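(* Let $\delta$ be a Berkeley cardinal and let $\langle\mathcal{M}_\delta,\mathcal{R}\rangle$ be the associated potentialist system. Then the propositional modal assertions $\varphi(p_0,\dots,p_n)$ that are valid in $\mathcal{M}_\delta$ (that is, valid at every world of $\mathcal{M}_\delta$, with respect to all substitution instances by assertions of the potentialist language $\mathrm{ZF}^\diamond$, with parameters) are exactly the modal assertions belonging to the modal theory S4.2.
   Context: Background theory: ZF (no Axiom of Choice). Berkeley cardinal: a cardinal $\delta$ is Berkeley if for every transitive set $M$ with $\delta\in M$ and every ordinal $\eta<\delta$ there is a non-trivial elementary embedding $j:M\to M$ (of $\langle M,\in\rangle$) with $\eta<\mathrm{crit}(j)<\delta$; non-trivial means $j$ is not the identity on the ordinals. The system: $\mathcal{M}_\delta$ is the class of all transitive sets $M$ with $\delta\in M$ (the "worlds", viewed as structures $\langle M,\in\rangle$). For $M,N\in\mathcal{M}_\delta$, $M\mathcal{R}N$ ("$M$ accesses $N$") iff $M\subseteq N$ and for every elementary embedding $j:N\to N$ (trivial or not), the restriction $j\restriction M$ is an elementary embedding from $M$ to $M$. Potentialist language: $\mathrm{ZF}^\diamond$ is the language of ZF (i.e. $\{\in\}$) augmented with the modal operators $\Diamond,\Box$. Truth at a world $M$ (with parameters from $M$): atomic formulas, connectives and quantifiers are interpreted as usual in $\langle M,\in\rangle$ (quantifiers range over $M$); $\Diamond\varphi$ holds at $M$ iff $\varphi$ holds at some $N\in\mathcal{M}_\delta$ with $M\mathcal{R}N$; $\Box\varphi$ holds at $M$ iff $\varphi$ holds at every $N\in\mathcal{M}_\delta$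 with $M\mathcal{R}N$. Validity: a propositional modal formula $\varphi(p_0,\dots,p_n)$ is valid at $M$ for a class of assertions if every substitution instance $\varphi(\psi_0,\dots,\psi_n)$, with $\psi_i$ in the class, is true at $M$; it is valid in $\mathcal{M}_\delta$ if it is valid at every world. The class of assertions here is all assertions of $\mathrm{ZF}^\diamond$, with parameters from the world. S4 is the closure under modus ponens and necessitation of (together with propositional tautologies) the axioms (K) $\Box(\varphi\to\psi)\to(\Box\varphi\to\Box\psi)$, (Dual) $\neg\Diamond\varphi\leftrightarrow\Box\neg\varphi$, (S) $\Box\varphi\to\varphi$, (4) $\Box\varphi\to\Box\Box\varphi$. S4.2 is obtained from S4 by adding the axiom (.2) $\Diamond\Box\varphi\to\Box\Diamond\varphi$ (with the same closure). *)

theory Defs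
  imports Main
begin

section \<open>Models of first-order ZF\<close>

text \<open>
  The background theory is ZF without choice. A theorem of ZF is rendered as a statement about
  every model \<open>(V, E)\<close> of \<^emph>\<open>first-order\<close> ZF, where \<open>E\<close> is an arbitrary binary relation on a type.
  It is essential that separation and replacement are the first-order schemes (with parameters):
  second-order replacement would import the choice principle of HOL into the model, and there are
  no Berkeley cardinals under the axiom of choice.
\<close>

datatype fm =
    FMem nat nat
  | FEq nat nat
  | FNeg fm
  | FAnd fm fm
  | FEx nat fm

primrec fsat :: "('v \<Rightarrow> 'v \<Rightarrow> bool) \<Rightarrow> fm \<Rightarrow> (nat \<Rightarrow> 'v) \<Rightarrow> bool" where
  "fsat E (FMem i k) s \<longleftrightarrow> E (s i) (s k)"
| "fsat E (FEq i k) s \<longleftrightarrow> s i = s k"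
| "fsat E (FNeg \<phi>) s \<longleftrightarrow> \<not> fsat E \<phi> s"
| "fsat E (FAnd \<phi> \<psi>) s \<longleftrightarrow> fsat E \<phi> s \<and> fsat E \<psi> s"
| "fsat E (FEx i \<phi>) s \<longleftrightarrow> (\<exists>x. fsat E \<phi> (s(i := x)))"

section \<open>Assertions of the potentialist language\<close>

datatype pfm =
    PMem nat nat
  | PEq nat nat
  | PNeg pfm
  | PAnd pfm pfm
  | POr pfm pfm
  | PImp pfm pfm
  | PIff pfm pfm
  | PAll nat pfm
  | PEx nat pfm
  | PBox pfm
  | PDia pfm

section \<open>Propositional modal logic\<close>

datatype mfm =
    Var nat
  | MNeg mfm
  | MAnd mfm mfm
  | MOr mfm mfm
  | MImp mfm mfm
  | MIff mfm mfm
  | MBox mfm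
  | MDia mfm

primrec instantiate :: "(nat \<Rightarrow> pfm) \<Rightarrow> mfm \<Rightarrow> pfm" where
  "instantiate \<psi> (Var i) = \<psi> i"
| "instantiate \<psi> (MNeg \<phi>) = PNeg (instantiate \<psi> \<phi>)"
| "instantiate \<psi> (MAnd \<phi> \<chi>) = PAnd (instantiate \<psi> \<phi>) (instantiate \<psi> \<chi>)"
| "instantiate \<psi> (MOr \<phi> \<chi>) = POr (instantiate \<psi> \<phi>) (instantiate \<psi> \<chi>)"
| "instantiate \<psi> (MImp \<phi> \<chi>) = PImp (instantiate \<psi> \<phi>) (instantiate \<psi> \<chi>)"
| "instantiate \<psi> (MIff \<phi> \<chi>) = PIff (instantiate \<psi> \<phi>) (instantiate \<psi> \<chi>)"
| "instantiate \<psi> (MBox \<phi>) = PBox (instantiate \<psi> \<phi>)"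
| "instantiate \<psi> (MDia \<phi>) = PDia (instantiate \<psi> \<phi>)"

text \<open>For propositional tautologies, boxed and diamond formulas count as atoms.\<close>

primrec prop_eval :: "(mfm \<Rightarrow> bool) \<Rightarrow> mfm \<Rightarrow> bool" where
  "prop_eval v (Var i) \<longleftrightarrow> v (Var i)"
| "prop_eval v (MNeg \<phi>) \<longleftrightarrow> \<not> prop_eval v \<phi>"
| "prop_eval v (MAnd \<phi> \<chi>) \<longleftrightarrow> prop_eval v \<phi> \<and> prop_eval v \<chi>"
| "prop_eval v (MOr \<phi> \<chi>) \<longleftrightarrow> prop_eval v \<phi> \<or> prop_eval v \<chi>"
| "prop_eval v (MImp \<phi> \<chi>) \<longleftrightarrow> (prop_eval v \<phi> \<longrightarrow> prop_eval v \<chi>)"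
| "prop_eval v (MIff \<phi> \<chi>) \<longleftrightarrow> (prop_eval v \<phi> \<longleftrightarrow> prop_eval v \<chi>)"
| "prop_eval v (MBox \<phi>) \<longleftrightarrow> v (MBox \<phi>)"
| "prop_eval v (MDia \<phi>) \<longleftrightarrow> v (MDia \<phi>)"

definition tautology :: "mfm \<Rightarrow> bool" where
  "tautology \<phi> \<longleftrightarrow> (\<forall>v. prop_eval v \<phi>)"

inductive_set S4_2 :: "mfm set" where
  taut: "tautology \<phi> \<Longrightarrow> \<phi> \<in> S4_2"
| K: "MImp (MBox (MImp \<phi> \<psi>)) (MImp (MBox \<phi>) (MBox \<psi>)) \<in> S4_2"
| Dual: "MIff (MNeg (MDia \<phi>)) (MBox (MNeg \<phi>)) \<in> S4_2"
| S: "MImp (MBox \<phi>) \<phi> \<in> S4_2"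
| Four: "MImp (MBox \<phi>) (MBox (MBox \<phi>)) \<in> S4_2"
| Dot2: "MImp (MDia (MBox \<phi>)) (MBox (MDia \<phi>)) \<in> S4_2"
| mp: "MImp \<phi> \<psi> \<in> S4_2 \<Longrightarrow> \<phi> \<in> S4_2 \<Longrightarrow> \<psi> \<in> S4_2"
| nec: "\<phi> \<in> S4_2 \<Longrightarrow> MBox \<phi> \<in> S4_2"

section \<open>Set theory inside a model of ZF\<close>

locale zf_model =
  fixes E :: "'v \<Rightarrow> 'v \<Rightarrow> bool"  (infix "\<^bold>\<in>" 50)
  assumes extensionality: "(\<forall>z. z \<^bold>\<in> x \<longleftrightarrow> z \<^bold>\<in> y) \<Longrightarrow> x = y"
    and foundation: "\<exists>y. y \<^bold>\<in> x \<Longrightarrow> \<exists>y. y \<^bold>\<in> x \<and> \<not> (\<exists>z. z \<^bold>\<in> x \<and> z \<^bold>\<in> y)"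
    and pairing: "\<exists>c. \<forall>x. x \<^bold>\<in> c \<longleftrightarrow> x = a \<or> x = b"
    and union: "\<exists>u. \<forall>x. x \<^bold>\<in> u \<longleftrightarrow> (\<exists>y. y \<^bold>\<in> a \<and> x \<^bold>\<in> y)"
    and powerset: "\<exists>p. \<forall>x. x \<^bold>\<in> p \<longleftrightarrow> (\<forall>y. y \<^bold>\<in> x \<longrightarrow> y \<^bold>\<in> a)"
    and infinity: "\<exists>w. (\<exists>e. e \<^bold>\<in> w \<and> (\<forall>x. \<not> x \<^bold>\<in> e)) \<and>
      (\<forall>x. x \<^bold>\<in> w \<longrightarrow> (\<exists>y. y \<^bold>\<in> w \<and> (\<forall>z. z \<^bold>\<in> y \<longleftrightarrow> z \<^bold>\<in> x \<or> z = x)))"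
    and separation: "\<exists>b. \<forall>x. x \<^bold>\<in> b \<longleftrightarrow> x \<^bold>\<in> a \<and> fsat E \<phi> (s(0 := x))"
    and replacement: "(\<forall>x. x \<^bold>\<in> a \<longrightarrow> (\<exists>!y. fsat E \<phi> (s(0 := x, 1 := y)))) \<Longrightarrow>
      \<exists>b. \<forall>y. y \<^bold>\<in> b \<longleftrightarrow> (\<exists>x. x \<^bold>\<in> a \<and> fsat E \<phi> (s(0 := x, 1 := y)))"
begin

text \<open>
  All notions below quantify only over elements of the model, so they are the usual set-theoretic
  notions evaluated inside it. In particular functions and embeddings are elements of the model.
\<close>

definition subset_of :: "'v \<Rightarrow> 'v \<Rightarrow> bool"  (infix "\<^bold>\<subseteq>" 50) where
  "x \<^bold>\<subseteq> y \<longleftrightarrow> (\<forall>z. z \<^bold>\<in> x \<longrightarrow> z \<^bold>\<in> y)"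

definition empty :: 'v where
  "empty = (THE e. \<forall>x. \<not> x \<^bold>\<in> e)"

definition succ :: "'v \<Rightarrow> 'v" where
  "succ x = (THE y. \<forall>z. z \<^bold>\<in> y \<longleftrightarrow> z \<^bold>\<in> x \<or> z = x)"

definition upair :: "'v \<Rightarrow> 'v \<Rightarrow> 'v" where
  "upair a b = (THE c. \<forall>x. x \<^bold>\<in> c \<longleftrightarrow> x = a \<or> x = b)"

definition opair :: "'v \<Rightarrow> 'v \<Rightarrow> 'v" where
  "opair a b = upair (upair a a) (upair a b)"

definition trans_set :: "'v \<Rightarrow> bool" where
  "trans_set x \<longleftrightarrow> (\<forall>y. y \<^bold>\<in> x \<longrightarrow> y \<^bold>\<subseteq> x)"

definition ordinal :: "'v \<Rightarrow> bool" where
  "ordinal x \<longleftrightarrow> trans_set x \<and> (\<forall>y. y \<^bold>\<in> x \<longrightarrow> trans_set y)"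

definition natural :: "'v \<Rightarrow> bool" where
  "natural n \<longleftrightarrow> ordinal n \<and> (\<forall>m. m \<^bold>\<in> n \<or> m = n \<longrightarrow> m = empty \<or> (\<exists>k. m = succ k))"

definition omega :: 'v where
  "omega = (THE w. \<forall>n. n \<^bold>\<in> w \<longleftrightarrow> natural n)"

definition maps :: "'v \<Rightarrow> 'v \<Rightarrow> 'v \<Rightarrow> bool" where
  "maps f a b \<longleftrightarrow>
    (\<forall>z. z \<^bold>\<in> f \<longrightarrow> (\<exists>x y. x \<^bold>\<in> a \<and> y \<^bold>\<in> b \<and> z = opair x y)) \<and>
    (\<forall>x. x \<^bold>\<in> a \<longrightarrow> (\<exists>!y. opair x y \<^bold>\<in> f))"

definition app :: "'v \<Rightarrow> 'v \<Rightarrow> 'v" where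
  "app f x = (THE y. opair x y \<^bold>\<in> f)"

definition restriction :: "'v \<Rightarrow> 'v \<Rightarrow> 'v" where
  "restriction f a =
    (THE g. \<forall>z. z \<^bold>\<in> g \<longleftrightarrow> z \<^bold>\<in> f \<and> (\<exists>x y. x \<^bold>\<in> a \<and> z = opair x y))"

definition cardinal :: "'v \<Rightarrow> bool" where
  "cardinal \<kappa> \<longleftrightarrow> ordinal \<kappa> \<and>
    \<not> (\<exists>\<alpha> f. \<alpha> \<^bold>\<in> \<kappa> \<and> maps f \<alpha> \<kappa> \<and> (\<forall>y. y \<^bold>\<in> \<kappa> \<longrightarrow> (\<exists>!x. x \<^bold>\<in> \<alpha> \<and> app f x = y)))"

subsection \<open>Internal satisfaction and elementary embeddings\<close>

text \<open>
  Since the structures \<open>M\<close> are sets of the model, elementarity refers to the model's own formulas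
  (the model may have nonstandard natural numbers), coded as sets, and to the model's own Tarskian
  satisfaction relation. Assignments are functions from \<^term>\<open>omega\<close> to \<open>M\<close>.
\<close>

definition cMem :: "'v \<Rightarrow> 'v \<Rightarrow> 'v" where
  "cMem i k = opair empty (opair i k)"

definition cEq :: "'v \<Rightarrow> 'v \<Rightarrow> 'v" where
  "cEq i k = opair (succ empty) (opair i k)"

definition cNeg :: "'v \<Rightarrow> 'v" where
  "cNeg p = opair (succ (succ empty)) p"

definition cAnd :: "'v \<Rightarrow> 'v \<Rightarrow> 'v" where
  "cAnd p q = opair (succ (succ (succ empty))) (opair p q)"

definition cEx :: "'v \<Rightarrow> 'v \<Rightarrow> 'v" where
  "cEx i p = opair (succ (succ (succ (succ empty)))) (opair i p)"

definition code_closed :: "'v \<Rightarrow> bool" where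
  "code_closed X \<longleftrightarrow>
    (\<forall>i k. i \<^bold>\<in> omega \<and> k \<^bold>\<in> omega \<longrightarrow> cMem i k \<^bold>\<in> X \<and> cEq i k \<^bold>\<in> X) \<and>
    (\<forall>p. p \<^bold>\<in> X \<longrightarrow> cNeg p \<^bold>\<in> X) \<and>
    (\<forall>p q. p \<^bold>\<in> X \<and> q \<^bold>\<in> X \<longrightarrow> cAnd p q \<^bold>\<in> X) \<and>
    (\<forall>i p. i \<^bold>\<in> omega \<and> p \<^bold>\<in> X \<longrightarrow> cEx i p \<^bold>\<in> X)"

definition code :: "'v \<Rightarrow> bool" where
  "code p \<longleftrightarrow> (\<forall>X. code_closed X \<longrightarrow> p \<^bold>\<in> X)"

definition satisfaction_rel :: "'v \<Rightarrow> 'v \<Rightarrow> bool" where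
  "satisfaction_rel M S \<longleftrightarrow> (\<forall>s. maps s omega M \<longrightarrow>
    (\<forall>i k. i \<^bold>\<in> omega \<and> k \<^bold>\<in> omega \<longrightarrow>
      (opair (cMem i k) s \<^bold>\<in> S \<longleftrightarrow> app s i \<^bold>\<in> app s k) \<and>
      (opair (cEq i k) s \<^bold>\<in> S \<longleftrightarrow> app s i = app s k)) \<and>
    (\<forall>p. code p \<longrightarrow>
      (opair (cNeg p) s \<^bold>\<in> S \<longleftrightarrow> \<not> opair p s \<^bold>\<in> S)) \<and>
    (\<forall>p q. code p \<and> code q \<longrightarrow>
      (opair (cAnd p q) s \<^bold>\<in> S \<longleftrightarrow> opair p s \<^bold>\<in> S \<and> opair q s \<^bold>\<in> S)) \<and>
    (\<forall>i p. i \<^bold>\<in> omega \<and> code p \<longrightarrow>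
      (opair (cEx i p) s \<^bold>\<in> S \<longleftrightarrow>
        (\<exists>t. maps t omega M \<and> (\<forall>k. k \<^bold>\<in> omega \<and> k \<noteq> i \<longrightarrow> app t k = app s k) \<and>
          opair p t \<^bold>\<in> S))))"

definition models :: "'v \<Rightarrow> 'v \<Rightarrow> 'v \<Rightarrow> bool" where
  "models M p s \<longleftrightarrow> (\<exists>S. satisfaction_rel M S \<and> opair p s \<^bold>\<in> S)"

definition elementary :: "'v \<Rightarrow> 'v \<Rightarrow> 'v \<Rightarrow> bool" where
  "elementary j M N \<longleftrightarrow> maps j M N \<and>
    (\<forall>p s t. code p \<and> maps s omega M \<and> maps t omega N \<and>
        (\<forall>i. i \<^bold>\<in> omega \<longrightarrow> app t i = app j (app s i)) \<longrightarrow>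
      (models M p s \<longleftrightarrow> models N p t))"

subsection \<open>Berkeley cardinals\<close>

definition nontrivial :: "'v \<Rightarrow> 'v \<Rightarrow> bool" where
  "nontrivial j M \<longleftrightarrow> (\<exists>\<alpha>. ordinal \<alpha> \<and> \<alpha> \<^bold>\<in> M \<and> app j \<alpha> \<noteq> \<alpha>)"

definition critical_point :: "'v \<Rightarrow> 'v \<Rightarrow> 'v \<Rightarrow> bool" where
  "critical_point j M \<kappa> \<longleftrightarrow> ordinal \<kappa> \<and> \<kappa> \<^bold>\<in> M \<and> app j \<kappa> \<noteq> \<kappa> \<and>
    (\<forall>\<alpha>. \<alpha> \<^bold>\<in> \<kappa> \<and> \<alpha> \<^bold>\<in> M \<longrightarrow> app j \<alpha> = \<alpha>)"

text \<open>
  The condition \<open>\<delta> \<noteq> empty\<close> only rules out the degenerate case in which the quantification over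
  \<open>\<eta> < \<delta>\<close> is vacuous; no other finite ordinal satisfies the remaining conditions.
\<close>

definition berkeley :: "'v \<Rightarrow> bool" where
  "berkeley \<delta> \<longleftrightarrow> cardinal \<delta> \<and> \<delta> \<noteq> empty \<and>
    (\<forall>M \<eta>. trans_set M \<and> \<delta> \<^bold>\<in> M \<and> \<eta> \<^bold>\<in> \<delta> \<longrightarrow>
      (\<exists>j \<kappa>. elementary j M M \<and> nontrivial j M \<and> critical_point j M \<kappa> \<and>
        \<eta> \<^bold>\<in> \<kappa> \<and> \<kappa> \<^bold>\<in> \<delta>))"

subsection \<open>The potentialist system\<close>

definition world :: "'v \<Rightarrow> 'v \<Rightarrow> bool" where
  "world \<delta> M \<longleftrightarrow> trans_set M \<and> \<delta> \<^bold>\<in> M"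

definition accesses :: "'v \<Rightarrow> 'v \<Rightarrow> bool"  (infix "\<R>" 50) where
  "M \<R> N \<longleftrightarrow> M \<^bold>\<subseteq> N \<and>
    (\<forall>j. elementary j N N \<longrightarrow> elementary (restriction j M) M M)"

primrec psat :: "'v \<Rightarrow> pfm \<Rightarrow> 'v \<Rightarrow> (nat \<Rightarrow> 'v) \<Rightarrow> bool" where
  "psat \<delta> (PMem i k) M s \<longleftrightarrow> s i \<^bold>\<in> s k"
| "psat \<delta> (PEq i k) M s \<longleftrightarrow> s i = s k"
| "psat \<delta> (PNeg \<phi>) M s \<longleftrightarrow> \<not> psat \<delta> \<phi> M s"
| "psat \<delta> (PAnd \<phi> \<chi>) M s \<longleftrightarrow> psat \<delta> \<phi> M s \<and> psat \<delta> \<chi> M s"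
| "psat \<delta> (POr \<phi> \<chi>) M s \<longleftrightarrow> psat \<delta> \<phi> M s \<or> psat \<delta> \<chi> M s"
| "psat \<delta> (PImp \<phi> \<chi>) M s \<longleftrightarrow> (psat \<delta> \<phi> M s \<longrightarrow> psat \<delta> \<chi> M s)"
| "psat \<delta> (PIff \<phi> \<chi>) M s \<longleftrightarrow> (psat \<delta> \<phi> M s \<longleftrightarrow> psat \<delta> \<chi> M s)"
| "psat \<delta> (PAll i \<phi>) M s \<longleftrightarrow> (\<forall>x. x \<^bold>\<in> M \<longrightarrow> psat \<delta> \<phi> M (s(i := x)))"
| "psat \<delta> (PEx i \<phi>) M s \<longleftrightarrow> (\<exists>x. x \<^bold>\<in> M \<and> psat \<delta> \<phi> M (s(i := x)))"
| "psat \<delta> (PBox \<phi>) M s \<longleftrightarrow> (\<forall>N. world \<delta> N \<and> M \<R> N \<longrightarrow> psat \<delta> \<phi> N s)"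
| "psat \<delta> (PDia \<phi>) M s \<longleftrightarrow> (\<exists>N. world \<delta> N \<and> M \<R> N \<and> psat \<delta> \<phi> N s)"

text \<open>
  The parameters of the substituted assertions are the values of the assignment \<open>s\<close>. A single
  assignment suffices: different \<open>\<psi> i\<close> can use different variables, of which there are infinitely
  many.
\<close>

definition valid_at :: "'v \<Rightarrow> 'v \<Rightarrow> mfm \<Rightarrow> bool" where
  "valid_at \<delta> M \<phi> \<longleftrightarrow>
    (\<forall>\<psi> s. (\<forall>i. s i \<^bold>\<in> M) \<longrightarrow> psat \<delta> (instantiate \<psi> \<phi>) M s)"

definition valid :: "'v \<Rightarrow> mfm \<Rightarrow> bool" where
  "valid \<delta> \<phi> \<longleftrightarrow> (\<forall>M. world \<delta> M \<longrightarrow> valid_at \<delta> M \<phi>)"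

end

end

theory Submission
  imports Defs
begin

text \<open>
  Soundness of the axiom (.2) is directedness of the accessibility relation: a world can be chosen
  with a single element that belongs to no other, coding two given worlds and their satisfaction
  relations; every elementary embedding fixes this element, hence restricts to both worlds.

  Conversely, a formula outside S4.2 fails at the root of a finite directed preorder. Over the world
  \<open>(\<delta> + 1) \<union> \<omega>\<close>, whose elements are ordinals, the statements ``\<open>(i + 4) \<setminus> {0}\<close> exists'' are independent
  buttons, and the choice of the maximal element of a world serves as a dial that can be turned
  freely without pushing buttons. The finite preorder is a bounded morphic image of the states of
  such buttons and a dial, so the failure is simulated at a world.
\<close>

subsection \<open>Completeness of S4.2 for finite rooted directed preorders\<close>

text \<open>Two obstacles shape the work inside the model. Its separation and replacement reach only
  first-order formulas with parameters, so no set can be carved out by an arbitrary HOL predicate;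
  each construction comes with a proof that its predicate is \<open>definable\<close>. Moreover the
  natural numbers and codes of the model may be nonstandard, so induction and recursion over them
  are internal, and HOL induction on \<open>nat\<close> or \<open>fm\<close> covers only the
  standard part. For the converse, the danger is that the machinery of an extension (pairs,
  assignments, satisfaction relations) pushes a button unasked. The extension is therefore built
  from few recognizable kinds of sets, and the buttons are chosen to be of none of these kinds. The
  dial turns because maximality is lost: an old maximal element lies in an element of the extension,
  where a new one with a freely chosen first component takes over. Worlds not produced in this way
  may have any number of maximal elements, so the map to the finite preorder has to accept arbitrary
  dial readings.\<close>

primrec ksat :: "'w set \<Rightarrow> ('w \<Rightarrow> 'w \<Rightarrow> bool) \<Rightarrow> ('w \<Rightarrow> nat \<Rightarrow> bool) \<Rightarrow> mfm \<Rightarrow> 'w \<Rightarrow> bool" where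
  "ksat W R V (Var i) x \<longleftrightarrow> V x i"
| "ksat W R V (MNeg \<phi>) x \<longleftrightarrow> \<not> ksat W R V \<phi> x"
| "ksat W R V (MAnd \<phi> \<chi>) x \<longleftrightarrow> ksat W R V \<phi> x \<and> ksat W R V \<chi> x"
| "ksat W R V (MOr \<phi> \<chi>) x \<longleftrightarrow> ksat W R V \<phi> x \<or> ksat W R V \<chi> x"
| "ksat W R V (MImp \<phi> \<chi>) x \<longleftrightarrow> (ksat W R V \<phi> x \<longrightarrow> ksat W R V \<chi> x)"
| "ksat W R V (MIff \<phi> \<chi>) x \<longleftrightarrow> (ksat W R V \<phi> x \<longleftrightarrow> ksat W R V \<chi> x)"
| "ksat W R V (MBox \<phi>) x \<longleftrightarrow> (\<forall>y\<in>W. R x y \<longrightarrow> ksat W R V \<phi> y)"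
| "ksat W R V (MDia \<phi>) x \<longleftrightarrow> (\<exists>y\<in>W. R x y \<and> ksat W R V \<phi> y)"

primrec subformulas :: "mfm \<Rightarrow> mfm set" where
  "subformulas (Var i) = {Var i}"
| "subformulas (MNeg \<phi>) = insert (MNeg \<phi>) (subformulas \<phi>)"
| "subformulas (MAnd \<phi> \<chi>) = insert (MAnd \<phi> \<chi>) (subformulas \<phi> \<union> subformulas \<chi>)"
| "subformulas (MOr \<phi> \<chi>) = insert (MOr \<phi> \<chi>) (subformulas \<phi> \<union> subformulas \<chi>)"
| "subformulas (MImp \<phi> \<chi>) = insert (MImp \<phi> \<chi>) (subformulas \<phi> \<union> subformulas \<chi>)"
| "subformulas (MIff \<phi> \<chi>) = insert (MIff \<phi> \<chi>) (subformulas \<phi> \<union> subformulas \<chi>)"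
| "subformulas (MBox \<phi>) = insert (MBox \<phi>) (subformulas \<phi>)"
| "subformulas (MDia \<phi>) = insert (MDia \<phi>) (subformulas \<phi>)"

lemma finite_subformulas: "finite (subformulas \<phi>)"
  by (induction \<phi>) auto

section \<open>Derivability in S4.2, with and without premises\<close>

abbreviation MBot :: mfm where
  "MBot \<equiv> MAnd (Var 0) (MNeg (Var 0))"

lemma prop_eval_foldr_MImp:
  "prop_eval v (foldr MImp xs \<phi>) \<longleftrightarrow> ((\<forall>x\<in>set xs. prop_eval v x) \<longrightarrow> prop_eval v \<phi>)"
  by (induction xs) auto

lemma prop_eval_foldr_MAnd:
  "prop_eval v (foldr MAnd xs \<phi>) \<longleftrightarrow> (\<forall>x\<in>set xs. prop_eval v x) \<and> prop_eval v \<phi>"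
  by (induction xs) auto

text \<open>Turns propositional reasoning in S4.2 into truth-table checks: the implication is a
  tautology, and modus ponens does the rest.\<close>

lemma S4_2_conseq:
  assumes "\<phi> \<in> S4_2" "\<And>v. prop_eval v \<phi> \<Longrightarrow> prop_eval v \<psi>"
  shows "\<psi> \<in> S4_2"
proof -
  have "MImp \<phi> \<psi> \<in> S4_2"
    using assms(2) by (auto intro!: S4_2.taut simp: tautology_def)
  with assms(1) show ?thesis by (rule S4_2.mp[rotated])
qed

lemma S4_2_conseq2:
  assumes "\<phi> \<in> S4_2" "\<chi> \<in> S4_2" "\<And>v. prop_eval v \<phi> \<Longrightarrow> prop_eval v \<chi> \<Longrightarrow> prop_eval v \<psi>"
  shows "\<psi> \<in> S4_2"
proof -
  have "MImp \<phi> (MImp \<chi> \<psi>) \<in> S4_2"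
    using assms(3) by (auto intro!: S4_2.taut simp: tautology_def)
  with assms(1,2) show ?thesis by (meson S4_2.mp)
qed

text \<open>The premises stand to the left of implications, so necessitation is never applied to
  them. This is the local consequence relation, for which the deduction theorem holds.\<close>

definition derives :: "mfm set \<Rightarrow> mfm \<Rightarrow> bool" where
  "derives \<Gamma> \<phi> \<longleftrightarrow> (\<exists>xs. set xs \<subseteq> \<Gamma> \<and> foldr MImp xs \<phi> \<in> S4_2)"

lemma derives_S4_2: "\<phi> \<in> S4_2 \<Longrightarrow> derives \<Gamma> \<phi>"
  unfolding derives_def by (rule exI[of _ "[]"]) auto

lemma derives_conseq:
  assumes "derives \<Gamma> \<phi>" "\<And>v. prop_eval v \<phi> \<Longrightarrow> prop_eval v \<psi>"
  shows "derives \<Gamma> \<psi>"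
proof -
  obtain xs where xs: "set xs \<subseteq> \<Gamma>" "foldr MImp xs \<phi> \<in> S4_2"
    using assms(1) by (auto simp: derives_def)
  from xs(2) have "foldr MImp xs \<psi> \<in> S4_2"
    by (rule S4_2_conseq) (use assms(2) in \<open>auto simp: prop_eval_foldr_MImp\<close>)
  with xs(1) show ?thesis by (auto simp: derives_def)
qed

lemma derives_conseq2:
  assumes "derives \<Gamma> \<phi>" "derives \<Gamma> \<chi>"
    and "\<And>v. prop_eval v \<phi> \<Longrightarrow> prop_eval v \<chi> \<Longrightarrow> prop_eval v \<psi>"
  shows "derives \<Gamma> \<psi>"
proof -
  obtain xs ys where xs: "set xs \<subseteq> \<Gamma>" "foldr MImp xs \<phi> \<in> S4_2"
    and ys: "set ys \<subseteq> \<Gamma>" "foldr MImp ys \<chi> \<in> S4_2"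
    using assms(1,2) by (auto simp: derives_def)
  from xs(2) ys(2) have "foldr MImp (xs @ ys) \<psi> \<in> S4_2"
    by (rule S4_2_conseq2) (simp add: prop_eval_foldr_MImp ball_Un del: foldr_append, use assms(3) in blast)
  with xs(1) ys(1) show ?thesis
    unfolding derives_def by (intro exI[of _ "xs @ ys"]) auto
qed

lemma derives_assumption:
  assumes "\<phi> \<in> \<Gamma>"
  shows "derives \<Gamma> \<phi>"
  unfolding derives_def
  by (rule exI[of _ "[\<phi>]"]) (use assms in \<open>auto intro!: S4_2.taut simp: tautology_def\<close>)

text \<open>The deduction theorem. Since the premises form a list, all occurrences of the discharged
  formula are filtered out together.\<close>

lemma derives_insert:
  assumes "derives (insert \<phi> \<Gamma>) \<psi>"
  shows "derives \<Gamma> (MImp \<phi> \<psi>)"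
proof -
  obtain xs where xs: "set xs \<subseteq> insert \<phi> \<Gamma>" "foldr MImp xs \<psi> \<in> S4_2"
    using assms by (auto simp: derives_def)
  let ?ys = "filter (\<lambda>x. x \<noteq> \<phi>) xs"
  from xs(2) have "foldr MImp ?ys (MImp \<phi> \<psi>) \<in> S4_2"
    by (rule S4_2_conseq) (auto simp: prop_eval_foldr_MImp)
  with xs(1) show ?thesis
    unfolding derives_def by (intro exI[of _ ?ys]) auto
qed

section \<open>Maximal consistent sets\<close>

definition mcs :: "mfm set \<Rightarrow> bool" where
  "mcs \<Gamma> \<longleftrightarrow> \<not> derives \<Gamma> MBot \<and> (\<forall>\<phi>. \<phi> \<in> \<Gamma> \<or> MNeg \<phi> \<in> \<Gamma>)"

text \<open>A derivation uses finitely many premises, which lie in one member of a chain, so unions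
  of chains stay consistent. Zorn's lemma is applied to sets of modal formulas in HOL; it puts no
  choice into the model of ZF.\<close>

lemma lindenbaum:
  assumes "\<not> derives \<Gamma> MBot"
  obtains \<Delta> where "\<Gamma> \<subseteq> \<Delta>" "mcs \<Delta>"
proof -
  let ?A = "{\<Delta>. \<Gamma> \<subseteq> \<Delta> \<and> \<not> derives \<Delta> MBot}"
  have "\<exists>M\<in>?A. \<forall>X\<in>?A. M \<subseteq> X \<longrightarrow> X = M"
  proof (rule subset_Zorn_nonempty)
    show "?A \<noteq> {}" using assms by auto
  next
    fix C assume C: "C \<noteq> {}" "subset.chain ?A C"
    have "\<not> derives (\<Union>C) MBot"
    proof
      assume "derives (\<Union>C) MBot"
      then obtain xs where xs: "set xs \<subseteq> \<Union>C" "foldr MImp xs MBot \<in> S4_2"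
        by (auto simp: derives_def)
      obtain D where D: "D \<in> C" "set xs \<subseteq> D"
        using finite_subset_Union_chain[OF _ xs(1) C] by auto
      then have "derives D MBot" using xs(2) by (auto simp: derives_def)
      moreover have "D \<in> ?A" using D(1) C(2) by (auto simp: subset.chain_def)
      ultimately show False by simp
    qed
    moreover have "\<Gamma> \<subseteq> \<Union>C"
    proof -
      obtain D where "D \<in> C" using C(1) by blast
      moreover from this have "\<Gamma> \<subseteq> D" using C(2) by (auto simp: subset.chain_def)
      ultimately show ?thesis by blast
    qed
    ultimately show "\<Union>C \<in> ?A" by simp
  qed
  then obtain \<Delta> where mem: "\<Delta> \<in> ?A" and max0: "\<forall>X\<in>?A. \<Delta> \<subseteq> X \<longrightarrow> X = \<Delta>"
    by (rule bexE)
  have \<Delta>: "\<Gamma> \<subseteq> \<Delta>" "\<not> derives \<Delta> MBot" using mem by simp_all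
  have max: "X = \<Delta>" if "\<Gamma> \<subseteq> X" "\<not> derives X MBot" "\<Delta> \<subseteq> X" for X
    using max0[rule_format, of X] that by simp
  have "\<phi> \<in> \<Delta> \<or> MNeg \<phi> \<in> \<Delta>" for \<phi>
  proof (rule ccontr)
    assume neg: "\<not> (\<phi> \<in> \<Delta> \<or> MNeg \<phi> \<in> \<Delta>)"
    have *: "derives (insert \<psi> \<Delta>) MBot" if "\<psi> \<notin> \<Delta>" for \<psi>
      using max[of "insert \<psi> \<Delta>"] that \<Delta>(1) by blast
    have "derives \<Delta> (MImp \<phi> MBot)" "derives \<Delta> (MImp (MNeg \<phi>) MBot)"
      using * neg by (auto intro!: derives_insert)
    then have "derives \<Delta> MBot"
      by (rule derives_conseq2) auto
    with \<Delta>(2) show False by simp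
  qed
  with \<Delta> have "mcs \<Delta>" by (auto simp: mcs_def)
  with \<Delta>(1) show thesis by (rule that)
qed

lemma mcs_closed:
  assumes "mcs \<Gamma>" "derives \<Gamma> \<phi>"
  shows "\<phi> \<in> \<Gamma>"
proof (rule ccontr)
  assume "\<phi> \<notin> \<Gamma>"
  then have "derives \<Gamma> (MNeg \<phi>)"
    using assms(1) by (auto simp: mcs_def intro: derives_assumption)
  with assms(2) have "derives \<Gamma> MBot" by (rule derives_conseq2) auto
  with assms(1) show False by (simp add: mcs_def)
qed

lemma mcs_theorem: "mcs \<Gamma> \<Longrightarrow> \<phi> \<in> S4_2 \<Longrightarrow> \<phi> \<in> \<Gamma>"
  by (simp add: mcs_closed derives_S4_2)

lemma mcs_neg_iff:
  assumes "mcs \<Gamma>"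
  shows "MNeg \<phi> \<in> \<Gamma> \<longleftrightarrow> \<phi> \<notin> \<Gamma>"
proof
  assume "MNeg \<phi> \<in> \<Gamma>"
  show "\<phi> \<notin> \<Gamma>"
  proof
    assume "\<phi> \<in> \<Gamma>"
    then have "derives \<Gamma> \<phi>" "derives \<Gamma> (MNeg \<phi>)"
      using \<open>MNeg \<phi> \<in> \<Gamma>\<close> by (auto intro: derives_assumption)
    then have "derives \<Gamma> MBot" by (rule derives_conseq2) auto
    with assms show False by (simp add: mcs_def)
  qed
qed (use assms in \<open>auto simp: mcs_def\<close>)

lemma mcs_conseq:
  assumes "mcs \<Gamma>" "\<phi> \<in> \<Gamma>" "\<And>v. prop_eval v \<phi> \<Longrightarrow> prop_eval v \<psi>"
  shows "\<psi> \<in> \<Gamma>"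
  by (rule mcs_closed[OF assms(1)])
    (rule derives_conseq[OF derives_assumption[OF assms(2)]], rule assms(3))

lemma mcs_conseq2:
  assumes "mcs \<Gamma>" "\<phi> \<in> \<Gamma>" "\<chi> \<in> \<Gamma>"
    and "\<And>v. prop_eval v \<phi> \<Longrightarrow> prop_eval v \<chi> \<Longrightarrow> prop_eval v \<psi>"
  shows "\<psi> \<in> \<Gamma>"
  by (rule mcs_closed[OF assms(1)])
    (rule derives_conseq2[OF derives_assumption[OF assms(2)] derives_assumption[OF assms(3)]],
      rule assms(4))

text \<open>Membership in a maximal consistent set acts as a valuation whose atoms include boxed and
  diamond formulas. This settles the Boolean cases of the truth lemma.\<close>

lemma mcs_prop_eval:
  assumes "mcs \<Gamma>"
  shows "prop_eval (\<lambda>\<chi>. \<chi> \<in> \<Gamma>) \<phi> \<longleftrightarrow> \<phi> \<in> \<Gamma>"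
proof (induction \<phi>)
  case (MNeg \<phi>)
  then show ?case by (simp add: mcs_neg_iff[OF assms])
next
  case (MAnd \<phi> \<chi>)
  have "\<phi> \<in> \<Gamma>" "\<chi> \<in> \<Gamma>" if "MAnd \<phi> \<chi> \<in> \<Gamma>"
    by (rule mcs_conseq[OF assms that], simp)+
  moreover have "MAnd \<phi> \<chi> \<in> \<Gamma>" if "\<phi> \<in> \<Gamma>" "\<chi> \<in> \<Gamma>"
    by (rule mcs_conseq2[OF assms that], simp)
  ultimately show ?case using MAnd by auto
next
  case (MOr \<phi> \<chi>)
  have "MOr \<phi> \<chi> \<in> \<Gamma>" if "\<phi> \<in> \<Gamma>"
    by (rule mcs_conseq[OF assms that], simp)
  moreover have "MOr \<phi> \<chi> \<in> \<Gamma>" if "\<chi> \<in> \<Gamma>"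
    by (rule mcs_conseq[OF assms that], simp)
  moreover have "\<chi> \<in> \<Gamma>" if "MOr \<phi> \<chi> \<in> \<Gamma>" "MNeg \<phi> \<in> \<Gamma>"
    by (rule mcs_conseq2[OF assms that], simp)
  ultimately show ?case using MOr mcs_neg_iff[OF assms, of \<phi>] by auto
next
  case (MImp \<phi> \<chi>)
  have "MImp \<phi> \<chi> \<in> \<Gamma>" if "MNeg \<phi> \<in> \<Gamma>"
    by (rule mcs_conseq[OF assms that], simp)
  moreover have "MImp \<phi> \<chi> \<in> \<Gamma>" if "\<chi> \<in> \<Gamma>"
    by (rule mcs_conseq[OF assms that], simp)
  moreover have "\<chi> \<in> \<Gamma>" if "MImp \<phi> \<chi> \<in> \<Gamma>" "\<phi> \<in> \<Gamma>"
    by (rule mcs_conseq2[OF assms that], simp)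
  ultimately show ?case using MImp mcs_neg_iff[OF assms, of \<phi>] by auto
next
  case (MIff \<phi> \<chi>)
  have "MIff \<phi> \<chi> \<in> \<Gamma>" if "\<phi> \<in> \<Gamma>" "\<chi> \<in> \<Gamma>"
    by (rule mcs_conseq2[OF assms that], simp)
  moreover have "MIff \<phi> \<chi> \<in> \<Gamma>" if "MNeg \<phi> \<in> \<Gamma>" "MNeg \<chi> \<in> \<Gamma>"
    by (rule mcs_conseq2[OF assms that], simp)
  moreover have "\<chi> \<in> \<Gamma>" if "MIff \<phi> \<chi> \<in> \<Gamma>" "\<phi> \<in> \<Gamma>"
    by (rule mcs_conseq2[OF assms that], simp)
  moreover have "\<phi> \<in> \<Gamma>" if "MIff \<phi> \<chi> \<in> \<Gamma>" "\<chi> \<in> \<Gamma>"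
    by (rule mcs_conseq2[OF assms that], simp)
  ultimately have "MIff \<phi> \<chi> \<in> \<Gamma> \<longleftrightarrow> (\<phi> \<in> \<Gamma> \<longleftrightarrow> \<chi> \<in> \<Gamma>)"
    unfolding mcs_neg_iff[OF assms] by blast
  with MIff show ?case by simp
qed simp_all

lemma mcs_mp:
  assumes "mcs \<Gamma>" "MImp \<phi> \<psi> \<in> S4_2" "\<phi> \<in> \<Gamma>"
  shows "\<psi> \<in> \<Gamma>"
  using mcs_conseq2[OF assms(1) mcs_theorem[OF assms(1,2)] assms(3)] by simp

lemma mcs_dia_iff:
  assumes "mcs \<Gamma>"
  shows "MDia \<phi> \<in> \<Gamma> \<longleftrightarrow> MBox (MNeg \<phi>) \<notin> \<Gamma>"
proof -
  have "MIff (MNeg (MDia \<phi>)) (MBox (MNeg \<phi>)) \<in> \<Gamma>"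
    by (rule mcs_theorem[OF assms S4_2.Dual])
  then show ?thesis
    using mcs_prop_eval[OF assms, of "MIff (MNeg (MDia \<phi>)) (MBox (MNeg \<phi>))"] by auto
qed

text \<open>Axiom K iterated along the list of premises; with necessitation it boxes a whole
  derivation.\<close>

lemma S4_2_box_foldr:
  "MImp (MBox (foldr MImp xs \<psi>)) (foldr MImp (map MBox xs) (MBox \<psi>)) \<in> S4_2"
proof (induction xs)
  case Nil
  show ?case by (auto intro!: S4_2.taut simp: tautology_def)
next
  case (Cons x xs)
  have "MImp (MBox (foldr MImp (x # xs) \<psi>)) (MImp (MBox x) (MBox (foldr MImp xs \<psi>))) \<in> S4_2"
    using S4_2.K by simp
  from this Cons show ?case by (rule S4_2_conseq2) auto
qed

lemma mcs_box_closed: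
  assumes "mcs \<Gamma>" "derives {\<chi>. MBox \<chi> \<in> \<Gamma>} \<phi>"
  shows "MBox \<phi> \<in> \<Gamma>"
proof -
  obtain xs where xs: "set xs \<subseteq> {\<chi>. MBox \<chi> \<in> \<Gamma>}" "foldr MImp xs \<phi> \<in> S4_2"
    using assms(2) by (auto simp: derives_def)
  have "foldr MImp (map MBox xs) (MBox \<phi>) \<in> S4_2"
    by (rule S4_2.mp[OF S4_2_box_foldr S4_2.nec[OF xs(2)]])
  moreover have "set (map MBox xs) \<subseteq> \<Gamma>" using xs(1) by auto
  ultimately have "derives \<Gamma> (MBox \<phi>)" unfolding derives_def by blast
  with assms(1) show ?thesis by (rule mcs_closed)
qed

section \<open>The canonical relation and its frame properties\<close>

definition canonical :: "mfm set \<Rightarrow> mfm set \<Rightarrow> bool" where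
  "canonical \<Gamma> \<Delta> \<longleftrightarrow> (\<forall>\<chi>. MBox \<chi> \<in> \<Gamma> \<longrightarrow> \<chi> \<in> \<Delta>)"

lemma canonical_refl: "mcs \<Gamma> \<Longrightarrow> canonical \<Gamma> \<Gamma>"
  unfolding canonical_def by (blast intro: mcs_mp[OF _ S4_2.S])

lemma canonical_box:
  "mcs \<Gamma> \<Longrightarrow> canonical \<Gamma> \<Delta> \<Longrightarrow> MBox \<chi> \<in> \<Gamma> \<Longrightarrow> MBox \<chi> \<in> \<Delta>"
  unfolding canonical_def by (blast intro: mcs_mp[OF _ S4_2.Four])

lemma canonical_trans:
  "mcs \<Gamma> \<Longrightarrow> canonical \<Gamma> \<Delta> \<Longrightarrow> canonical \<Delta> \<Theta> \<Longrightarrow> canonical \<Gamma> \<Theta>"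
  using canonical_box unfolding canonical_def by blast

lemma canonical_dia:
  assumes "mcs \<Gamma>" "mcs \<Delta>" "canonical \<Gamma> \<Delta>" "MDia \<chi> \<in> \<Delta>"
  shows "MDia \<chi> \<in> \<Gamma>"
  using assms canonical_box[OF assms(1,3)] by (auto simp: mcs_dia_iff)

text \<open>If the negation of \<phi> were inconsistent with the unboxed formulas of \<Gamma>, these
  would derive \<phi>, and \<open>mcs_box_closed\<close> would put \<open>MBox \<phi>\<close> into
  \<Gamma>.\<close>

lemma canonical_successor:
  assumes "mcs \<Gamma>" "MBox \<phi> \<notin> \<Gamma>"
  obtains \<Delta> where "mcs \<Delta>" "canonical \<Gamma> \<Delta>" "\<phi> \<notin> \<Delta>"
proof -
  have "\<not> derives (insert (MNeg \<phi>) {\<chi>. MBox \<chi> \<in> \<Gamma>}) MBot"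
  proof
    assume "derives (insert (MNeg \<phi>) {\<chi>. MBox \<chi> \<in> \<Gamma>}) MBot"
    then have "derives {\<chi>. MBox \<chi> \<in> \<Gamma>} (MImp (MNeg \<phi>) MBot)" by (rule derives_insert)
    then have "derives {\<chi>. MBox \<chi> \<in> \<Gamma>} \<phi>" by (rule derives_conseq) auto
    with assms show False by (simp add: mcs_box_closed)
  qed
  then obtain \<Delta> where "insert (MNeg \<phi>) {\<chi>. MBox \<chi> \<in> \<Gamma>} \<subseteq> \<Delta>" "mcs \<Delta>"
    by (rule lindenbaum)
  then show thesis
    by (intro that) (auto simp: canonical_def mcs_neg_iff)
qed

text \<open>If the unboxed formulas of both sets clashed, some conjunction \<open>c\<close> of those
  from \<Delta>2 would be refuted by those from \<Delta>1. Then \<open>MBox (MNeg c)\<close> is in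
  \<Delta>1, so \<Gamma> contains \<open>MDia (MBox (MNeg c))\<close> and by (.2) also
  \<open>MBox (MDia (MNeg c))\<close>; this contradicts that \<open>c\<close> is necessary at
  \<Delta>2.\<close>

lemma canonical_directed:
  assumes mcs: "mcs \<Gamma>" "mcs \<Delta>1" "mcs \<Delta>2" and can: "canonical \<Gamma> \<Delta>1" "canonical \<Gamma> \<Delta>2"
  obtains \<Theta> where "mcs \<Theta>" "canonical \<Delta>1 \<Theta>" "canonical \<Delta>2 \<Theta>"
proof -
  let ?B1 = "{\<chi>. MBox \<chi> \<in> \<Delta>1}" and ?B2 = "{\<chi>. MBox \<chi> \<in> \<Delta>2}"
  have "\<not> derives (?B1 \<union> ?B2) MBot"
  proof
    assume "derives (?B1 \<union> ?B2) MBot"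
    then obtain xs where xs: "set xs \<subseteq> ?B1 \<union> ?B2" "foldr MImp xs MBot \<in> S4_2"
      by (auto simp: derives_def)
    define ys where "ys = filter (\<lambda>\<chi>. \<chi> \<in> ?B2) xs"
    define zs where "zs = filter (\<lambda>\<chi>. \<chi> \<notin> ?B2) xs"
    define c where "c = foldr MAnd ys (MNeg MBot)"
    \<comment> \<open>The double negation matches the form \<open>MBox (MNeg _)\<close> in which the
      axiom Dual speaks about \<open>MDia (MNeg c)\<close>.\<close>
    have "foldr MImp ys (MNeg (MNeg c)) \<in> S4_2"
      by (rule S4_2.taut)
        (auto simp: tautology_def prop_eval_foldr_MImp prop_eval_foldr_MAnd c_def)
    moreover have "set ys \<subseteq> ?B2" by (auto simp: ys_def)
    ultimately have "derives ?B2 (MNeg (MNeg c))" unfolding derives_def by blast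
    then have "MBox (MNeg (MNeg c)) \<in> \<Delta>2" by (rule mcs_box_closed[OF mcs(3)])
    then have dia: "MDia (MNeg c) \<notin> \<Delta>2" by (simp add: mcs_dia_iff[OF mcs(3)])
    from xs(2) have "foldr MImp zs (MNeg c) \<in> S4_2"
      by (rule S4_2_conseq)
        (auto simp: prop_eval_foldr_MImp prop_eval_foldr_MAnd c_def ys_def zs_def)
    moreover have "set zs \<subseteq> ?B1" using xs(1) by (auto simp: zs_def)
    ultimately have "derives ?B1 (MNeg c)" unfolding derives_def by blast
    then have "MBox (MNeg c) \<in> \<Delta>1" by (rule mcs_box_closed[OF mcs(2)])
    then have "MNeg (MBox (MNeg c)) \<notin> \<Delta>1" by (simp add: mcs_neg_iff[OF mcs(2)])
    then have "MBox (MNeg (MBox (MNeg c))) \<notin> \<Gamma>" using can(1) by (auto simp: canonical_def)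
    then have "MDia (MBox (MNeg c)) \<in> \<Gamma>" by (simp add: mcs_dia_iff[OF mcs(1)])
    then have "MBox (MDia (MNeg c)) \<in> \<Gamma>" by (rule mcs_mp[OF mcs(1) S4_2.Dot2])
    with can(2) dia show False by (auto simp: canonical_def)
  qed
  then obtain \<Theta> where "?B1 \<union> ?B2 \<subseteq> \<Theta>" "mcs \<Theta>" by (rule lindenbaum)
  then show thesis by (intro that) (auto simp: canonical_def)
qed

text \<open>Filtration: worlds are the traces of canonical worlds on the subformulas of the formula.\<close>

theorem S4_2_complete:
  assumes "\<phi> \<notin> S4_2"
  obtains W :: "mfm set set" and R V r where
    "finite W" "r \<in> W" "\<And>x. x \<in> W \<Longrightarrow> R x x" "\<And>x y z. R x y \<Longrightarrow> R y z \<Longrightarrow> R x z"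
    "\<And>x. x \<in> W \<Longrightarrow> R r x" "\<And>x y. x \<in> W \<Longrightarrow> y \<in> W \<Longrightarrow> \<exists>z\<in>W. R x z \<and> R y z"
    "\<not> ksat W R V \<phi> r"
proof -
  have "\<not> derives {MNeg \<phi>} MBot"
  proof
    assume "derives {MNeg \<phi>} MBot"
    then have "derives {} (MImp (MNeg \<phi>) MBot)" by (rule derives_insert)
    then have "derives {} \<phi>" by (rule derives_conseq) auto
    with assms show False by (simp add: derives_def)
  qed
  then obtain \<Gamma>0 where \<Gamma>0: "mcs \<Gamma>0" "\<phi> \<notin> \<Gamma>0"
    by (rule lindenbaum) (auto simp: mcs_neg_iff)
  define \<Sigma> where "\<Sigma> = subformulas \<phi>"
  \<comment> \<open>Keeping only what \<Gamma>0 sees provides the root, and also the common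
    predecessor that \<open>canonical_directed\<close> asks for.\<close>
  define G where "G = {\<Gamma>. mcs \<Gamma> \<and> canonical \<Gamma>0 \<Gamma>}"
  define W where "W = (\<lambda>\<Gamma>. \<Gamma> \<inter> \<Sigma>) ` G"
  \<comment> \<open>The transitive filtration: carrying \<open>MBox \<chi>\<close> itself along,
    rather than \<chi>, makes \<open>R\<close> transitive. The diamond clause is separate because
    \<Sigma> need not contain \<open>MBox (MNeg \<chi>)\<close> along with
    \<open>MDia \<chi>\<close>.\<close>
  define R where "R x y \<longleftrightarrow> (\<forall>\<chi>. MBox \<chi> \<in> x \<longrightarrow> MBox \<chi> \<in> y) \<and> (\<forall>\<chi>. MDia \<chi> \<in> y \<longrightarrow> MDia \<chi> \<in> x)"
    for x y :: "mfm set"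
  define V where "V x i \<longleftrightarrow> Var i \<in> x" for x i
  have R: "R (\<Gamma> \<inter> \<Sigma>) (\<Delta> \<inter> \<Sigma>)" if "mcs \<Gamma>" "mcs \<Delta>" "canonical \<Gamma> \<Delta>" for \<Gamma> \<Delta>
    using canonical_box[OF that(1,3)] canonical_dia[OF that] by (auto simp: R_def)
  have truth: "ksat W R V \<chi> (\<Gamma> \<inter> \<Sigma>) \<longleftrightarrow> \<chi> \<in> \<Gamma>" if "subformulas \<chi> \<subseteq> \<Sigma>" "\<Gamma> \<in> G" for \<chi> \<Gamma>
    using that
  proof (induction \<chi> arbitrary: \<Gamma>)
    case (Var i)
    then show ?case by (auto simp: V_def)
  next
    case (MNeg \<chi>)
    with mcs_prop_eval[of \<Gamma> "MNeg \<chi>"] mcs_prop_eval[of \<Gamma>] show ?case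
      by (simp add: G_def)
  next
    case (MAnd \<chi> \<xi>)
    with mcs_prop_eval[of \<Gamma> "MAnd \<chi> \<xi>"] mcs_prop_eval[of \<Gamma>] show ?case
      by (simp add: G_def)
  next
    case (MOr \<chi> \<xi>)
    with mcs_prop_eval[of \<Gamma> "MOr \<chi> \<xi>"] mcs_prop_eval[of \<Gamma>] show ?case
      by (simp add: G_def)
  next
    case (MImp \<chi> \<xi>)
    with mcs_prop_eval[of \<Gamma> "MImp \<chi> \<xi>"] mcs_prop_eval[of \<Gamma>] show ?case
      by (simp add: G_def)
  next
    case (MIff \<chi> \<xi>)
    with mcs_prop_eval[of \<Gamma> "MIff \<chi> \<xi>"] mcs_prop_eval[of \<Gamma>] show ?case
      by (simp add: G_def)
  next
    case (MBox \<chi>)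
    have \<chi>: "subformulas \<chi> \<subseteq> \<Sigma>" "MBox \<chi> \<in> \<Sigma>" and \<Gamma>: "mcs \<Gamma>" "canonical \<Gamma>0 \<Gamma>"
      using MBox.prems by (auto simp: G_def)
    show ?case
    proof
      assume sat: "ksat W R V (MBox \<chi>) (\<Gamma> \<inter> \<Sigma>)"
      show "MBox \<chi> \<in> \<Gamma>"
      proof (rule ccontr)
        assume "MBox \<chi> \<notin> \<Gamma>"
        with \<Gamma>(1) obtain \<Delta> where \<Delta>: "mcs \<Delta>" "canonical \<Gamma> \<Delta>" "\<chi> \<notin> \<Delta>"
          by (rule canonical_successor)
        then have "\<Delta> \<in> G" using canonical_trans[OF \<Gamma>0(1) \<Gamma>(2)] by (auto simp: G_def)
        moreover have "R (\<Gamma> \<inter> \<Sigma>) (\<Delta> \<inter> \<Sigma>)" using R \<Gamma>(1) \<Delta> by blast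
        ultimately have "ksat W R V \<chi> (\<Delta> \<inter> \<Sigma>)" using sat by (auto simp: W_def)
        with MBox.IH[OF \<chi>(1) \<open>\<Delta> \<in> G\<close>] \<Delta>(3) show False by simp
      qed
    next
      assume box: "MBox \<chi> \<in> \<Gamma>"
      have "\<chi> \<in> \<Delta>" if "\<Delta> \<in> G" "R (\<Gamma> \<inter> \<Sigma>) (\<Delta> \<inter> \<Sigma>)" for \<Delta>
        using that box \<chi>(2) mcs_mp[OF _ S4_2.S, of \<Delta> \<chi>] by (auto simp: R_def G_def)
      then show "ksat W R V (MBox \<chi>) (\<Gamma> \<inter> \<Sigma>)"
        using MBox.IH[OF \<chi>(1)] by (auto simp: W_def)
    qed
  next
    case (MDia \<chi>)
    have \<chi>: "subformulas \<chi> \<subseteq> \<Sigma>" "MDia \<chi> \<in> \<Sigma>" and \<Gamma>: "mcs \<Gamma>" "canonical \<Gamma>0 \<Gamma>"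
      using MDia.prems by (auto simp: G_def)
    show ?case
    proof
      assume "MDia \<chi> \<in> \<Gamma>"
      then have "MBox (MNeg \<chi>) \<notin> \<Gamma>" by (simp add: mcs_dia_iff[OF \<Gamma>(1)])
      with \<Gamma>(1) obtain \<Delta> where \<Delta>: "mcs \<Delta>" "canonical \<Gamma> \<Delta>" "MNeg \<chi> \<notin> \<Delta>"
        by (rule canonical_successor)
      then have "\<Delta> \<in> G" using canonical_trans[OF \<Gamma>0(1) \<Gamma>(2)] by (auto simp: G_def)
      moreover have "R (\<Gamma> \<inter> \<Sigma>) (\<Delta> \<inter> \<Sigma>)" using R \<Gamma>(1) \<Delta> by blast
      moreover have "\<chi> \<in> \<Delta>" using \<Delta> by (simp add: mcs_neg_iff)
      ultimately show "ksat W R V (MDia \<chi>) (\<Gamma> \<inter> \<Sigma>)"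
        using MDia.IH[OF \<chi>(1)] by (auto simp: W_def)
    next
      assume "ksat W R V (MDia \<chi>) (\<Gamma> \<inter> \<Sigma>)"
      then obtain \<Delta> where \<Delta>: "\<Delta> \<in> G" "R (\<Gamma> \<inter> \<Sigma>) (\<Delta> \<inter> \<Sigma>)" "ksat W R V \<chi> (\<Delta> \<inter> \<Sigma>)"
        by (auto simp: W_def)
      have \<Delta>': "mcs \<Delta>" "\<chi> \<in> \<Delta>" using \<Delta> MDia.IH[OF \<chi>(1)] by (auto simp: G_def)
      have "MBox (MNeg \<chi>) \<notin> \<Delta>"
        using \<Delta>' mcs_mp[OF \<Delta>'(1) S4_2.S, of "MNeg \<chi>"] by (auto simp: mcs_neg_iff)
      then have "MDia \<chi> \<in> \<Delta>" by (simp add: mcs_dia_iff[OF \<Delta>'(1)])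
      with \<Delta>(2) \<chi>(2) show "MDia \<chi> \<in> \<Gamma>" by (auto simp: R_def)
    qed
  qed
  have G0: "\<Gamma>0 \<in> G" using \<Gamma>0 canonical_refl by (auto simp: G_def)
  show thesis
  proof (rule that[of W "\<Gamma>0 \<inter> \<Sigma>" R V])
    show "finite W"
      by (rule finite_subset[of _ "Pow \<Sigma>"]) (auto simp: W_def \<Sigma>_def finite_subformulas)
    show "\<Gamma>0 \<inter> \<Sigma> \<in> W" using G0 by (auto simp: W_def)
    show "R x x" for x by (simp add: R_def)
    show "R x y \<Longrightarrow> R y z \<Longrightarrow> R x z" for x y z by (simp add: R_def)
    show "x \<in> W \<Longrightarrow> R (\<Gamma>0 \<inter> \<Sigma>) x" for x using R \<Gamma>0(1) by (auto simp: W_def G_def)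
    show "\<exists>z\<in>W. R x z \<and> R y z" if xy: "x \<in> W" "y \<in> W" for x y
    proof -
      obtain \<Delta>1 \<Delta>2 where d: "mcs \<Delta>1" "mcs \<Delta>2" "canonical \<Gamma>0 \<Delta>1" "canonical \<Gamma>0 \<Delta>2"
        "x = \<Delta>1 \<inter> \<Sigma>" "y = \<Delta>2 \<inter> \<Sigma>"
        using xy by (auto simp: W_def G_def)
      obtain \<Theta> where \<Theta>: "mcs \<Theta>" "canonical \<Delta>1 \<Theta>" "canonical \<Delta>2 \<Theta>"
        by (rule canonical_directed[OF \<Gamma>0(1) d(1-4)])
      then have "\<Theta> \<in> G" using canonical_trans[OF \<Gamma>0(1) d(3)] by (auto simp: G_def)
      then show ?thesis using R \<Theta> d by (auto simp: W_def)
    qed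
    show "\<not> ksat W R V \<phi> (\<Gamma>0 \<inter> \<Sigma>)"
      using truth[OF _ G0, of \<phi>] \<Gamma>0(2) by (simp add: \<Sigma>_def)
  qed
qed

text \<open>
  A set of pushed buttons that is a chain leads to its greatest element, any other set to the top;
  the dial then selects a point in the cluster.
\<close>

lemma button_dial_morphism:
  fixes W :: "'w set"
  assumes fin: "finite W" and r: "r \<in> W" and refl: "\<And>x. x \<in> W \<Longrightarrow> R x x"
    and trans: "\<And>x y z. R x y \<Longrightarrow> R y z \<Longrightarrow> R x z"
    and root: "\<And>x. x \<in> W \<Longrightarrow> R r x"
    and dir: "\<And>x y. x \<in> W \<Longrightarrow> y \<in> W \<Longrightarrow> \<exists>z\<in>W. R x z \<and> R y z"
  obtains k :: nat and g :: "nat set \<Rightarrow> nat set \<Rightarrow> 'w" where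
    "\<And>B D. B \<subseteq> {..<k} \<Longrightarrow> g B D \<in> W"
    "\<And>B B' D D'. B \<subseteq> B' \<Longrightarrow> B' \<subseteq> {..<k} \<Longrightarrow> R (g B D) (g B' D')"
    "\<And>B D y. B \<subseteq> {..<k} \<Longrightarrow> y \<in> W \<Longrightarrow> R (g B D) y \<Longrightarrow>
      \<exists>B' i. B \<subseteq> B' \<and> B' \<subseteq> {..<k} \<and> i < k \<and> g B' {i} = y"
    "\<And>D. R (g {} D) r"
proof -
  \<comment> \<open>Buttons and dial positions are both indexed by the points of \<open>W\<close>,
    so there are \<open>card W\<close> of each.\<close>
  obtain \<tau> :: "nat \<Rightarrow> 'w" where \<tau>: "bij_betw \<tau> {..<card W} W"
    using ex_bij_betw_nat_finite[OF fin] by (auto simp: lessThan_atLeast0)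
  define k where "k = card W"
  have \<tau>W: "\<tau> i \<in> W" if "i < k" for i using \<tau> that by (auto simp: bij_betw_def k_def)
  have \<tau>surj: "\<exists>i<k. \<tau> i = y" if "y \<in> W" for y
    using \<tau> that unfolding bij_betw_def k_def by (metis imageE lessThan_iff)
  have "\<exists>t\<in>W. \<forall>x\<in>F. R x t" if "finite F" "F \<subseteq> W" for F
    using that
  proof (induction F rule: finite_induct)
    case empty
    then show ?case using r by auto
  next
    case (insert x F)
    then obtain t where t: "t \<in> W" "\<forall>x\<in>F. R x t" by auto
    from insert.prems have "x \<in> W" by simp
    then obtain z where z: "z \<in> W" "R x z" "R t z" using dir t(1) by blast
    show ?case by (rule bexI[OF _ z(1)]) (use t(2) z trans in blast)
  qed
  then obtain t where t: "t \<in> W" "\<forall>x\<in>W. R x t" using fin by blast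
  define chain where "chain B \<longleftrightarrow> (\<forall>i\<in>B. \<forall>j\<in>B. R (\<tau> i) (\<tau> j) \<or> R (\<tau> j) (\<tau> i))" for B
  \<comment> \<open>The root \<open>r\<close> stands in for the greatest element of the empty chain.
    Greatest elements of a preorder are unique only up to their cluster, so \<open>rep\<close> has
    to pick one.\<close>
  define greatest where "greatest B x \<longleftrightarrow> x \<in> insert r (\<tau> ` B) \<and> (\<forall>i\<in>B. R (\<tau> i) x)" for B x
  have greatest: "\<exists>x. greatest B x" if "B \<subseteq> {..<k}" "chain B" for B
  proof -
    have "finite B" using that(1) finite_subset by blast
    then show ?thesis using that
    proof (induction B rule: finite_induct)
      case empty
      show ?case by (auto simp: greatest_def)
    next
      case (insert i B)
      have "\<exists>x. greatest B x" using insert by (auto simp: chain_def)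
      then obtain x where x: "x \<in> insert r (\<tau> ` B)" "\<forall>i\<in>B. R (\<tau> i) x"
        by (auto simp: greatest_def)
      have iW: "\<tau> i \<in> W" using insert.prems(1) by (simp add: \<tau>W)
      have "x \<in> W" using x(1) insert.prems(1) r \<tau>W by auto
      have "R (\<tau> i) x \<or> R x (\<tau> i)"
        using x(1) insert.prems(2) root[OF iW] by (auto simp: chain_def)
      then show ?case
      proof
        assume "R (\<tau> i) x"
        with x show ?thesis by (intro exI[of _ x]) (auto simp: greatest_def)
      next
        assume "R x (\<tau> i)"
        with x refl[OF iW] show ?thesis
          by (intro exI[of _ "\<tau> i"]) (auto simp: greatest_def intro: trans)
      qed
    qed
  qed
  define rep where "rep B = (if chain B then SOME x. greatest B x else t)" for B
  have rep: "greatest B (rep B)" if "B \<subseteq> {..<k}" "chain B" for B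
    using someI_ex[OF greatest[OF that]] that(2) by (simp add: rep_def)
  have repW: "rep B \<in> W" if "B \<subseteq> {..<k}" for B
  proof (cases "chain B")
    case True
    then show ?thesis using rep[OF that True] that r \<tau>W by (auto simp: greatest_def)
  qed (simp add: rep_def t)
  have repmono: "R (rep B) (rep B')" if "B \<subseteq> B'" "B' \<subseteq> {..<k}" for B B'
  \<comment> \<open>Supersets of a non-chain are non-chains, so pushing more buttons never leads
    away from the top.\<close>
  proof (cases "chain B'")
    case True
    then have "chain B" using that(1) by (auto simp: chain_def)
    with that have "greatest B (rep B)" by (auto intro: rep)
    moreover have "greatest B' (rep B')" using that True by (auto intro: rep)
    ultimately show ?thesis using that root repW[OF that(2)] by (auto simp: greatest_def)
  next
    case False
    then have "rep B' = t" by (simp add: rep_def)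
    then show ?thesis using t repW[of B] that by auto
  qed
  \<comment> \<open>The dial acts only if it reads a single \<open>i\<close> with
    \<open>\<tau> i\<close> in the cluster of \<open>rep B\<close>. Any other reading, empty or
    multiple ones included, falls back to \<open>rep B\<close>, so \<open>g B D\<close> never leaves
    that cluster.\<close>
  define g where "g B D = (if \<exists>i<k. D = {i} \<and> R (\<tau> i) (rep B) \<and> R (rep B) (\<tau> i)
    then \<tau> (the_elem D) else rep B)" for B D
  have g: "g B D \<in> W" "R (g B D) (rep B)" "R (rep B) (g B D)" if "B \<subseteq> {..<k}" for B D
    using repW[OF that] refl \<tau>W by (auto simp: g_def)
  show thesis
  proof (rule that[of k g])
    show "g B D \<in> W" if "B \<subseteq> {..<k}" for B D using g[OF that] by simp
    show "R (g B D) (g B' D')" if "B \<subseteq> B'" "B' \<subseteq> {..<k}" for B B' D D'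
      using g[of B] g[OF that(2)] repmono[OF that] that trans by (meson subset_trans)
    show "R (g {} D) r" for D
    proof -
      have "chain {}" by (simp add: chain_def)
      then have "rep {} = r" using rep[of "{}"] by (auto simp: greatest_def)
      then show ?thesis using g(2)[of "{}" D] by simp
    qed
    show "\<exists>B' i. B \<subseteq> B' \<and> B' \<subseteq> {..<k} \<and> i < k \<and> g B' {i} = y"
      if B: "B \<subseteq> {..<k}" and y: "y \<in> W" and Ry: "R (g B D) y" for B D y
    proof -
      obtain i where i: "i < k" "\<tau> i = y" using \<tau>surj[OF y] by blast
      have Ry': "R (rep B) y" using g(3)[OF B] Ry trans by blast
      show ?thesis
      proof (cases "chain B")
        case True
        \<comment> \<open>\<open>y\<close> lies above the whole chain, so pushing its own button
          keeps a chain and moves \<open>rep\<close> into the cluster of \<open>y\<close>; the dial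
          reading \<open>{i}\<close> then selects \<open>y\<close> itself.\<close>
        let ?B = "insert i B"
        have gr: "greatest B (rep B)" using rep[OF B True] .
        then have le: "\<forall>j\<in>B. R (\<tau> j) y" using Ry' trans by (auto simp: greatest_def)
        have "chain ?B" using True le i(2) refl[OF y] by (auto simp: chain_def)
        moreover have B': "?B \<subseteq> {..<k}" using B i by auto
        ultimately have "greatest ?B (rep ?B)" by (intro rep)
        then have "R y (rep ?B)" "R (rep ?B) y"
          using le i(2) refl[OF y] root[OF y] by (auto simp: greatest_def)
        then have "g ?B {i} = y" using i by (auto simp: g_def)
        with B' i(1) show ?thesis by blast
      next
        case False
        \<comment> \<open>Here \<open>y\<close> is above the top, hence in the top cluster already
          reached: turning the dial is enough.\<close>
        then have "rep B = t" by (simp add: rep_def)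
        then have "g B {i} = y" using Ry' t y i by (auto simp: g_def)
        with B i(1) show ?thesis by blast
      qed
    qed
  qed
qed

subsection \<open>Definability with parameters\<close>

primrec fvars :: "fm \<Rightarrow> nat set" where
  "fvars (FMem i k) = {i, k}"
| "fvars (FEq i k) = {i, k}"
| "fvars (FNeg \<phi>) = fvars \<phi>"
| "fvars (FAnd \<phi> \<psi>) = fvars \<phi> \<union> fvars \<psi>"
| "fvars (FEx i \<phi>) = insert i (fvars \<phi>)"

primrec rename_fm :: "(nat \<Rightarrow> nat) \<Rightarrow> fm \<Rightarrow> fm" where
  "rename_fm f (FMem i k) = FMem (f i) (f k)"
| "rename_fm f (FEq i k) = FEq (f i) (f k)"
| "rename_fm f (FNeg \<phi>) = FNeg (rename_fm f \<phi>)"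
| "rename_fm f (FAnd \<phi> \<psi>) = FAnd (rename_fm f \<phi>) (rename_fm f \<psi>)"
| "rename_fm f (FEx i \<phi>) = FEx (f i) (rename_fm f \<phi>)"

lemma finite_fvars: "finite (fvars \<phi>)"
  by (induction \<phi>) auto

lemma fsat_cong: "(\<And>i. i \<in> fvars \<phi> \<Longrightarrow> s i = t i) \<Longrightarrow> fsat E \<phi> s \<longleftrightarrow> fsat E \<phi> t"
proof (induction \<phi> arbitrary: s t)
  case (FNeg \<phi>)
  then show ?case by (metis fsat.simps(3) fvars.simps(3))
next
  case (FAnd \<phi> \<psi>)
  have "fsat E \<phi> s = fsat E \<phi> t" "fsat E \<psi> s = fsat E \<psi> t"
    by (rule FAnd.IH, use FAnd.prems in simp)+
  then show ?case by simp
next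
  case (FEx i \<phi>)
  have "fsat E \<phi> (s(i := x)) = fsat E \<phi> (t(i := x))" for x
    by (rule FEx.IH) (use FEx.prems in auto)
  then show ?case by simp
qed auto

text \<open>Bound variables are renamed as well, so injectivity is what rules out capture.\<close>

lemma fsat_rename:
  assumes "inj_on f (fvars \<phi>)"
  shows "fsat E (rename_fm f \<phi>) s \<longleftrightarrow> fsat E \<phi> (s \<circ> f)"
  using assms
proof (induction \<phi> arbitrary: s)
  case (FAnd \<phi> \<psi>)
  then show ?case by (auto simp: inj_on_Un)
next
  case (FEx i \<phi>)
  have inj: "inj_on f (fvars \<phi>)" using FEx.prems by auto
  have "fsat E \<phi> (s(f i := x) \<circ> f) \<longleftrightarrow> fsat E \<phi> ((s \<circ> f)(i := x))" for x
    by (rule fsat_cong) (use FEx.prems[unfolded fvars.simps inj_on_def] in auto)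
  then show ?case by (simp only: rename_fm.simps fsat.simps FEx.IH[OF inj])
qed auto

text \<open>Even variables of a formula are the arguments of a definable predicate, odd ones parameters.\<close>

definition mix :: "(nat \<Rightarrow> 'a) \<Rightarrow> (nat \<Rightarrow> 'a) \<Rightarrow> nat \<Rightarrow> 'a" where
  "mix s e n = (if even n then s (n div 2) else e (n div 2))"

named_theorems definable_intros

context zf_model
begin

text \<open>The predicate takes a whole assignment, as with de Bruijn indices: passing under a
  quantifier shifts the arguments. Definability of a notion can then be proved by following its
  syntax with \<open>definable_intros\<close>, without writing down an \<open>fm\<close>.\<close>

definition definable :: "((nat \<Rightarrow> 'v) \<Rightarrow> bool) \<Rightarrow> bool" where
  "definable P \<longleftrightarrow> (\<exists>\<phi> e. \<forall>s. P s \<longleftrightarrow> fsat E \<phi> (mix s e))"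

text \<open>\<open>fm\<close> has no function symbols, so a term is represented by its graph: index
  0 carries the value and the arguments move up by one.\<close>

definition definable_term :: "((nat \<Rightarrow> 'v) \<Rightarrow> 'v) \<Rightarrow> bool" where
  "definable_term t \<longleftrightarrow> definable (\<lambda>s. s 0 = t (\<lambda>n. s (Suc n)))"

lemma definable_not [definable_intros]:
  assumes "definable P"
  shows "definable (\<lambda>s. \<not> P s)"
proof -
  obtain \<phi> e where "\<forall>s. P s \<longleftrightarrow> fsat E \<phi> (mix s e)" using assms by (auto simp: definable_def)
  then show ?thesis unfolding definable_def by (intro exI[of _ "FNeg \<phi>"] exI[of _ e]) simp
qed

lemma definable_and [definable_intros]:
  assumes "definable P" "definable Q"
  shows "definable (\<lambda>s. P s \<and> Q s)"
proof -
  obtain \<phi> d where \<phi>: "\<forall>s. P s \<longleftrightarrow> fsat E \<phi> (mix s d)" using assms(1) by (auto simp: definable_def)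
  obtain \<psi> e where \<psi>: "\<forall>s. Q s \<longleftrightarrow> fsat E \<psi> (mix s e)" using assms(2) by (auto simp: definable_def)
  \<comment> \<open>Two parameter lists are merged into \<open>mix d e\<close>: \<open>f\<close>
    sends the parameter with index b to index 2b, and \<open>g\<close> sends it to index 2b + 1. The
    arguments, at even variables, stay in place.\<close>
  define f where "f n = (if even n then n else 2 * n - 1)" for n :: nat
  define g where "g n = (if even n then n else 2 * n + 1)" for n :: nat
  have "f i = f j \<Longrightarrow> i = j" "g i = g j \<Longrightarrow> i = j" for i j
    unfolding f_def g_def by (cases "even i"; cases "even j"; simp; presburger)+
  then have inj: "inj f" "inj g" by (blast intro: injI)+
  have "mix s (mix d e) (f n) = mix s d n \<and> mix s (mix d e) (g n) = mix s e n" for s n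
  proof (cases "even n")
    case False
    then obtain b where "n = 2 * b + 1" by (rule oddE)
    then show ?thesis by (simp add: f_def g_def mix_def)
  qed (simp add: f_def g_def mix_def)
  then have fg: "mix s (mix d e) \<circ> f = mix s d" "mix s (mix d e) \<circ> g = mix s e" for s
    by (simp_all add: fun_eq_iff)
  have "P s \<and> Q s \<longleftrightarrow> fsat E (FAnd (rename_fm f \<phi>) (rename_fm g \<psi>)) (mix s (mix d e))" for s
    using \<phi> \<psi> inj by (simp add: fsat_rename inj_on_subset[OF _ subset_UNIV] fg)
  then show ?thesis unfolding definable_def by blast
qed

lemma definable_or [definable_intros]:
  "definable P \<Longrightarrow> definable Q \<Longrightarrow> definable (\<lambda>s. P s \<or> Q s)"
  using definable_not[OF definable_and[OF definable_not[of P] definable_not[of Q]]] by simp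

lemma definable_imp [definable_intros]:
  "definable P \<Longrightarrow> definable Q \<Longrightarrow> definable (\<lambda>s. P s \<longrightarrow> Q s)"
  unfolding imp_conv_disj by (rule definable_or[OF definable_not])

lemma definable_iff [definable_intros]:
  "definable P \<Longrightarrow> definable Q \<Longrightarrow> definable (\<lambda>s. P s \<longleftrightarrow> Q s)"
  unfolding iff_conv_conj_imp by (intro definable_and definable_imp)

lemma definable_ex [definable_intros]:
  assumes "definable (\<lambda>s. P (s 0) (\<lambda>n. s (Suc n)))"
  shows "definable (\<lambda>s. \<exists>x. P x s)"
proof -
  obtain \<phi> e where \<phi>: "\<And>s. P (s 0) (\<lambda>n. s (Suc n)) \<longleftrightarrow> fsat E \<phi> (mix s e)"
    using assms by (auto simp: definable_def)
  obtain m where m: "\<forall>i\<in>fvars \<phi>. i < m"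
    using finite_nat_set_iff_bounded[of "fvars \<phi>"] finite_fvars by auto
  \<comment> \<open>The quantified argument 0 moves to \<open>2 * m\<close>, beyond every variable
    of \<phi>; the other even variables move down by 2 to undo the shift, and the odd ones, the
    parameters, stay.\<close>
  define f where "f n = (if odd n then n else if n = 0 then 2 * m else n - 2)" for n
  have "f i \<noteq> f j" if "i < j" "i < m" "j < m" for i j
    using that unfolding f_def by (cases "even i"; cases "even j"; simp; presburger)
  then have inj: "inj_on f (fvars \<phi>)" using m by (metis inj_on_def linorder_neqE_nat)
  have "(\<exists>x. P x s) \<longleftrightarrow> fsat E (FEx (2 * m) (rename_fm f \<phi>)) (mix s e)" for s
  proof -
    have "P x s \<longleftrightarrow> fsat E (rename_fm f \<phi>) ((mix s e)(2 * m := x))" for x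
    proof -
      have "P x s \<longleftrightarrow> fsat E \<phi> (mix (case_nat x s) e)"
        using \<phi>[of "case_nat x s"] by simp
      also have "\<dots> \<longleftrightarrow> fsat E \<phi> ((mix s e)(2 * m := x) \<circ> f)"
      proof (rule fsat_cong)
        fix i assume "i \<in> fvars \<phi>"
        with m have "i < m" by blast
        then show "mix (case_nat x s) e i = ((mix s e)(2 * m := x) \<circ> f) i"
        proof (cases "odd i \<or> i = 0")
          case True
          then show ?thesis by (auto simp: mix_def f_def)
        next
          case False
          then obtain b where "i = 2 * b" "b \<noteq> 0" by (auto elim: evenE)
          then obtain c where "i = 2 * Suc c" by (metis not0_implies_Suc)
          with \<open>i < m\<close> show ?thesis by (simp add: mix_def f_def)
        qed
      qed
      also have "\<dots> \<longleftrightarrow> fsat E (rename_fm f \<phi>) ((mix s e)(2 * m := x))"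
        by (rule fsat_rename[OF inj, symmetric])
      finally show ?thesis .
    qed
    then show ?thesis by simp
  qed
  then show ?thesis unfolding definable_def by blast
qed

lemma definable_all [definable_intros]:
  "definable (\<lambda>s. P (s 0) (\<lambda>n. s (Suc n))) \<Longrightarrow> definable (\<lambda>s. \<forall>x. P x s)"
  using definable_not[OF definable_ex[OF definable_not[of "\<lambda>s. P (s 0) (\<lambda>n. s (Suc n))"]]] by simp

lemma definable_ren:
  assumes "definable P" "inj f"
  shows "definable (\<lambda>s. P (\<lambda>n. s (f n)))"
proof -
  obtain \<phi> e where \<phi>: "\<And>s. P s \<longleftrightarrow> fsat E \<phi> (mix s e)"
    using assms by (auto simp: definable_def)
  define g where "g n = (if even n then 2 * f (n div 2) else n)" for n
  have "i = j" if "g i = g j" for i j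
  proof (cases "even i \<and> even j")
    case True
    then have "f (i div 2) = f (j div 2)" using that by (simp add: g_def)
    then have "i div 2 = j div 2" using assms(2) by (simp add: inj_eq)
    with True show ?thesis by presburger
  next
    case False
    with that show ?thesis
      unfolding g_def by (cases "even i"; cases "even j"; simp; presburger)
  qed
  then have "inj g" by (rule injI)
  then have "P (\<lambda>n. s (f n)) \<longleftrightarrow> fsat E (rename_fm g \<phi>) (mix s e)" for s
    unfolding \<phi> by (subst fsat_rename)
      (auto intro!: arg_cong[of _ _ "fsat E \<phi>"] intro: inj_on_subset simp: mix_def g_def fun_eq_iff)
  then show ?thesis unfolding definable_def by blast
qed

section \<open>Atomic predicates, definable terms and substitution\<close>

lemma definable_var_mem: "definable (\<lambda>s. s i \<^bold>\<in> s k)"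
  unfolding definable_def by (rule exI[of _ "FMem (2 * i) (2 * k)"]) (simp add: mix_def)

lemma definable_var_eq: "definable (\<lambda>s. s i = s k)"
  unfolding definable_def by (rule exI[of _ "FEq (2 * i) (2 * k)"]) (simp add: mix_def)

lemma definable_term_var [definable_intros]: "definable_term (\<lambda>s. s i)"
  unfolding definable_term_def by (rule definable_var_eq)

lemma definable_term_const [definable_intros]: "definable_term (\<lambda>s. c)"
  unfolding definable_term_def definable_def
  by (rule exI[of _ "FEq 0 1"], rule exI[of _ "\<lambda>_. c"]) (simp add: mix_def)

lemma definable_term_shift:
  assumes "definable_term t"
  shows "definable_term (\<lambda>s. t (\<lambda>n. s (Suc n)))"
proof -
  have "inj (case_nat 0 (\<lambda>n. Suc (Suc n)))" by (auto simp: inj_def split: nat.splits)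
  from definable_ren[OF assms[unfolded definable_term_def] this]
  show ?thesis by (simp add: definable_term_def)
qed

text \<open>Substitution without function symbols: quantify over a value and equate it with the
  term.\<close>

lemma definable_ex_eq:
  assumes "definable_term t" "definable (\<lambda>s. P (s 0) (\<lambda>n. s (Suc n)))"
  shows "definable (\<lambda>s. P (t s) s)"
proof -
  have "definable (\<lambda>s. \<exists>x. x = t s \<and> P x s)"
    by (intro definable_ex definable_and assms(1)[unfolded definable_term_def] assms(2))
  then show ?thesis by simp
qed

text \<open>The lifting rules reduce definability at terms to definability at variables, where
  unfolding the notion and applying \<open>definable_intros\<close> finishes.\<close>

lemma definable_lift1:
  assumes "definable (\<lambda>s. R (s 0))" "definable_term t"
  shows "definable (\<lambda>s. R (t s))"
  by (rule definable_ex_eq[OF assms(2) assms(1)])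

lemma definable_lift2:
  assumes "definable (\<lambda>s. R (s 0) (s 1))" "definable_term t" "definable_term u"
  shows "definable (\<lambda>s. R (t s) (u s))"
  by (rule definable_ex_eq[OF assms(3)],
      rule definable_ex_eq[OF definable_term_shift[OF assms(2)]]) (use assms(1) in simp)

lemma definable_lift3:
  assumes "definable (\<lambda>s. R (s 0) (s 1) (s 2))"
    and "definable_term t" "definable_term u" "definable_term v"
  shows "definable (\<lambda>s. R (t s) (u s) (v s))"
  by (rule definable_ex_eq[OF assms(4)],
      rule definable_ex_eq[OF definable_term_shift[OF assms(3)]],
      rule definable_ex_eq[OF definable_term_shift[OF definable_term_shift[OF assms(2)]]])
    (use assms(1) in \<open>simp add: numeral_2_eq_2\<close>)

lemmas definable_mem [definable_intros] = definable_lift2[of "(\<^bold>\<in>)", OF definable_var_mem]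
lemmas definable_eq [definable_intros] = definable_lift2[of "(=)", OF definable_var_eq]

lemma definable_ex1 [definable_intros]:
  "definable (\<lambda>s. \<exists>x. P x s \<and> (\<forall>y. P y s \<longrightarrow> y = x)) \<Longrightarrow> definable (\<lambda>s. \<exists>!x. P x s)"
  by (simp add: Ex1_def)

lemma definable_term1:
  assumes "definable (\<lambda>s. s 0 = f (s 1))" "definable_term t"
  shows "definable_term (\<lambda>s. f (t s))"
  unfolding definable_term_def
  using definable_lift2[of "\<lambda>x y. x = f y", OF assms(1) definable_term_var[of 0]
      definable_term_shift[OF assms(2)]] by simp

lemma definable_term2:
  assumes "definable (\<lambda>s. s 0 = f (s 1) (s 2))" "definable_term t" "definable_term u"
  shows "definable_term (\<lambda>s. f (t s) (u s))"
  unfolding definable_term_def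
  using definable_lift3[of "\<lambda>x y z. x = f y z", OF assms(1) definable_term_var[of 0]
      definable_term_shift[OF assms(2)] definable_term_shift[OF assms(3)]] by simp

section \<open>Separation and replacement for definable predicates\<close>

lemma separation_definable:
  assumes "definable (\<lambda>s. P (s 0))"
  shows "\<exists>b. \<forall>x. x \<^bold>\<in> b \<longleftrightarrow> x \<^bold>\<in> a \<and> P x"
proof -
  obtain \<phi> e where \<phi>: "\<And>s. P (s 0) \<longleftrightarrow> fsat E \<phi> (mix s e)"
    using assms by (auto simp: definable_def)
  have "(mix (\<lambda>_. a) e)(0 := x) = mix ((\<lambda>_. a)(0 := x)) e" for x
    by (auto simp: mix_def fun_eq_iff)
  then have "fsat E \<phi> ((mix (\<lambda>_. a) e)(0 := x)) \<longleftrightarrow> P x" for x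
    using \<phi>[of "(\<lambda>_. a)(0 := x)"] by simp
  with separation[of a \<phi> "mix (\<lambda>_. a) e"] show ?thesis by simp
qed

lemma replacement_definable:
  assumes "definable (\<lambda>s. P (s 0) (s 1))" "\<And>x. x \<^bold>\<in> a \<Longrightarrow> \<exists>!y. P x y"
  shows "\<exists>b. \<forall>y. y \<^bold>\<in> b \<longleftrightarrow> (\<exists>x. x \<^bold>\<in> a \<and> P x y)"
proof -
  obtain \<phi> e where \<phi>: "\<And>s. P (s 0) (s 1) \<longleftrightarrow> fsat E \<phi> (mix s e)"
    using assms by (auto simp: definable_def)
  \<comment> \<open>The replacement scheme has its two variables at 0 and 1, whereas
    \<open>mix\<close> keeps argument 1 at variable 2 and the first parameter at variable 1; so 1
    and 2 are swapped and \<open>e 0\<close> is stored at 2.\<close>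
  define f :: "nat \<Rightarrow> nat" where "f = (\<lambda>n. n)(1 := 2, 2 := 1)"
  define s where "s = (mix (\<lambda>_. a) e)(2 := e 0)"
  have inj: "inj f" by (auto simp: inj_def f_def)
  have "s(0 := x, 1 := y) \<circ> f = mix ((\<lambda>_. a)(0 := x, 1 := y)) e" for x y
  proof
    fix n :: nat
    consider "n = 0" | "n = 1" | "n = 2" | "n > 2" by linarith
    then show "(s(0 := x, 1 := y) \<circ> f) n = mix ((\<lambda>_. a)(0 := x, 1 := y)) e n"
      by cases (auto simp: s_def f_def mix_def elim!: evenE)
  qed
  then have "fsat E (rename_fm f \<phi>) (s(0 := x, 1 := y)) \<longleftrightarrow> P x y" for x y
    using \<phi>[of "(\<lambda>_. a)(0 := x, 1 := y)"] inj
    by (simp add: fsat_rename inj_on_subset[OF _ subset_UNIV])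
  with replacement[of a "rename_fm f \<phi>" s] assms(2) show ?thesis by simp
qed

subsection \<open>Elementary set theory\<close>

lemma set_eqI: "(\<And>z. z \<^bold>\<in> x \<longleftrightarrow> z \<^bold>\<in> y) \<Longrightarrow> x = y"
  using extensionality by blast

lemma mem_the:
  assumes "\<exists>b. \<forall>x. x \<^bold>\<in> b \<longleftrightarrow> P x"
  shows "x \<^bold>\<in> (THE b. \<forall>x. x \<^bold>\<in> b \<longleftrightarrow> P x) \<longleftrightarrow> P x"
proof -
  obtain b where b: "\<forall>x. x \<^bold>\<in> b \<longleftrightarrow> P x" using assms by blast
  then have "(THE b. \<forall>x. x \<^bold>\<in> b \<longleftrightarrow> P x) = b"
    by (intro the_equality set_eqI) auto
  with b show ?thesis by simp
qed

text \<open>Accepts any HOL predicate as a notation, but describes the intended set only when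
  \<open>mem_sep\<close> applies, that is, for definable ones.\<close>

definition sep :: "'v \<Rightarrow> ('v \<Rightarrow> bool) \<Rightarrow> 'v" where
  "sep a P = (THE b. \<forall>x. x \<^bold>\<in> b \<longleftrightarrow> x \<^bold>\<in> a \<and> P x)"

lemma mem_sep: "definable (\<lambda>s. P (s 0)) \<Longrightarrow> x \<^bold>\<in> sep a P \<longleftrightarrow> x \<^bold>\<in> a \<and> P x"
  unfolding sep_def by (rule mem_the) (rule separation_definable)

definition bigunion :: "'v \<Rightarrow> 'v" where
  "bigunion a = (THE b. \<forall>x. x \<^bold>\<in> b \<longleftrightarrow> (\<exists>y. y \<^bold>\<in> a \<and> x \<^bold>\<in> y))"

lemma mem_bigunion [simp]: "x \<^bold>\<in> bigunion a \<longleftrightarrow> (\<exists>y. y \<^bold>\<in> a \<and> x \<^bold>\<in> y)"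
  unfolding bigunion_def by (rule mem_the) (rule union)

definition pow :: "'v \<Rightarrow> 'v" where
  "pow a = (THE b. \<forall>x. x \<^bold>\<in> b \<longleftrightarrow> x \<^bold>\<subseteq> a)"

lemma mem_pow [simp]: "x \<^bold>\<in> pow a \<longleftrightarrow> x \<^bold>\<subseteq> a"
  unfolding pow_def by (rule mem_the) (use powerset in \<open>simp add: subset_of_def\<close>)

lemma mem_empty [simp]: "\<not> x \<^bold>\<in> empty"
  using mem_the[of "\<lambda>_. False"] infinity unfolding empty_def by auto

lemma mem_upair [simp]: "x \<^bold>\<in> upair a b \<longleftrightarrow> x = a \<or> x = b"
  unfolding upair_def by (rule mem_the) (rule pairing)

definition un :: "'v \<Rightarrow> 'v \<Rightarrow> 'v" where
  "un a b = bigunion (upair a b)"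

lemma mem_un [simp]: "x \<^bold>\<in> un a b \<longleftrightarrow> x \<^bold>\<in> a \<or> x \<^bold>\<in> b"
  unfolding un_def by auto

lemma mem_succ [simp]: "z \<^bold>\<in> succ x \<longleftrightarrow> z \<^bold>\<in> x \<or> z = x"
proof -
  have "\<forall>z. z \<^bold>\<in> un x (upair x x) \<longleftrightarrow> z \<^bold>\<in> x \<or> z = x" by simp
  then show ?thesis unfolding succ_def by (intro mem_the) blast
qed

lemma upair_eq_iff: "upair a b = upair c d \<longleftrightarrow> a = c \<and> b = d \<or> a = d \<and> b = c"
proof
  assume "upair a b = upair c d"
  then have "x \<^bold>\<in> upair a b \<longleftrightarrow> x \<^bold>\<in> upair c d" for x by (rule arg_cong)
  then show "a = c \<and> b = d \<or> a = d \<and> b = c" unfolding mem_upair by metis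
next
  have "upair a b = upair b a" by (rule set_eqI) auto
  then show "a = c \<and> b = d \<or> a = d \<and> b = c \<Longrightarrow> upair a b = upair c d" by auto
qed

lemma opair_eq_iff [simp]: "opair a b = opair c d \<longleftrightarrow> a = c \<and> b = d"
  unfolding opair_def by (auto simp: upair_eq_iff)

lemma mem_irrefl: "\<not> x \<^bold>\<in> x"
  using foundation[of "upair x x"] by auto

lemma mem_asym: "x \<^bold>\<in> y \<Longrightarrow> \<not> y \<^bold>\<in> x"
  using foundation[of "upair x y"] by auto

lemma succ_inject [simp]: "succ x = succ y \<longleftrightarrow> x = y"
proof
  assume eq: "succ x = succ y"
  have "x \<^bold>\<in> succ x" "y \<^bold>\<in> succ y" by simp_all
  then have "x \<^bold>\<in> succ y" "y \<^bold>\<in> succ x" using eq by simp_all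
  then show "x = y" using mem_asym by auto
qed simp

lemma succ_neq_empty [simp]: "succ x \<noteq> empty" "empty \<noteq> succ x"
  by (metis mem_succ mem_empty)+

lemma subset_ofI: "(\<And>z. z \<^bold>\<in> x \<Longrightarrow> z \<^bold>\<in> y) \<Longrightarrow> x \<^bold>\<subseteq> y"
  by (simp add: subset_of_def)

lemma subset_ofD: "x \<^bold>\<subseteq> y \<Longrightarrow> z \<^bold>\<in> x \<Longrightarrow> z \<^bold>\<in> y"
  by (simp add: subset_of_def)

lemma trans_setD: "trans_set x \<Longrightarrow> y \<^bold>\<in> x \<Longrightarrow> z \<^bold>\<in> y \<Longrightarrow> z \<^bold>\<in> x"
  by (auto simp: trans_set_def subset_of_def)

lemma trans_setI: "(\<And>y z. y \<^bold>\<in> x \<Longrightarrow> z \<^bold>\<in> y \<Longrightarrow> z \<^bold>\<in> x) \<Longrightarrow> trans_set x"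
  by (auto simp: trans_set_def subset_of_def)

lemma trans_set_opairD:
  assumes "trans_set x" "opair a b \<^bold>\<in> x"
  shows "a \<^bold>\<in> x" "b \<^bold>\<in> x" "upair a a \<^bold>\<in> x" "upair a b \<^bold>\<in> x"
proof -
  show "upair a a \<^bold>\<in> x" "upair a b \<^bold>\<in> x"
    using assms trans_setD[of x "opair a b"] by (auto simp: opair_def)
  then show "a \<^bold>\<in> x" "b \<^bold>\<in> x" using assms(1) trans_setD[of x "upair a b"] by auto
qed

subsection \<open>Definability of the basic notions\<close>

lemma definable_subset_of [definable_intros]:
  assumes "definable_term t" "definable_term u"
  shows "definable (\<lambda>s. t s \<^bold>\<subseteq> u s)"
  by (rule definable_lift2[OF _ assms]) (unfold subset_of_def, intro definable_intros)

lemma definable_trans_set [definable_intros]: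
  assumes "definable_term t"
  shows "definable (\<lambda>s. trans_set (t s))"
  by (rule definable_lift1[OF _ assms]) (unfold trans_set_def, intro definable_intros)

lemma definable_ordinal [definable_intros]:
  assumes "definable_term t"
  shows "definable (\<lambda>s. ordinal (t s))"
  by (rule definable_lift1[OF _ assms]) (unfold ordinal_def, intro definable_intros)

text \<open>This form makes graphs of terms definable: \<open>x = t\<close> becomes a condition on
  the members of \<open>t\<close>, which the membership rules then eliminate.\<close>

lemma eq_set_iff: "x = y \<longleftrightarrow> (\<forall>z. z \<^bold>\<in> x \<longleftrightarrow> z \<^bold>\<in> y)"
  using extensionality by blast

lemma definable_upair [definable_intros]:
  assumes "definable_term t" "definable_term u"
  shows "definable_term (\<lambda>s. upair (t s) (u s))"
  by (rule definable_term2[OF _ assms]) (unfold eq_set_iff mem_upair, intro definable_intros)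

lemma definable_opair [definable_intros]:
  assumes "definable_term t" "definable_term u"
  shows "definable_term (\<lambda>s. opair (t s) (u s))"
  unfolding opair_def by (intro definable_intros assms)

lemma definable_succ [definable_intros]:
  assumes "definable_term t"
  shows "definable_term (\<lambda>s. succ (t s))"
  by (rule definable_term1[OF _ assms]) (unfold eq_set_iff mem_succ, intro definable_intros)

lemma definable_natural [definable_intros]:
  assumes "definable_term t"
  shows "definable (\<lambda>s. natural (t s))"
  by (rule definable_lift1[OF _ assms]) (unfold natural_def, intro definable_intros)

lemma definable_maps [definable_intros]:
  assumes "definable_term t" "definable_term u" "definable_term v"
  shows "definable (\<lambda>s. maps (t s) (u s) (v s))"
  by (rule definable_lift3[OF _ assms]) (unfold maps_def, intro definable_intros)

subsection \<open>Natural numbers\<close>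

lemma natural_empty [simp]: "natural empty"
  by (simp add: natural_def ordinal_def trans_set_def)

lemma ordinal_succ: "ordinal x \<Longrightarrow> ordinal (succ x)"
  unfolding ordinal_def trans_set_def subset_of_def mem_succ by blast

lemma natural_succ [simp]: "natural n \<Longrightarrow> natural (succ n)"
  unfolding natural_def using ordinal_succ mem_succ by blast

lemma natural_trans: "natural n \<Longrightarrow> m \<^bold>\<in> n \<Longrightarrow> natural m"
  unfolding natural_def ordinal_def trans_set_def subset_of_def by blast

lemma natural_trans_set: "natural n \<Longrightarrow> trans_set n"
  by (simp add: natural_def ordinal_def)

text \<open>Induction over the model's own natural numbers, nonstandard ones included. The
  counterexamples up to \<open>n\<close> form a set because \<open>P\<close> is definable, and
  foundation gives a minimal one.\<close>

lemma natural_induct: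
  assumes n: "natural n" and P: "definable (\<lambda>s. P (s 0))"
    and "P empty" and step: "\<And>k. natural k \<Longrightarrow> P k \<Longrightarrow> P (succ k)"
  shows "P n"
proof (rule ccontr)
  assume "\<not> P n"
  let ?b = "sep (succ n) (\<lambda>x. \<not> P x)"
  have b: "x \<^bold>\<in> ?b \<longleftrightarrow> (x \<^bold>\<in> n \<or> x = n) \<and> \<not> P x" for x
    by (subst mem_sep) (auto intro: definable_not[OF P])
  have "\<exists>y. y \<^bold>\<in> ?b" using b \<open>\<not> P n\<close> by blast
  from foundation[OF this] obtain m where m: "m \<^bold>\<in> n \<or> m = n" "\<not> P m"
    and min: "\<And>z. z \<^bold>\<in> m \<Longrightarrow> \<not> ((z \<^bold>\<in> n \<or> z = n) \<and> \<not> P z)"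
    unfolding b by blast
  have nat: "natural m" using m(1) n natural_trans by blast
  then consider "m = empty" | k where "m = succ k" unfolding natural_def by blast
  then show False
  proof cases
    case 1
    then show False using m(2) assms(3) by simp
  next
    case (2 k)
    then have "k \<^bold>\<in> m" by simp
    moreover from this have "k \<^bold>\<in> n" using m(1) trans_setD[OF natural_trans_set[OF n]] by blast
    ultimately show False using min m(2) 2 step natural_trans[OF nat] by blast
  qed
qed

lemma mem_omega [simp]: "n \<^bold>\<in> omega \<longleftrightarrow> natural n"
proof -
  obtain w where w: "\<exists>e. e \<^bold>\<in> w \<and> (\<forall>x. \<not> x \<^bold>\<in> e)"
    "\<And>x. x \<^bold>\<in> w \<Longrightarrow> \<exists>y. y \<^bold>\<in> w \<and> (\<forall>z. z \<^bold>\<in> y \<longleftrightarrow> z \<^bold>\<in> x \<or> z = x)"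
    using infinity by blast
  obtain e where e: "e \<^bold>\<in> w" "\<forall>x. \<not> x \<^bold>\<in> e" using w(1) by blast
  have "e = empty" by (rule set_eqI) (simp add: e(2))
  with e have "empty \<^bold>\<in> w" by simp
  have "succ x \<^bold>\<in> w" if x: "x \<^bold>\<in> w" for x
  proof -
    obtain y where y: "y \<^bold>\<in> w" "\<forall>z. z \<^bold>\<in> y \<longleftrightarrow> z \<^bold>\<in> x \<or> z = x" using w(2)[OF x] by blast
    have "y = succ x" by (rule set_eqI) (simp add: y(2))
    with y show ?thesis by simp
  qed
  then have "n \<^bold>\<in> w" if "natural n" for n
    using that \<open>empty \<^bold>\<in> w\<close> by (rule_tac natural_induct) (auto intro: definable_intros)
  moreover have "x \<^bold>\<in> sep w natural \<longleftrightarrow> x \<^bold>\<in> w \<and> natural x" for x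
    by (intro mem_sep definable_intros)
  ultimately have "\<forall>n. n \<^bold>\<in> sep w natural \<longleftrightarrow> natural n" by blast
  then show ?thesis unfolding omega_def by (intro mem_the) blast
qed

lemma succ_mem_succ:
  assumes "natural n" "succ k \<^bold>\<in> succ n"
  shows "k \<^bold>\<in> n"
  using assms(2) trans_setD[OF natural_trans_set[OF assms(1)], of "succ k" k] by auto

subsection \<open>Recursion on the natural numbers\<close>

text \<open>The approximations of the recursion theorem: \<open>g\<close> lists the iterates of
  \<open>G\<close> from \<open>L\<close> up to index \<open>n\<close> inclusive. Only its pairs are
  constrained, so \<open>approximation_unique\<close> compares values and not sets.\<close>

definition approximation :: "'v \<Rightarrow> ('v \<Rightarrow> 'v) \<Rightarrow> 'v \<Rightarrow> 'v \<Rightarrow> bool" where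
  "approximation L G g n \<longleftrightarrow>
    (\<forall>k y. opair k y \<^bold>\<in> g \<longrightarrow> k \<^bold>\<in> succ n) \<and> (\<forall>k. k \<^bold>\<in> succ n \<longrightarrow> (\<exists>!y. opair k y \<^bold>\<in> g)) \<and>
    opair empty L \<^bold>\<in> g \<and> (\<forall>k y. k \<^bold>\<in> n \<and> opair k y \<^bold>\<in> g \<longrightarrow> opair (succ k) (G y) \<^bold>\<in> g)"

lemma definable_approximation:
  assumes "definable (\<lambda>s. s 0 = G (s 1))" "definable_term t" "definable_term u"
  shows "definable (\<lambda>s. approximation L G (t s) (u s))"
  by (rule definable_lift2[OF _ assms(2,3)])
    (unfold approximation_def, intro definable_intros definable_term1[of G, OF assms(1)])

lemma approximation_unique:
  assumes G: "definable (\<lambda>s. s 0 = G (s 1))" and n: "natural n"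
    and g: "approximation L G g n" and h: "approximation L G h n"
    and k: "k \<^bold>\<in> succ n" and yz: "opair k y \<^bold>\<in> g" "opair k z \<^bold>\<in> h"
  shows "y = z"
proof -
  let ?P = "\<lambda>k. k \<^bold>\<in> succ n \<longrightarrow> (\<forall>y z. opair k y \<^bold>\<in> g \<and> opair k z \<^bold>\<in> h \<longrightarrow> y = z)"
  have "natural k" using k n natural_trans by auto
  then have "?P k"
  proof (rule natural_induct[where P = ?P])
    show "definable (\<lambda>s. ?P (s 0))" by (intro definable_intros)
    show "?P empty" using g h unfolding approximation_def by metis
  next
    fix k assume IH: "?P k"
    show "?P (succ k)"
    proof (intro impI allI, elim conjE)
      fix y z assume k: "succ k \<^bold>\<in> succ n" and y: "opair (succ k) y \<^bold>\<in> g" and z: "opair (succ k) z \<^bold>\<in> h"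
      have kn: "k \<^bold>\<in> n" by (rule succ_mem_succ[OF n k])
      then obtain y' z' where yz: "opair k y' \<^bold>\<in> g" "opair k z' \<^bold>\<in> h"
        using g h unfolding approximation_def by (meson mem_succ)
      then have "y' = z'" using IH kn by simp
      moreover have "opair (succ k) (G y') \<^bold>\<in> g" "opair (succ k) (G z') \<^bold>\<in> h"
        using g h kn yz unfolding approximation_def by blast+
      then have "y = G y'" "z = G z'"
        using g h k y z unfolding approximation_def by blast+
      ultimately show "y = z" by simp
    qed
  qed
  with k yz show ?thesis by blast
qed

lemma approximation_empty: "approximation L G (upair (opair empty L) (opair empty L)) empty"
  by (auto simp: approximation_def)

lemma approximation_succ:
  assumes n: "natural n" and g: "approximation L G g n" and y: "opair n y \<^bold>\<in> g"
  shows "approximation L G (un g (upair (opair (succ n) (G y)) (opair (succ n) (G y)))) (succ n)"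
proof -
  have irr: "\<not> succ n \<^bold>\<in> succ n" by (rule mem_irrefl)
  have 1: "\<And>k y. opair k y \<^bold>\<in> g \<Longrightarrow> k \<^bold>\<in> succ n" and 2: "\<And>k. k \<^bold>\<in> succ n \<Longrightarrow> \<exists>!y. opair k y \<^bold>\<in> g"
    and 3: "opair empty L \<^bold>\<in> g"
    and 4: "\<And>k y. k \<^bold>\<in> n \<Longrightarrow> opair k y \<^bold>\<in> g \<Longrightarrow> opair (succ k) (G y) \<^bold>\<in> g"
    using g unfolding approximation_def by blast+
  have 5: "\<not> opair (succ n) z \<^bold>\<in> g" for z using 1 irr by blast
  have 6: "z = y" if "opair n z \<^bold>\<in> g" for z using 2[of n] y that by auto
  show ?thesis
    unfolding approximation_def
  proof (intro conjI allI impI)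
    fix k z assume "opair k z \<^bold>\<in> un g (upair (opair (succ n) (G y)) (opair (succ n) (G y)))"
    then show "k \<^bold>\<in> succ (succ n)" using 1 by auto
  next
    fix k assume "k \<^bold>\<in> succ (succ n)"
    then consider "k \<^bold>\<in> succ n" "k \<noteq> succ n" | "k = succ n" using irr by (metis mem_succ)
    then show "\<exists>!z. opair k z \<^bold>\<in> un g (upair (opair (succ n) (G y)) (opair (succ n) (G y)))"
      by cases (use 2 5 in auto)
  next
    show "opair empty L \<^bold>\<in> un g (upair (opair (succ n) (G y)) (opair (succ n) (G y)))" using 3 by simp
  next
    fix k z
    assume "k \<^bold>\<in> succ n \<and> opair k z \<^bold>\<in> un g (upair (opair (succ n) (G y)) (opair (succ n) (G y)))"
    then have k: "k \<^bold>\<in> succ n" and "opair k z \<^bold>\<in> g" using irr by auto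
    then show "opair (succ k) (G z) \<^bold>\<in> un g (upair (opair (succ n) (G y)) (opair (succ n) (G y)))"
      using 4 6 by auto
  qed
qed

text \<open>The recursion theorem, delivered as the set of iterates with an induction rule for
  definable predicates. The indices are dropped because a closure is just the union of these
  iterates.\<close>

lemma omega_iteration:
  assumes G: "definable (\<lambda>s. s 0 = G (s 1))"
  obtains b where "L \<^bold>\<in> b" "\<And>y. y \<^bold>\<in> b \<Longrightarrow> G y \<^bold>\<in> b"
    "\<And>P y. definable (\<lambda>s. P (s 0)) \<Longrightarrow> P L \<Longrightarrow> (\<And>z. z \<^bold>\<in> b \<Longrightarrow> P z \<Longrightarrow> P (G z)) \<Longrightarrow> y \<^bold>\<in> b \<Longrightarrow> P y"
proof -
  define V where "V n y \<longleftrightarrow> (\<exists>g. approximation L G g n \<and> opair n y \<^bold>\<in> g)" for n y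
  have V: "definable (\<lambda>s. V (s 0) (s 1))"
    unfolding V_def by (intro definable_intros definable_approximation[OF G])
  have V0: "V empty L" unfolding V_def using approximation_empty by (metis mem_upair)
  have Vsucc: "V (succ n) (G y)" if "natural n" "V n y" for n y
    using that approximation_succ[OF that(1)] unfolding V_def by (metis mem_un mem_upair)
  have Vuniq: "y = z" if "natural n" "V n y" "V n z" for n y z
    using that approximation_unique[OF G that(1)] unfolding V_def by (meson mem_succ)
  have Vex: "\<exists>y. V n y" if "natural n" for n
    by (rule natural_induct[OF that, of "\<lambda>n. \<exists>y. V n y"])
      (intro definable_intros definable_lift2[OF V], use V0 in blast, use Vsucc in blast)
  have "\<exists>!y. V n y" if "n \<^bold>\<in> omega" for n using Vex Vuniq that by (metis mem_omega)
  then have "\<exists>b. \<forall>y. y \<^bold>\<in> b \<longleftrightarrow> (\<exists>n. n \<^bold>\<in> omega \<and> V n y)" by (rule replacement_definable[OF V])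
  then obtain b where b: "\<And>y. y \<^bold>\<in> b \<longleftrightarrow> (\<exists>n. natural n \<and> V n y)" by auto
  show thesis
  proof (rule that)
    show "L \<^bold>\<in> b" unfolding b by (intro exI conjI, rule natural_empty, rule V0)
    show "G y \<^bold>\<in> b" if "y \<^bold>\<in> b" for y
      using that unfolding b by (elim exE conjE, intro exI conjI) (erule natural_succ, erule Vsucc)
    show "P y" if P: "definable (\<lambda>s. P (s 0))" and "P L" and step: "\<And>z. z \<^bold>\<in> b \<Longrightarrow> P z \<Longrightarrow> P (G z)"
      and "y \<^bold>\<in> b" for P y
    proof -
      obtain n where n: "natural n" "V n y" using \<open>y \<^bold>\<in> b\<close> unfolding b by blast
      have "\<forall>y. V n y \<longrightarrow> P y"
      proof (rule natural_induct[OF n(1), of "\<lambda>n. \<forall>y. V n y \<longrightarrow> P y"])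
        show "definable (\<lambda>s. \<forall>y. V (s 0) y \<longrightarrow> P y)"
          by (intro definable_intros definable_lift2[OF V] definable_lift1[OF P])
        show "\<forall>y. V empty y \<longrightarrow> P y" using Vuniq[OF natural_empty V0] \<open>P L\<close> by blast
        show "\<forall>y. V (succ k) y \<longrightarrow> P y" if k: "natural k" "\<forall>y. V k y \<longrightarrow> P y" for k
        proof (intro allI impI)
          fix y assume "V (succ k) y"
          moreover obtain z where z: "V k z" using Vex k(1) by blast
          ultimately have "y = G z" using Vuniq[OF natural_succ[OF k(1)]] Vsucc[OF k(1)] by blast
          moreover have "z \<^bold>\<in> b" unfolding b using k(1) z by blast
          ultimately show "P y" using step k(2) z by blast
        qed
      qed
      with n(2) show ?thesis by blast
    qed
  qed
qed

subsection \<open>Closure under unordered pairs\<close>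

definition add_pairs :: "'v \<Rightarrow> 'v" where
  "add_pairs x = un x (sep (pow x) (\<lambda>w. \<exists>a b. a \<^bold>\<in> x \<and> b \<^bold>\<in> x \<and> w = upair a b))"

lemma mem_add_pairs: "w \<^bold>\<in> add_pairs x \<longleftrightarrow> w \<^bold>\<in> x \<or> (\<exists>a b. a \<^bold>\<in> x \<and> b \<^bold>\<in> x \<and> w = upair a b)"
proof -
  have "definable (\<lambda>s. \<exists>a b. a \<^bold>\<in> x \<and> b \<^bold>\<in> x \<and> s 0 = upair a b)" by (intro definable_intros)
  note * = mem_sep[of "\<lambda>w. \<exists>a b. a \<^bold>\<in> x \<and> b \<^bold>\<in> x \<and> w = upair a b", OF this]
  have "upair a b \<^bold>\<subseteq> x" if "a \<^bold>\<in> x" "b \<^bold>\<in> x" for a b using that by (auto simp: subset_of_def)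
  then show ?thesis unfolding add_pairs_def mem_un * mem_pow by blast
qed

text \<open>\<open>U\<close> is an ambient set for later separations: it contains all nested pairs
  over \<open>L\<close>, hence codes, graphs and satisfaction relations can be cut out of it or its
  power set. The third property says that nothing but pairs is added, which later controls the
  elements of an extension.\<close>

lemma upair_closure:
  obtains U where "L \<^bold>\<subseteq> U" "\<And>a b. a \<^bold>\<in> U \<Longrightarrow> b \<^bold>\<in> U \<Longrightarrow> upair a b \<^bold>\<in> U"
    "\<And>x. x \<^bold>\<in> U \<Longrightarrow> x \<^bold>\<in> L \<or> (\<exists>a b. a \<^bold>\<in> U \<and> b \<^bold>\<in> U \<and> x = upair a b)"
proof -
  have "definable (\<lambda>s. s 0 = add_pairs (s 1))"
    unfolding eq_set_iff[of _ "add_pairs _"] mem_add_pairs by (intro definable_intros)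
  then obtain b where b: "L \<^bold>\<in> b" "\<And>y. y \<^bold>\<in> b \<Longrightarrow> add_pairs y \<^bold>\<in> b"
    and induct: "\<And>P y. definable (\<lambda>s. P (s 0)) \<Longrightarrow> P L \<Longrightarrow>
      (\<And>z. z \<^bold>\<in> b \<Longrightarrow> P z \<Longrightarrow> P (add_pairs z)) \<Longrightarrow> y \<^bold>\<in> b \<Longrightarrow> P y"
    by (rule omega_iteration[of add_pairs L]) blast
  have ext: "y \<^bold>\<subseteq> add_pairs y" for y by (simp add: mem_add_pairs subset_of_def)
  have mono: "add_pairs y \<^bold>\<subseteq> add_pairs z" if "y \<^bold>\<subseteq> z" for y z
    using that unfolding mem_add_pairs subset_of_def by blast
  have L: "L \<^bold>\<subseteq> y" if "y \<^bold>\<in> b" for y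
    by (rule induct[of "\<lambda>y. L \<^bold>\<subseteq> y", OF _ _ _ that])
      (use ext in \<open>auto simp: subset_of_def intro!: definable_intros\<close>)
  \<comment> \<open>Two elements may come from different stages. The stages carry no indices to
    compare, so a common larger stage is found by induction.\<close>
  have dir: "\<forall>y. y \<^bold>\<in> b \<longrightarrow> (\<exists>w. w \<^bold>\<in> b \<and> y \<^bold>\<subseteq> w \<and> z \<^bold>\<subseteq> w)" if "z \<^bold>\<in> b" for z
  proof (rule induct[of "\<lambda>z. \<forall>y. y \<^bold>\<in> b \<longrightarrow> (\<exists>w. w \<^bold>\<in> b \<and> y \<^bold>\<subseteq> w \<and> z \<^bold>\<subseteq> w)", OF _ _ _ that])
    show "definable (\<lambda>s. \<forall>y. y \<^bold>\<in> b \<longrightarrow> (\<exists>w. w \<^bold>\<in> b \<and> y \<^bold>\<subseteq> w \<and> s 0 \<^bold>\<subseteq> w))"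
      by (intro definable_intros)
    show "\<forall>y. y \<^bold>\<in> b \<longrightarrow> (\<exists>w. w \<^bold>\<in> b \<and> y \<^bold>\<subseteq> w \<and> L \<^bold>\<subseteq> w)"
      using L by (meson subset_of_def)
    show "\<forall>y. y \<^bold>\<in> b \<longrightarrow> (\<exists>w. w \<^bold>\<in> b \<and> y \<^bold>\<subseteq> w \<and> add_pairs z \<^bold>\<subseteq> w)"
      if "\<forall>y. y \<^bold>\<in> b \<longrightarrow> (\<exists>w. w \<^bold>\<in> b \<and> y \<^bold>\<subseteq> w \<and> z \<^bold>\<subseteq> w)" for z
      using that b(2) ext mono by (meson subset_of_def)
  qed
  show thesis
  proof (rule that[of "bigunion b"])
    show "L \<^bold>\<subseteq> bigunion b" using b(1) by (auto simp: subset_of_def)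
    show "upair x y \<^bold>\<in> bigunion b" if "x \<^bold>\<in> bigunion b" "y \<^bold>\<in> bigunion b" for x y
    proof -
      obtain u v where "x \<^bold>\<in> u" "u \<^bold>\<in> b" "y \<^bold>\<in> v" "v \<^bold>\<in> b"
        using \<open>x \<^bold>\<in> bigunion b\<close> \<open>y \<^bold>\<in> bigunion b\<close> unfolding mem_bigunion by blast
      moreover from this obtain w where "w \<^bold>\<in> b" "u \<^bold>\<subseteq> w" "v \<^bold>\<subseteq> w" using dir by meson
      ultimately have "upair x y \<^bold>\<in> add_pairs w" by (auto simp: mem_add_pairs subset_of_def)
      with \<open>w \<^bold>\<in> b\<close> b(2) show ?thesis by auto
    qed
    let ?Q = "\<lambda>x. x \<^bold>\<in> L \<or> (\<exists>c d. c \<^bold>\<in> bigunion b \<and> d \<^bold>\<in> bigunion b \<and> x = upair c d)"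
    show "?Q x" if "x \<^bold>\<in> bigunion b" for x
    proof -
      obtain y where y: "y \<^bold>\<in> b" "x \<^bold>\<in> y" using \<open>x \<^bold>\<in> bigunion b\<close> by auto
      have "\<forall>x. x \<^bold>\<in> y \<longrightarrow> ?Q x"
      proof (rule induct[of "\<lambda>y. \<forall>x. x \<^bold>\<in> y \<longrightarrow> ?Q x", OF _ _ _ y(1)])
        show "definable (\<lambda>s. \<forall>x. x \<^bold>\<in> s 0 \<longrightarrow> ?Q x)" by (intro definable_intros)
        show "\<forall>x. x \<^bold>\<in> add_pairs z \<longrightarrow> ?Q x" if "z \<^bold>\<in> b" "\<forall>x. x \<^bold>\<in> z \<longrightarrow> ?Q x" for z
          using that by (auto simp: mem_add_pairs)
      qed simp
      with y(2) show ?thesis by blast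
    qed
  qed
qed

subsection \<open>Codes of formulas\<close>

lemma code_eq_simps [simp]:
  "cMem i k = cMem i' k' \<longleftrightarrow> i = i' \<and> k = k'" "cEq i k = cEq i' k' \<longleftrightarrow> i = i' \<and> k = k'"
  "cNeg p = cNeg p' \<longleftrightarrow> p = p'" "cAnd p q = cAnd p' q' \<longleftrightarrow> p = p' \<and> q = q'"
  "cEx i p = cEx i' p' \<longleftrightarrow> i = i' \<and> p = p'"
  "cMem i k \<noteq> cEq i' k'" "cMem i k \<noteq> cNeg p" "cMem i k \<noteq> cAnd p q" "cMem i k \<noteq> cEx i' p"
  "cEq i k \<noteq> cMem i' k'" "cEq i k \<noteq> cNeg p" "cEq i k \<noteq> cAnd p q" "cEq i k \<noteq> cEx i' p"
  "cNeg p \<noteq> cMem i k" "cNeg p \<noteq> cEq i k" "cNeg p \<noteq> cAnd p' q'" "cNeg p \<noteq> cEx i p'"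
  "cAnd p q \<noteq> cMem i k" "cAnd p q \<noteq> cEq i k" "cAnd p q \<noteq> cNeg p'" "cAnd p q \<noteq> cEx i p'"
  "cEx i p \<noteq> cMem i' k" "cEx i p \<noteq> cEq i' k" "cEx i p \<noteq> cNeg p'" "cEx i p \<noteq> cAnd p' q"
  by (simp_all add: cMem_def cEq_def cNeg_def cAnd_def cEx_def)

lemma definable_code_constructors [definable_intros]:
  assumes "definable_term t" "definable_term u"
  shows "definable_term (\<lambda>s. cMem (t s) (u s))" "definable_term (\<lambda>s. cEq (t s) (u s))"
    "definable_term (\<lambda>s. cAnd (t s) (u s))" "definable_term (\<lambda>s. cEx (t s) (u s))"
  unfolding cMem_def cEq_def cAnd_def cEx_def by (intro definable_intros assms)+

lemma definable_cNeg [definable_intros]: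
  assumes "definable_term t"
  shows "definable_term (\<lambda>s. cNeg (t s))"
  unfolding cNeg_def by (intro definable_intros assms)

lemma definable_code_closed [definable_intros]:
  assumes "definable_term t"
  shows "definable (\<lambda>s. code_closed (t s))"
  by (rule definable_lift1[OF _ assms]) (unfold code_closed_def, intro definable_intros)

lemma definable_code [definable_intros]:
  assumes "definable_term t"
  shows "definable (\<lambda>s. code (t s))"
  by (rule definable_lift1[OF _ assms]) (unfold code_def, intro definable_intros)

lemma upair_closed_opair:
  "(\<And>a b. a \<^bold>\<in> U \<Longrightarrow> b \<^bold>\<in> U \<Longrightarrow> upair a b \<^bold>\<in> U) \<Longrightarrow> a \<^bold>\<in> U \<Longrightarrow> b \<^bold>\<in> U \<Longrightarrow> opair a b \<^bold>\<in> U"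
  by (simp add: opair_def)

lemma upair_closed_code_closed:
  assumes "omega \<^bold>\<subseteq> U" "\<And>a b. a \<^bold>\<in> U \<Longrightarrow> b \<^bold>\<in> U \<Longrightarrow> upair a b \<^bold>\<in> U"
  shows "code_closed U"
proof -
  have "natural n \<Longrightarrow> n \<^bold>\<in> U" for n using assms(1) by (simp add: subset_of_def)
  with upair_closed_opair[of U, OF assms(2)] show ?thesis
    by (simp add: code_closed_def cMem_def cEq_def cNeg_def cAnd_def cEx_def)
qed

lemma code_closedD:
  assumes "code_closed X"
  shows "natural i \<Longrightarrow> natural k \<Longrightarrow> cMem i k \<^bold>\<in> X"
    "natural i \<Longrightarrow> natural k \<Longrightarrow> cEq i k \<^bold>\<in> X"
    "p \<^bold>\<in> X \<Longrightarrow> cNeg p \<^bold>\<in> X"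
    "p \<^bold>\<in> X \<Longrightarrow> q \<^bold>\<in> X \<Longrightarrow> cAnd p q \<^bold>\<in> X"
    "natural i \<Longrightarrow> p \<^bold>\<in> X \<Longrightarrow> cEx i p \<^bold>\<in> X"
  using assms by (simp_all add: code_closed_def)

lemma code_intros [simp, intro]:
  "natural i \<Longrightarrow> natural k \<Longrightarrow> code (cMem i k)"
  "natural i \<Longrightarrow> natural k \<Longrightarrow> code (cEq i k)"
  "code p \<Longrightarrow> code (cNeg p)"
  "code p \<Longrightarrow> code q \<Longrightarrow> code (cAnd p q)"
  "natural i \<Longrightarrow> code p \<Longrightarrow> code (cEx i p)"
  unfolding code_def using code_closedD by blast+

text \<open>\<open>code\<close> is an intersection over all closed sets; it defines a set because
  one closed set exists, namely the pair closure of \<open>omega\<close>.\<close>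

lemma codes_exist: "\<exists>C. \<forall>p. p \<^bold>\<in> C \<longleftrightarrow> code p"
proof -
  obtain U where U: "omega \<^bold>\<subseteq> U" "\<And>a b. a \<^bold>\<in> U \<Longrightarrow> b \<^bold>\<in> U \<Longrightarrow> upair a b \<^bold>\<in> U"
    by (rule upair_closure) blast
  have "x \<^bold>\<in> sep U code \<longleftrightarrow> x \<^bold>\<in> U \<and> code x" for x by (intro mem_sep definable_intros)
  moreover have "x \<^bold>\<in> U" if "code x" for x
    using that upair_closed_code_closed[OF U] by (auto simp: code_def)
  ultimately show ?thesis by blast
qed

text \<open>Induction that also reaches nonstandard codes: the codes satisfying a definable
  \<open>P\<close> form a set, and this set is \<open>code_closed\<close>.\<close>

lemma code_induct:
  assumes p: "code p" and P: "definable (\<lambda>s. P (s 0))"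
    and "\<And>i k. natural i \<Longrightarrow> natural k \<Longrightarrow> P (cMem i k)"
    and "\<And>i k. natural i \<Longrightarrow> natural k \<Longrightarrow> P (cEq i k)"
    and "\<And>p. code p \<Longrightarrow> P p \<Longrightarrow> P (cNeg p)"
    and "\<And>p q. code p \<Longrightarrow> code q \<Longrightarrow> P p \<Longrightarrow> P q \<Longrightarrow> P (cAnd p q)"
    and "\<And>i p. natural i \<Longrightarrow> code p \<Longrightarrow> P p \<Longrightarrow> P (cEx i p)"
  shows "P p"
proof -
  obtain C where C: "\<And>p. p \<^bold>\<in> C \<longleftrightarrow> code p" using codes_exist by blast
  have X: "x \<^bold>\<in> sep C P \<longleftrightarrow> code x \<and> P x" for x using mem_sep[of P, OF P] C by simp
  have "code_closed (sep C P)"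
    unfolding code_closed_def X mem_omega using assms(3-7) by simp
  then have "p \<^bold>\<in> sep C P" using p by (simp add: code_def)
  then show ?thesis using X by simp
qed

subsection \<open>Functions\<close>

lemma maps_app: "maps f a b \<Longrightarrow> x \<^bold>\<in> a \<Longrightarrow> opair x (app f x) \<^bold>\<in> f"
  unfolding maps_def app_def by (metis (no_types, lifting) the_equality)

lemma maps_mem_iff:
  assumes "maps f a b" "x \<^bold>\<in> a"
  shows "opair x y \<^bold>\<in> f \<longleftrightarrow> app f x = y"
proof -
  have "\<exists>!y. opair x y \<^bold>\<in> f" using assms by (simp add: maps_def)
  then show ?thesis using maps_app[OF assms] by blast
qed

lemma maps_app_mem:
  assumes "maps f a b" "x \<^bold>\<in> a"
  shows "app f x \<^bold>\<in> b"
proof -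
  have "\<exists>x' y'. x' \<^bold>\<in> a \<and> y' \<^bold>\<in> b \<and> opair x (app f x) = opair x' y'"
    using assms(1) maps_app[OF assms] unfolding maps_def by blast
  then show ?thesis by auto
qed

lemma maps_opairD:
  assumes "maps f a b" "opair x y \<^bold>\<in> f"
  shows "x \<^bold>\<in> a" "y \<^bold>\<in> b"
proof -
  have "\<exists>x' y'. x' \<^bold>\<in> a \<and> y' \<^bold>\<in> b \<and> opair x y = opair x' y'"
    using assms unfolding maps_def by blast
  then show "x \<^bold>\<in> a" "y \<^bold>\<in> b" by auto
qed

lemma maps_memE:
  assumes "maps f a b" "z \<^bold>\<in> f"
  obtains x y where "z = opair x y" "x \<^bold>\<in> a" "y \<^bold>\<in> b"
  using assms unfolding maps_def by blast

lemma maps_ext: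
  assumes "maps f a b" "maps g a c" "\<And>x. x \<^bold>\<in> a \<Longrightarrow> app f x = app g x"
  shows "f = g"
proof (rule set_eqI)
  fix z
  have "opair x y \<^bold>\<in> f \<longleftrightarrow> opair x y \<^bold>\<in> g" for x y
    using maps_mem_iff[OF assms(1)] maps_mem_iff[OF assms(2)] maps_opairD(1)[OF assms(1)]
      maps_opairD(1)[OF assms(2)] assms(3) by metis
  then show "z \<^bold>\<in> f \<longleftrightarrow> z \<^bold>\<in> g"
    using maps_memE[OF assms(1), of z] maps_memE[OF assms(2), of z] by metis
qed

text \<open>The pair closure of \<open>un a b\<close> takes the place of the Cartesian product as
  the bound for separation.\<close>

lemma maps_exists:
  assumes R: "definable (\<lambda>s. R (s 0) (s 1))"
    and ex1: "\<And>x. x \<^bold>\<in> a \<Longrightarrow> \<exists>!y. R x y" and mem: "\<And>x y. x \<^bold>\<in> a \<Longrightarrow> R x y \<Longrightarrow> y \<^bold>\<in> b"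
  obtains f where "maps f a b" "\<And>x. x \<^bold>\<in> a \<Longrightarrow> R x (app f x)"
proof -
  obtain U where U: "un a b \<^bold>\<subseteq> U" "\<And>x y. x \<^bold>\<in> U \<Longrightarrow> y \<^bold>\<in> U \<Longrightarrow> upair x y \<^bold>\<in> U"
    by (rule upair_closure) blast
  define f where "f = sep U (\<lambda>z. \<exists>x y. z = opair x y \<and> x \<^bold>\<in> a \<and> R x y)"
  have f: "z \<^bold>\<in> f \<longleftrightarrow> z \<^bold>\<in> U \<and> (\<exists>x y. z = opair x y \<and> x \<^bold>\<in> a \<and> R x y)" for z
    unfolding f_def by (intro mem_sep definable_intros definable_lift2[OF R])
  have "opair x y \<^bold>\<in> f \<longleftrightarrow> x \<^bold>\<in> a \<and> R x y" for x y
  proof -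
    have "opair x y \<^bold>\<in> U" if "x \<^bold>\<in> a" "R x y"
      using that U(1) mem[OF that] upair_closed_opair[of U, OF U(2)] by (simp add: subset_of_def)
    then show ?thesis unfolding f by auto
  qed
  note f' = this
  have m: "maps f a b"
    unfolding maps_def f' using f mem ex1 by blast
  moreover have "R x (app f x)" if "x \<^bold>\<in> a" for x
    using maps_app[OF m that] f' by simp
  ultimately show thesis by (rule that)
qed

lemma maps_const:
  assumes "c \<^bold>\<in> b"
  obtains f where "maps f a b" "\<And>x. x \<^bold>\<in> a \<Longrightarrow> app f x = c"
proof -
  have "definable (\<lambda>s. s 1 = c)" by (intro definable_intros)
  then obtain f where "maps f a b" "\<And>x. x \<^bold>\<in> a \<Longrightarrow> app f x = c"
    by (rule maps_exists[of "\<lambda>x y. y = c" a b]) (use assms in auto)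
  then show thesis by (rule that)
qed

lemma maps_update:
  assumes "maps f a b" "c \<^bold>\<in> b"
  obtains g where "maps g a b" "i \<^bold>\<in> a \<Longrightarrow> app g i = c"
    "\<And>x. x \<^bold>\<in> a \<Longrightarrow> x \<noteq> i \<Longrightarrow> app g x = app f x"
proof -
  let ?R = "\<lambda>x y. x = i \<and> y = c \<or> x \<noteq> i \<and> opair x y \<^bold>\<in> f"
  have "definable (\<lambda>s. ?R (s 0) (s 1))" by (intro definable_intros)
  then obtain g where g: "maps g a b" "\<And>x. x \<^bold>\<in> a \<Longrightarrow> ?R x (app g x)"
  proof (rule maps_exists[of ?R a b])
    show "\<exists>!y. ?R x y" if "x \<^bold>\<in> a" for x
      using maps_mem_iff[OF assms(1) that] by (cases "x = i") auto
    show "y \<^bold>\<in> b" if "x \<^bold>\<in> a" "?R x y" for x y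
      using that assms(2) maps_opairD(2)[OF assms(1)] by blast
  qed blast
  have "app g i = c" if "i \<^bold>\<in> a" using g(2)[OF that] by blast
  moreover have "app g x = app f x" if "x \<^bold>\<in> a" "x \<noteq> i" for x
    using g(2)[OF that(1)] that(2) maps_mem_iff[OF assms(1) that(1)] by simp
  ultimately show thesis using that[OF g(1)] by blast
qed

lemma maps_comp:
  assumes "maps f a b" "maps g b c"
  obtains h where "maps h a c" "\<And>x. x \<^bold>\<in> a \<Longrightarrow> app h x = app g (app f x)"
proof -
  let ?R = "\<lambda>x z. \<exists>y. opair x y \<^bold>\<in> f \<and> opair y z \<^bold>\<in> g"
  have R: "?R x z \<longleftrightarrow> app g (app f x) = z" if "x \<^bold>\<in> a" for x z
    using maps_mem_iff[OF assms(1) that] maps_mem_iff[OF assms(2) maps_app_mem[OF assms(1) that]]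
    by simp
  have "definable (\<lambda>s. ?R (s 0) (s 1))" by (intro definable_intros)
  then obtain h where h: "maps h a c" "\<And>x. x \<^bold>\<in> a \<Longrightarrow> ?R x (app h x)"
    by (rule maps_exists[of ?R a c])
      (use R maps_app_mem[OF assms(2) maps_app_mem[OF assms(1)]] in auto)
  show thesis by (rule that[OF h(1)]) (use h(2) R in simp)
qed

lemma maps_set_exists: "\<exists>F. \<forall>f. f \<^bold>\<in> F \<longleftrightarrow> maps f a b"
proof -
  obtain U where U: "un a b \<^bold>\<subseteq> U" "\<And>x y. x \<^bold>\<in> U \<Longrightarrow> y \<^bold>\<in> U \<Longrightarrow> upair x y \<^bold>\<in> U"
    by (rule upair_closure) blast
  have "f \<^bold>\<in> sep (pow U) (\<lambda>f. maps f a b) \<longleftrightarrow> f \<^bold>\<in> pow U \<and> maps f a b" for f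
    by (intro mem_sep definable_intros)
  moreover have "f \<^bold>\<in> pow U" if f: "maps f a b" for f
  proof -
    have "z \<^bold>\<in> U" if "z \<^bold>\<in> f" for z
      using f that by (rule maps_memE)
        (use U(1) upair_closed_opair[of U, OF U(2)] in \<open>simp add: subset_of_def\<close>)
    then show ?thesis by (simp add: subset_of_def)
  qed
  ultimately show ?thesis by blast
qed

lemma restriction_mem: "z \<^bold>\<in> restriction f a \<longleftrightarrow> z \<^bold>\<in> f \<and> (\<exists>x y. x \<^bold>\<in> a \<and> z = opair x y)"
proof -
  have "definable (\<lambda>s. \<exists>x y. x \<^bold>\<in> a \<and> s 0 = opair x y)" by (intro definable_intros)
  then show ?thesis
    unfolding restriction_def by (intro mem_the separation_definable[of "\<lambda>z. \<exists>x y. x \<^bold>\<in> a \<and> z = opair x y"])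
qed

lemma maps_restriction:
  assumes "maps f a b" "c \<^bold>\<subseteq> a" "\<And>x. x \<^bold>\<in> c \<Longrightarrow> app f x \<^bold>\<in> d"
  shows "maps (restriction f c) c d" "\<And>x. x \<^bold>\<in> c \<Longrightarrow> app (restriction f c) x = app f x"
proof -
  have c: "x \<^bold>\<in> a" if "x \<^bold>\<in> c" for x using assms(2) that by (rule subset_ofD)
  have *: "opair x y \<^bold>\<in> restriction f c \<longleftrightarrow> x \<^bold>\<in> c \<and> app f x = y" for x y
    unfolding restriction_mem using maps_mem_iff[OF assms(1) c] by auto
  show m: "maps (restriction f c) c d"
    unfolding maps_def *
  proof (intro conjI allI impI)
    fix z assume "z \<^bold>\<in> restriction f c"
    then obtain x y where xy: "x \<^bold>\<in> c" "z = opair x y"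
      unfolding restriction_mem by blast
    with \<open>z \<^bold>\<in> restriction f c\<close> have "y = app f x" using * by simp
    with xy assms(3) show "\<exists>x y. x \<^bold>\<in> c \<and> y \<^bold>\<in> d \<and> z = opair x y" by blast
  qed auto
  show "app (restriction f c) x = app f x" if "x \<^bold>\<in> c" for x
    using * that maps_mem_iff[OF m that] by blast
qed

subsection \<open>The satisfaction relation of a set\<close>

text \<open>Knaster-Tarski inside the model: \<open>T\<close> is the union of all subsets
  \<open>X\<close> of \<open>D\<close> whose elements satisfy \<Phi> at \<open>X\<close>, hence the
  greatest fixed point.\<close>

lemma fixpoint_exists:
  assumes \<Phi>: "definable (\<lambda>s. \<Phi> (s 0) (s 1))"
    and mono: "\<And>X Y z. X \<^bold>\<subseteq> Y \<Longrightarrow> \<Phi> z X \<Longrightarrow> \<Phi> z Y"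
  obtains T where "\<And>z. z \<^bold>\<in> T \<longleftrightarrow> z \<^bold>\<in> D \<and> \<Phi> z T"
proof -
  define Q where "Q X \<longleftrightarrow> X \<^bold>\<subseteq> D \<and> (\<forall>y. y \<^bold>\<in> X \<longrightarrow> \<Phi> y X)" for X
  define T where "T = sep D (\<lambda>z. \<exists>X. Q X \<and> z \<^bold>\<in> X)"
  have T: "z \<^bold>\<in> T \<longleftrightarrow> z \<^bold>\<in> D \<and> (\<exists>X. Q X \<and> z \<^bold>\<in> X)" for z
    unfolding T_def Q_def by (intro mem_sep definable_intros definable_lift2[OF \<Phi>])
  have sub: "X \<^bold>\<subseteq> T" if "Q X" for X
    using that T by (auto simp: subset_of_def Q_def)
  have 1: "\<Phi> z T" if "z \<^bold>\<in> T" for z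
    using that T sub mono unfolding Q_def by blast
  have 2: "z \<^bold>\<in> T" if "z \<^bold>\<in> D" "\<Phi> z T" for z
  proof -
    let ?T = "un T (upair z z)"
    have le: "T \<^bold>\<subseteq> ?T" by (simp add: subset_of_def)
    have "Q ?T"
      unfolding Q_def using that 1 T mono[OF le] by (auto simp: subset_of_def)
    then show ?thesis using T that(1) by auto
  qed
  show thesis by (rule that[of T]) (use 1 2 T in blast)
qed

text \<open>
  Truth and falsity are defined simultaneously, so that the inductive clauses are monotone.
\<close>

definition verum :: "'v \<Rightarrow> 'v \<Rightarrow> 'v" where
  "verum p s = opair (succ empty) (opair p s)"

definition falsum :: "'v \<Rightarrow> 'v \<Rightarrow> 'v" where
  "falsum p s = opair empty (opair p s)"

text \<open>Values are read off through pairs and not through \<open>app\<close>: \<open>app\<close>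
  is a definite description, while membership of pairs is handled by
  \<open>definable_intros\<close>. The step predicates below follow the same rule.\<close>

definition variant :: "'v \<Rightarrow> 'v \<Rightarrow> 'v \<Rightarrow> 'v \<Rightarrow> bool" where
  "variant M i s t \<longleftrightarrow> maps t omega M \<and>
    (\<forall>k y. k \<^bold>\<in> omega \<and> k \<noteq> i \<longrightarrow> (opair k y \<^bold>\<in> t \<longleftrightarrow> opair k y \<^bold>\<in> s))"

definition verum_step :: "'v \<Rightarrow> 'v \<Rightarrow> 'v \<Rightarrow> 'v \<Rightarrow> bool" where
  "verum_step M p s X \<longleftrightarrow>
    (\<exists>i k x y. p = cMem i k \<and> opair i x \<^bold>\<in> s \<and> opair k y \<^bold>\<in> s \<and> x \<^bold>\<in> y) \<or>
    (\<exists>i k x y. p = cEq i k \<and> opair i x \<^bold>\<in> s \<and> opair k y \<^bold>\<in> s \<and> x = y) \<or>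
    (\<exists>q. p = cNeg q \<and> falsum q s \<^bold>\<in> X) \<or>
    (\<exists>q r. p = cAnd q r \<and> verum q s \<^bold>\<in> X \<and> verum r s \<^bold>\<in> X) \<or>
    (\<exists>i q. p = cEx i q \<and> (\<exists>t. variant M i s t \<and> verum q t \<^bold>\<in> X))"

definition falsum_step :: "'v \<Rightarrow> 'v \<Rightarrow> 'v \<Rightarrow> 'v \<Rightarrow> bool" where
  "falsum_step M p s X \<longleftrightarrow>
    (\<exists>i k x y. p = cMem i k \<and> opair i x \<^bold>\<in> s \<and> opair k y \<^bold>\<in> s \<and> \<not> x \<^bold>\<in> y) \<or>
    (\<exists>i k x y. p = cEq i k \<and> opair i x \<^bold>\<in> s \<and> opair k y \<^bold>\<in> s \<and> x \<noteq> y) \<or>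
    (\<exists>q. p = cNeg q \<and> verum q s \<^bold>\<in> X) \<or>
    (\<exists>q r. p = cAnd q r \<and> (falsum q s \<^bold>\<in> X \<or> falsum r s \<^bold>\<in> X)) \<or>
    (\<exists>i q. p = cEx i q \<and> (\<forall>t. variant M i s t \<longrightarrow> falsum q t \<^bold>\<in> X))"

text \<open>\<open>satisfaction_rel\<close> alone admits stray elements. Here \<open>S\<close>
  consists of pairs of a code and an assignment, as needed to keep extensions transitive and their
  elements recognizable.\<close>

lemma satisfaction_exists:
  obtains S where "satisfaction_rel M S"
    "\<And>z. z \<^bold>\<in> S \<Longrightarrow> \<exists>p s. z = opair p s \<and> code p \<and> maps s omega M"
proof -
  obtain C where C: "\<And>p. p \<^bold>\<in> C \<longleftrightarrow> code p" using codes_exist by blast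
  obtain F where F: "\<And>s. s \<^bold>\<in> F \<longleftrightarrow> maps s omega M" using maps_set_exists by blast
  obtain U where U: "un omega (un C F) \<^bold>\<subseteq> U" "\<And>x y. x \<^bold>\<in> U \<Longrightarrow> y \<^bold>\<in> U \<Longrightarrow> upair x y \<^bold>\<in> U"
    by (rule upair_closure) blast
  have pU: "opair p s \<^bold>\<in> U" "verum p s \<^bold>\<in> U" "falsum p s \<^bold>\<in> U" if "code p" "maps s omega M" for p s
  proof -
    have "p \<^bold>\<in> U" "s \<^bold>\<in> U" "empty \<^bold>\<in> U" "succ empty \<^bold>\<in> U"
      using U(1) that C F by (simp_all add: subset_of_def)
    then show "opair p s \<^bold>\<in> U" "verum p s \<^bold>\<in> U" "falsum p s \<^bold>\<in> U"
      unfolding verum_def falsum_def by (simp_all add: upair_closed_opair[of U, OF U(2)])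
  qed
  define \<Phi> where "\<Phi> z X \<longleftrightarrow> (\<exists>p s. code p \<and> maps s omega M \<and>
    (z = verum p s \<and> verum_step M p s X \<or> z = falsum p s \<and> falsum_step M p s X))" for z X
  have def\<Phi>: "definable (\<lambda>s. \<Phi> (s 0) (s 1))"
    unfolding \<Phi>_def verum_step_def falsum_step_def verum_def falsum_def variant_def
    by (intro definable_intros)
  have mono: "\<Phi> z Y" if "X \<^bold>\<subseteq> Y" "\<Phi> z X" for X Y z
  proof -
    have le: "w \<^bold>\<in> X \<Longrightarrow> w \<^bold>\<in> Y" for w using that(1) by (rule subset_ofD)
    have "verum_step M p s X \<Longrightarrow> verum_step M p s Y" for p s
      unfolding verum_step_def by (elim disj_forward; (assumption | blast intro: le))
    moreover have "falsum_step M p s X \<Longrightarrow> falsum_step M p s Y" for p s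
      unfolding falsum_step_def by (elim disj_forward; (assumption | blast intro: le))
    ultimately show ?thesis using that(2) unfolding \<Phi>_def by blast
  qed
  obtain T where T: "\<And>z. z \<^bold>\<in> T \<longleftrightarrow> z \<^bold>\<in> U \<and> \<Phi> z T"
  proof (rule fixpoint_exists[of \<Phi> U])
    show "definable (\<lambda>s. \<Phi> (s 0) (s 1))" by (rule def\<Phi>)
    show "\<Phi> z Y" if "X \<^bold>\<subseteq> Y" "\<Phi> z X" for X Y z by (rule mono[OF that])
  qed (rule that)
  have verum: "verum p s \<^bold>\<in> T \<longleftrightarrow> verum_step M p s T"
    and falsum: "falsum p s \<^bold>\<in> T \<longleftrightarrow> falsum_step M p s T" if "code p" "maps s omega M" for p s
    using that pU[OF that] unfolding T[of "verum p s"] T[of "falsum p s"] \<Phi>_def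
    by (auto simp: verum_def falsum_def)
  have variant: "maps t omega M" if "variant M i s t" for i s t
    using that by (simp add: variant_def)
  have opair_iff: "opair k x \<^bold>\<in> s \<longleftrightarrow> x = app s k" if "maps s omega M" "natural k" for s k x
    using maps_mem_iff[OF that(1), of k x] that(2) by auto
  \<comment> \<open>A mere fixed point could leave gaps or let truth and falsity overlap; induction
    on codes excludes both.\<close>
  have "\<forall>s. maps s omega M \<longrightarrow> (falsum p s \<^bold>\<in> T \<longleftrightarrow> \<not> verum p s \<^bold>\<in> T)" if "code p" for p
    using that
  proof (rule code_induct[of p "\<lambda>p. \<forall>s. maps s omega M \<longrightarrow> (falsum p s \<^bold>\<in> T \<longleftrightarrow> \<not> verum p s \<^bold>\<in> T)"])
    show "definable (\<lambda>s. \<forall>t. maps t omega M \<longrightarrow> (falsum (s 0) t \<^bold>\<in> T \<longleftrightarrow> \<not> verum (s 0) t \<^bold>\<in> T))"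
      unfolding verum_def falsum_def by (intro definable_intros)
  next
    fix i k assume "natural i" "natural k"
    then show "\<forall>s. maps s omega M \<longrightarrow> (falsum (cMem i k) s \<^bold>\<in> T \<longleftrightarrow> \<not> verum (cMem i k) s \<^bold>\<in> T)"
      "\<forall>s. maps s omega M \<longrightarrow> (falsum (cEq i k) s \<^bold>\<in> T \<longleftrightarrow> \<not> verum (cEq i k) s \<^bold>\<in> T)"
      by (auto simp add: verum falsum verum_step_def falsum_step_def opair_iff)
  next
    fix p assume "code p" "\<forall>s. maps s omega M \<longrightarrow> (falsum p s \<^bold>\<in> T \<longleftrightarrow> \<not> verum p s \<^bold>\<in> T)"
    then show "\<forall>s. maps s omega M \<longrightarrow> (falsum (cNeg p) s \<^bold>\<in> T \<longleftrightarrow> \<not> verum (cNeg p) s \<^bold>\<in> T)"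
      by (simp add: verum[of "cNeg p"] falsum[of "cNeg p"] verum_step_def falsum_step_def)
  next
    fix p q assume "code p" "code q" "\<forall>s. maps s omega M \<longrightarrow> (falsum p s \<^bold>\<in> T \<longleftrightarrow> \<not> verum p s \<^bold>\<in> T)"
      "\<forall>s. maps s omega M \<longrightarrow> (falsum q s \<^bold>\<in> T \<longleftrightarrow> \<not> verum q s \<^bold>\<in> T)"
    then show "\<forall>s. maps s omega M \<longrightarrow> (falsum (cAnd p q) s \<^bold>\<in> T \<longleftrightarrow> \<not> verum (cAnd p q) s \<^bold>\<in> T)"
      by (simp add: verum[of "cAnd p q"] falsum[of "cAnd p q"] verum_step_def falsum_step_def)
  next
    fix i p assume ip: "natural i" "code p"
      and IH: "\<forall>s. maps s omega M \<longrightarrow> (falsum p s \<^bold>\<in> T \<longleftrightarrow> \<not> verum p s \<^bold>\<in> T)"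
    have "falsum p t \<^bold>\<in> T \<longleftrightarrow> \<not> verum p t \<^bold>\<in> T" if "variant M i s t" for s t
      using IH variant[OF that] by blast
    with ip show "\<forall>s. maps s omega M \<longrightarrow> (falsum (cEx i p) s \<^bold>\<in> T \<longleftrightarrow> \<not> verum (cEx i p) s \<^bold>\<in> T)"
      by (simp add: verum[of "cEx i p"] falsum[of "cEx i p"] verum_step_def falsum_step_def)
  qed
  then have falsum_iff: "falsum p s \<^bold>\<in> T \<longleftrightarrow> \<not> verum p s \<^bold>\<in> T" if "code p" "maps s omega M" for p s
    using that by blast
  define S where "S = sep U (\<lambda>z. \<exists>p s. code p \<and> maps s omega M \<and> z = opair p s \<and> verum p s \<^bold>\<in> T)"
  have S: "z \<^bold>\<in> S \<longleftrightarrow> z \<^bold>\<in> U \<and> (\<exists>p s. code p \<and> maps s omega M \<and> z = opair p s \<and> verum p s \<^bold>\<in> T)" for z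
    unfolding S_def verum_def by (intro mem_sep definable_intros)
  have S_iff: "opair p s \<^bold>\<in> S \<longleftrightarrow> verum p s \<^bold>\<in> T" if "code p" "maps s omega M" for p s
    using that pU[OF that] unfolding S by auto
  have variant_iff: "variant M i s t \<longleftrightarrow> maps t omega M \<and>
      (\<forall>k. k \<^bold>\<in> omega \<and> k \<noteq> i \<longrightarrow> app t k = app s k)" if "maps s omega M" for i s t
    using that opair_iff unfolding variant_def mem_omega by metis
  have "satisfaction_rel M S"
    unfolding satisfaction_rel_def mem_omega
  proof (intro allI impI conjI, goal_cases)
    case (1 s i k)
    then show ?case by (simp add: S_iff verum verum_step_def opair_iff)
  next
    case (2 s i k)
    then show ?case by (auto simp add: S_iff verum verum_step_def opair_iff)
  next
    case (3 s p)
    then show ?case by (simp add: S_iff verum[of "cNeg p"] verum_step_def falsum_iff)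
  next
    case (4 s p q)
    then show ?case by (simp add: S_iff verum[of "cAnd p q"] verum_step_def)
  next
    case (5 s i p)
    then have "opair (cEx i p) s \<^bold>\<in> S \<longleftrightarrow> (\<exists>t. variant M i s t \<and> verum p t \<^bold>\<in> T)"
      by (simp add: S_iff verum[of "cEx i p"] verum_step_def)
    also have "\<dots> \<longleftrightarrow> (\<exists>t. maps t omega M \<and> (\<forall>k. natural k \<and> k \<noteq> i \<longrightarrow> app t k = app s k) \<and>
        opair p t \<^bold>\<in> S)"
      using 5 S_iff unfolding variant_iff[OF 5(1)] mem_omega by blast
    finally show ?case .
  qed
  moreover have "\<exists>p s. z = opair p s \<and> code p \<and> maps s omega M" if "z \<^bold>\<in> S" for z
    using that unfolding S by blast
  ultimately show thesis by (rule that)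
qed

section \<open>Uniqueness of satisfaction and the clauses of truth\<close>

lemma satisfaction_relD:
  assumes "satisfaction_rel M S" "maps s omega M"
  shows "natural i \<Longrightarrow> natural k \<Longrightarrow> opair (cMem i k) s \<^bold>\<in> S \<longleftrightarrow> app s i \<^bold>\<in> app s k"
    and "natural i \<Longrightarrow> natural k \<Longrightarrow> opair (cEq i k) s \<^bold>\<in> S \<longleftrightarrow> app s i = app s k"
    and "code p \<Longrightarrow> opair (cNeg p) s \<^bold>\<in> S \<longleftrightarrow> \<not> opair p s \<^bold>\<in> S"
    and "code p \<Longrightarrow> code q \<Longrightarrow> opair (cAnd p q) s \<^bold>\<in> S \<longleftrightarrow> opair p s \<^bold>\<in> S \<and> opair q s \<^bold>\<in> S"
    and "natural i \<Longrightarrow> code p \<Longrightarrow> opair (cEx i p) s \<^bold>\<in> S \<longleftrightarrow>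
      (\<exists>t. maps t omega M \<and> (\<forall>k. natural k \<and> k \<noteq> i \<longrightarrow> app t k = app s k) \<and> opair p t \<^bold>\<in> S)"
proof -
  note * = HOL.mp[OF spec[OF assms(1)[unfolded satisfaction_rel_def mem_omega], of s] assms(2)]
  show "natural i \<Longrightarrow> natural k \<Longrightarrow> opair (cMem i k) s \<^bold>\<in> S \<longleftrightarrow> app s i \<^bold>\<in> app s k"
    "natural i \<Longrightarrow> natural k \<Longrightarrow> opair (cEq i k) s \<^bold>\<in> S \<longleftrightarrow> app s i = app s k"
    "code p \<Longrightarrow> opair (cNeg p) s \<^bold>\<in> S \<longleftrightarrow> \<not> opair p s \<^bold>\<in> S"
    "code p \<Longrightarrow> code q \<Longrightarrow> opair (cAnd p q) s \<^bold>\<in> S \<longleftrightarrow> opair p s \<^bold>\<in> S \<and> opair q s \<^bold>\<in> S"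
    "natural i \<Longrightarrow> code p \<Longrightarrow> opair (cEx i p) s \<^bold>\<in> S \<longleftrightarrow>
      (\<exists>t. maps t omega M \<and> (\<forall>k. natural k \<and> k \<noteq> i \<longrightarrow> app t k = app s k) \<and> opair p t \<^bold>\<in> S)"
    by (simp_all add: *)
qed

text \<open>\<open>models\<close> asks for some \<open>S\<close>; agreement of all candidates is
  what lets it obey the negation clause.\<close>

lemma satisfaction_unique:
  assumes S: "satisfaction_rel M S" and S': "satisfaction_rel M S'"
    and "code p" "maps s omega M"
  shows "opair p s \<^bold>\<in> S \<longleftrightarrow> opair p s \<^bold>\<in> S'"
proof -
  have "\<forall>s. maps s omega M \<longrightarrow> (opair p s \<^bold>\<in> S \<longleftrightarrow> opair p s \<^bold>\<in> S')"
    using assms(3)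
  proof (rule code_induct[of p "\<lambda>p. \<forall>s. maps s omega M \<longrightarrow> (opair p s \<^bold>\<in> S \<longleftrightarrow> opair p s \<^bold>\<in> S')"])
    show "definable (\<lambda>s. \<forall>t. maps t omega M \<longrightarrow> (opair (s 0) t \<^bold>\<in> S \<longleftrightarrow> opair (s 0) t \<^bold>\<in> S'))"
      by (intro definable_intros)
  qed (use satisfaction_relD[OF S] satisfaction_relD[OF S'] in \<open>simp_all cong: conj_cong\<close>)
  with assms(4) show ?thesis by blast
qed

lemma models_iff:
  assumes "satisfaction_rel M S" "code p" "maps s omega M"
  shows "models M p s \<longleftrightarrow> opair p s \<^bold>\<in> S"
  using assms satisfaction_unique unfolding models_def by blast

lemma models_simps:
  assumes "maps s omega M"
  shows "natural i \<Longrightarrow> natural k \<Longrightarrow> models M (cMem i k) s \<longleftrightarrow> app s i \<^bold>\<in> app s k"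
    and "natural i \<Longrightarrow> natural k \<Longrightarrow> models M (cEq i k) s \<longleftrightarrow> app s i = app s k"
    and "code p \<Longrightarrow> models M (cNeg p) s \<longleftrightarrow> \<not> models M p s"
    and "code p \<Longrightarrow> code q \<Longrightarrow> models M (cAnd p q) s \<longleftrightarrow> models M p s \<and> models M q s"
    and "natural i \<Longrightarrow> code p \<Longrightarrow> models M (cEx i p) s \<longleftrightarrow>
      (\<exists>t. maps t omega M \<and> (\<forall>k. natural k \<and> k \<noteq> i \<longrightarrow> app t k = app s k) \<and> models M p t)"
proof -
  obtain S where S: "satisfaction_rel M S" by (rule satisfaction_exists)
  note * = models_iff[OF S] satisfaction_relD[OF S] assms
  show "natural i \<Longrightarrow> natural k \<Longrightarrow> models M (cMem i k) s \<longleftrightarrow> app s i \<^bold>\<in> app s k"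
    "natural i \<Longrightarrow> natural k \<Longrightarrow> models M (cEq i k) s \<longleftrightarrow> app s i = app s k"
    "code p \<Longrightarrow> models M (cNeg p) s \<longleftrightarrow> \<not> models M p s"
    "code p \<Longrightarrow> code q \<Longrightarrow> models M (cAnd p q) s \<longleftrightarrow> models M p s \<and> models M q s"
    by (simp_all add: *)
  show "natural i \<Longrightarrow> code p \<Longrightarrow> models M (cEx i p) s \<longleftrightarrow>
      (\<exists>t. maps t omega M \<and> (\<forall>k. natural k \<and> k \<noteq> i \<longrightarrow> app t k = app s k) \<and> models M p t)"
    using *(1) by (simp add: *(2-) cong: conj_cong)
qed

subsection \<open>Elementarity for standard formulas\<close>

primrec numeral_of :: "nat \<Rightarrow> 'v" where
  "numeral_of 0 = empty"
| "numeral_of (Suc n) = succ (numeral_of n)"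

lemma natural_numeral_of [simp]: "natural (numeral_of n)"
  by (induction n) simp_all

lemma numeral_of_inject [simp]: "numeral_of m = numeral_of n \<longleftrightarrow> m = n"
proof (induction m arbitrary: n)
  case 0
  then show ?case by (cases n) simp_all
next
  case (Suc m)
  then show ?case by (cases n) simp_all
qed

text \<open>Sends HOL formulas to codes of the model, so that elementarity, stated for internal
  codes, can be applied to formulas written out explicitly.\<close>

primrec code_of :: "fm \<Rightarrow> 'v" where
  "code_of (FMem i k) = cMem (numeral_of i) (numeral_of k)"
| "code_of (FEq i k) = cEq (numeral_of i) (numeral_of k)"
| "code_of (FNeg \<phi>) = cNeg (code_of \<phi>)"
| "code_of (FAnd \<phi> \<psi>) = cAnd (code_of \<phi>) (code_of \<psi>)"
| "code_of (FEx i \<phi>) = cEx (numeral_of i) (code_of \<phi>)"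

lemma code_code_of [simp]: "code (code_of \<phi>)"
  by (induction \<phi>) auto

primrec rsat :: "'v \<Rightarrow> fm \<Rightarrow> (nat \<Rightarrow> 'v) \<Rightarrow> bool" where
  "rsat M (FMem i k) s \<longleftrightarrow> s i \<^bold>\<in> s k"
| "rsat M (FEq i k) s \<longleftrightarrow> s i = s k"
| "rsat M (FNeg \<phi>) s \<longleftrightarrow> \<not> rsat M \<phi> s"
| "rsat M (FAnd \<phi> \<psi>) s \<longleftrightarrow> rsat M \<phi> s \<and> rsat M \<psi> s"
| "rsat M (FEx i \<phi>) s \<longleftrightarrow> (\<exists>x. x \<^bold>\<in> M \<and> rsat M \<phi> (s(i := x)))"

lemma rsat_cong: "(\<And>i. i \<in> fvars \<phi> \<Longrightarrow> s i = t i) \<Longrightarrow> rsat M \<phi> s \<longleftrightarrow> rsat M \<phi> t"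
proof (induction \<phi> arbitrary: s t)
  case (FNeg \<phi>)
  then show ?case by (metis rsat.simps(3) fvars.simps(3))
next
  case (FAnd \<phi> \<psi>)
  have "rsat M \<phi> s = rsat M \<phi> t" "rsat M \<psi> s = rsat M \<psi> t"
    by (rule FAnd.IH, use FAnd.prems in simp)+
  then show ?case by simp
next
  case (FEx i \<phi>)
  have "rsat M \<phi> (s(i := x)) = rsat M \<phi> (t(i := x))" for x
    by (rule FEx.IH) (use FEx.prems in auto)
  then show ?case by simp
qed auto

lemma models_code_of:
  "maps s omega M \<Longrightarrow> models M (code_of \<phi>) s \<longleftrightarrow> rsat M \<phi> (\<lambda>n. app s (numeral_of n))"
proof (induction \<phi> arbitrary: s)
  case (FEx i \<phi>)
  show ?case
  proof
    assume "models M (code_of (FEx i \<phi>)) s"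
    then obtain t where t: "maps t omega M" "models M (code_of \<phi>) t"
      "\<forall>k. natural k \<and> k \<noteq> numeral_of i \<longrightarrow> app t k = app s k"
      using models_simps(5)[OF FEx.prems] by auto
    have "(\<lambda>n. app t (numeral_of n)) = (\<lambda>n. app s (numeral_of n))(i := app t (numeral_of i))"
      using t(3) by (auto simp: fun_eq_iff)
    then have "rsat M \<phi> ((\<lambda>n. app s (numeral_of n))(i := app t (numeral_of i)))"
      using FEx.IH[OF t(1)] t(2) by simp
    moreover have "app t (numeral_of i) \<^bold>\<in> M" using maps_app_mem[OF t(1)] by simp
    ultimately show "rsat M (FEx i \<phi>) (\<lambda>n. app s (numeral_of n))" by auto
  next
    assume "rsat M (FEx i \<phi>) (\<lambda>n. app s (numeral_of n))"
    then obtain x where x: "x \<^bold>\<in> M" "rsat M \<phi> ((\<lambda>n. app s (numeral_of n))(i := x))" by auto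
    obtain t where t: "maps t omega M" "numeral_of i \<^bold>\<in> omega \<Longrightarrow> app t (numeral_of i) = x"
      "\<And>k. k \<^bold>\<in> omega \<Longrightarrow> k \<noteq> numeral_of i \<Longrightarrow> app t k = app s k"
      by (rule maps_update[OF FEx.prems x(1), of "numeral_of i"]) blast
    have "(\<lambda>n. app t (numeral_of n)) = (\<lambda>n. app s (numeral_of n))(i := x)"
      using t(2,3) by (auto simp: fun_eq_iff)
    then have "models M (code_of \<phi>) t" using FEx.IH[OF t(1)] x(2) by simp
    then show "models M (code_of (FEx i \<phi>)) s"
      using models_simps(5)[OF FEx.prems] t by auto
  qed
qed (simp_all add: models_simps)

text \<open>\<sigma> is a sequence of HOL and need not correspond to a set of the model, so only
  finitely many of its values can be copied into an internal assignment. A formula reads no more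
  than that.\<close>

lemma assignment_exists:
  assumes "\<And>n. \<sigma> n \<^bold>\<in> M"
  obtains s where "maps s omega M" "\<And>n. n < m \<Longrightarrow> app s (numeral_of n) = \<sigma> n"
proof -
  have "\<exists>s. maps s omega M \<and> (\<forall>n<m. app s (numeral_of n) = \<sigma> n)"
  proof (induction m)
    case 0
    show ?case by (rule maps_const[OF assms[of 0], of omega]) auto
  next
    case (Suc m)
    then obtain s where s: "maps s omega M" "\<forall>n<m. app s (numeral_of n) = \<sigma> n" by blast
    obtain t where "maps t omega M" "numeral_of m \<^bold>\<in> omega \<Longrightarrow> app t (numeral_of m) = \<sigma> m"
      "\<And>k. k \<^bold>\<in> omega \<Longrightarrow> k \<noteq> numeral_of m \<Longrightarrow> app t k = app s k"
      by (rule maps_update[OF s(1) assms[of m], of "numeral_of m"]) blast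
    with s(2) show ?case by (intro exI[of _ t]) (auto simp: less_Suc_eq)
  qed
  with that show thesis by blast
qed

lemma elementary_maps: "elementary j M N \<Longrightarrow> maps j M N"
  by (simp add: elementary_def)

lemma elementary_rsat:
  assumes j: "elementary j M N" and \<sigma>: "\<And>n. \<sigma> n \<^bold>\<in> M"
  shows "rsat M \<phi> \<sigma> \<longleftrightarrow> rsat N \<phi> (\<lambda>n. app j (\<sigma> n))"
proof -
  obtain m where m: "\<forall>i\<in>fvars \<phi>. i < m"
    using finite_nat_set_iff_bounded[of "fvars \<phi>"] finite_fvars by auto
  obtain s where s: "maps s omega M" "\<And>n. n < m \<Longrightarrow> app s (numeral_of n) = \<sigma> n"
    by (rule assignment_exists[of \<sigma> M m, OF \<sigma>]) blast
  obtain t where t: "maps t omega N" "\<And>i. i \<^bold>\<in> omega \<Longrightarrow> app t i = app j (app s i)"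
    by (rule maps_comp[OF s(1) elementary_maps[OF j]]) blast
  have "rsat M \<phi> \<sigma> \<longleftrightarrow> rsat M \<phi> (\<lambda>n. app s (numeral_of n))"
    by (rule rsat_cong) (use s(2) m in simp)
  also have "\<dots> \<longleftrightarrow> models M (code_of \<phi>) s" by (simp add: models_code_of[OF s(1)])
  also have "\<dots> \<longleftrightarrow> models N (code_of \<phi>) t"
    using j s(1) t unfolding elementary_def by (meson code_code_of)
  also have "\<dots> \<longleftrightarrow> rsat N \<phi> (\<lambda>n. app t (numeral_of n))" by (simp add: models_code_of[OF t(1)])
  also have "\<dots> \<longleftrightarrow> rsat N \<phi> (\<lambda>n. app j (\<sigma> n))"
    by (rule rsat_cong) (use s(2) t(2) m in simp)
  finally show ?thesis .
qed

subsection \<open>Elementary embeddings of a transitive set\<close>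

context
  fixes Q j :: 'v
  assumes Q: "trans_set Q" and j: "elementary j Q Q"
begin

lemma embedding_mem: "x \<^bold>\<in> Q \<Longrightarrow> app j x \<^bold>\<in> Q"
  using maps_app_mem[OF elementary_maps[OF j]] .

lemma embedding_preserves_mem:
  assumes "x \<^bold>\<in> Q" "y \<^bold>\<in> Q"
  shows "x \<^bold>\<in> y \<longleftrightarrow> app j x \<^bold>\<in> app j y"
  using elementary_rsat[OF j, of "(\<lambda>_. y)(0 := x)" "FMem 0 1"] assms by simp

text \<open>Lying in no element is first-order, so it passes to the image. Where only one such
  element exists, every embedding therefore fixes it.\<close>

lemma embedding_maximal:
  assumes "u \<^bold>\<in> Q" "\<And>y. y \<^bold>\<in> Q \<Longrightarrow> \<not> u \<^bold>\<in> y" "y \<^bold>\<in> Q"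
  shows "\<not> app j u \<^bold>\<in> y"
  using elementary_rsat[OF j, of "\<lambda>_. u" "FNeg (FEx 1 (FMem 0 1))"] assms by auto

lemma embedding_empty:
  assumes "empty \<^bold>\<in> Q"
  shows "app j empty = empty"
proof -
  have "\<not> x \<^bold>\<in> app j empty" if "x \<^bold>\<in> Q" for x
    using elementary_rsat[OF j, of "\<lambda>_. empty" "FNeg (FEx 1 (FMem 1 0))"] assms that by auto
  then show ?thesis
    using trans_setD[OF Q embedding_mem[OF assms]] by (intro set_eqI) auto
qed

text \<open>The quantifier of \<open>?f\<close> ranges over \<open>Q\<close> only. By transitivity
  all members of the image belong to \<open>Q\<close>, so the formula determines the image
  completely; \<open>embedding_succ\<close> works in the same way.\<close>

lemma embedding_upair:
  assumes "upair a b \<^bold>\<in> Q"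
  shows "app j (upair a b) = upair (app j a) (app j b)"
proof -
  let ?f = "FAnd (FAnd (FMem 1 0) (FMem 2 0))
    (FNeg (FEx 3 (FAnd (FMem 3 0) (FAnd (FNeg (FEq 3 1)) (FNeg (FEq 3 2))))))"
  have ab: "a \<^bold>\<in> Q" "b \<^bold>\<in> Q" using trans_setD[OF Q assms] by auto
  let ?s = "(\<lambda>_. upair a b)(1 := a, 2 := b)"
  have "rsat Q ?f ?s" by auto
  then have "rsat Q ?f (\<lambda>n. app j (?s n))"
    using elementary_rsat[OF j, of ?s ?f] ab assms by simp
  then have "app j a \<^bold>\<in> app j (upair a b)" "app j b \<^bold>\<in> app j (upair a b)"
    "\<And>x. x \<^bold>\<in> Q \<Longrightarrow> x \<^bold>\<in> app j (upair a b) \<Longrightarrow> x = app j a \<or> x = app j b"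
    by auto
  then show ?thesis
    using trans_setD[OF Q embedding_mem[OF assms]] by (intro set_eqI) (metis mem_upair)
qed

lemma embedding_opair:
  assumes "opair a b \<^bold>\<in> Q"
  shows "app j (opair a b) = opair (app j a) (app j b)"
  using embedding_upair[of a a] embedding_upair[of a b] trans_set_opairD[OF Q assms]
    embedding_upair[of "upair a a" "upair a b"] assms
  by (simp add: opair_def)

lemma embedding_succ:
  assumes "succ x \<^bold>\<in> Q"
  shows "app j (succ x) = succ (app j x)"
proof -
  let ?f = "FAnd (FMem 1 0) (FAnd (FNeg (FEx 2 (FAnd (FMem 2 1) (FNeg (FMem 2 0)))))
    (FNeg (FEx 2 (FAnd (FMem 2 0) (FAnd (FNeg (FMem 2 1)) (FNeg (FEq 2 1)))))))"
  have x: "x \<^bold>\<in> Q" using trans_setD[OF Q assms] by auto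
  let ?s = "(\<lambda>_. succ x)(1 := x)"
  have "rsat Q ?f ?s" by auto
  then have "rsat Q ?f (\<lambda>n. app j (?s n))"
    using elementary_rsat[OF j, of ?s ?f] x assms by simp
  then have *: "app j x \<^bold>\<in> app j (succ x)"
    "\<And>y. y \<^bold>\<in> Q \<Longrightarrow> y \<^bold>\<in> app j x \<Longrightarrow> y \<^bold>\<in> app j (succ x)"
    "\<And>y. y \<^bold>\<in> Q \<Longrightarrow> y \<^bold>\<in> app j (succ x) \<Longrightarrow> y \<^bold>\<in> app j x \<or> y = app j x"
    by auto
  show ?thesis
  proof (rule set_eqI)
    fix y
    show "y \<^bold>\<in> app j (succ x) \<longleftrightarrow> y \<^bold>\<in> succ (app j x)"
      using * trans_setD[OF Q embedding_mem[OF assms], of y]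
        trans_setD[OF Q embedding_mem[OF x], of y] embedding_mem[OF x] by auto
  qed
qed

lemma embedding_natural:
  assumes "omega \<^bold>\<subseteq> Q" "natural n"
  shows "app j n = n"
proof -
  have nat: "natural k \<Longrightarrow> k \<^bold>\<in> Q" for k using assms(1) by (simp add: subset_of_def)
  note iff = maps_mem_iff[OF elementary_maps[OF j] nat]
  \<comment> \<open>Fixing \<open>n\<close> is written as membership in the set \<open>j\<close>,
    which makes the predicate definable and so admits internal induction.\<close>
  have "opair n n \<^bold>\<in> j"
    using assms(2)
  proof (rule natural_induct[of n "\<lambda>n. opair n n \<^bold>\<in> j"])
    show "definable (\<lambda>s. opair (s 0) (s 0) \<^bold>\<in> j)" by (intro definable_intros)
    show "opair empty empty \<^bold>\<in> j" using iff embedding_empty nat by simp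
    show "opair (succ k) (succ k) \<^bold>\<in> j" if "natural k" "opair k k \<^bold>\<in> j" for k
      using that iff[of k k] iff[of "succ k" "succ k"] embedding_succ[of k] nat by simp
  qed
  with iff assms(2) show ?thesis by simp
qed

text \<open>Codes are nested pairs over \<open>omega\<close>, and \<open>j\<close> commutes with
  pairs and fixes natural numbers. So the fixed points of \<open>j\<close> in \<open>Y\<close> form
  a \<open>code_closed\<close> set of the model, which contains nonstandard codes as well.\<close>

lemma embedding_code:
  assumes "omega \<^bold>\<subseteq> Q" "code_closed Y" "Y \<^bold>\<subseteq> Q" "code p"
  shows "app j p = p"
proof -
  have YQ: "x \<^bold>\<in> Q" if "x \<^bold>\<in> Y" for x using assms(3) that by (rule subset_ofD)
  note iff = maps_mem_iff[OF elementary_maps[OF j] YQ]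
  have mem: "x \<^bold>\<in> sep Y (\<lambda>x. opair x x \<^bold>\<in> j) \<longleftrightarrow> x \<^bold>\<in> Y \<and> app j x = x" for x
  proof -
    have "definable (\<lambda>s. opair (s 0) (s 0) \<^bold>\<in> j)" by (intro definable_intros)
    from mem_sep[of "\<lambda>x. opair x x \<^bold>\<in> j", OF this] show ?thesis using iff by auto
  qed
  have opair: "app j (opair a b) = opair a b" if "opair a b \<^bold>\<in> Q" "app j a = a" "app j b = b" for a b
    using embedding_opair[OF that(1)] that(2,3) by simp
  have nat: "app j n = n" if "natural n" for n using embedding_natural[OF assms(1) that] .
  have tag: "app j (opair n (opair a b)) = opair n (opair a b)"
    if "opair n (opair a b) \<^bold>\<in> Y" "natural n" "app j a = a" "app j b = b" for n a b
    using that YQ opair nat trans_set_opairD(2)[OF Q] by metis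
  have cNeg: "app j (cNeg q) = cNeg q" if "cNeg q \<^bold>\<in> Y" "app j q = q" for q
    using that YQ opair nat unfolding cNeg_def by simp
  have "code_closed (sep Y (\<lambda>x. opair x x \<^bold>\<in> j))"
    unfolding code_closed_def mem mem_omega
    using code_closedD[OF assms(2)] tag nat cNeg
    by (simp add: cMem_def cEq_def cAnd_def cEx_def)
  then have "p \<^bold>\<in> sep Y (\<lambda>x. opair x x \<^bold>\<in> j)" using assms(4) by (simp add: code_def)
  then show ?thesis using mem by simp
qed

text \<open>
  If \<open>j\<close> fixes a transitive set together with its satisfaction relation, then no relativization of
  formulas is needed: the truth of \<open>p\<close> at \<open>s\<close> is the membership of a pair in a fixed set.
\<close>

lemma embedding_restriction:
  assumes omega: "omega \<^bold>\<subseteq> Q" and Y: "code_closed Y" "Y \<^bold>\<subseteq> Q"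
    and N: "N \<^bold>\<in> Q" "app j N = N" and S: "S \<^bold>\<in> Q" "app j S = S" "satisfaction_rel N S"
    and S_mem: "\<And>z. z \<^bold>\<in> S \<Longrightarrow> \<exists>p s. z = opair p s \<and> code p \<and> maps s omega N"
  shows "elementary (restriction j N) N N"
proof -
  have NQ: "x \<^bold>\<in> Q" if "x \<^bold>\<in> N" for x using trans_setD[OF Q N(1) that] .
  have jN: "app j x \<^bold>\<in> N" if "x \<^bold>\<in> N" for x
    using embedding_preserves_mem[OF NQ[OF that] N(1)] that N(2) by simp
  have NsubQ: "N \<^bold>\<subseteq> Q" using NQ by (rule subset_ofI)
  note restr = maps_restriction[OF elementary_maps[OF j] NsubQ jN]
  \<comment> \<open>Only truth is carried forward here; the converse comes from applying this to the
    negated code.\<close>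
  have step: "opair p t \<^bold>\<in> S" if p: "code p" and s: "maps s omega N" and t: "maps t omega N"
    and st: "\<And>i. i \<^bold>\<in> omega \<Longrightarrow> app t i = app j (app s i)" and ps: "opair p s \<^bold>\<in> S" for p s t
  proof -
    have psQ: "opair p s \<^bold>\<in> Q" using trans_setD[OF Q S(1) ps] .
    have "app j (opair p s) \<^bold>\<in> S" using embedding_preserves_mem[OF psQ S(1)] ps S(2) by simp
    then have pS: "opair p (app j s) \<^bold>\<in> S"
      using embedding_opair[OF psQ] embedding_code[OF omega Y p] by simp
    then have js: "maps (app j s) omega N" using S_mem by fastforce
    have sQ: "s \<^bold>\<in> Q" using trans_set_opairD(2)[OF Q psQ] .
    \<comment> \<open>Both are assignments into \<open>N\<close>. The pair of \<open>i\<close> and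
      \<open>app s i\<close> in \<open>s\<close> is sent to the pair of \<open>i\<close> and
      \<open>app j (app s i)\<close> in \<open>app j s\<close>, because \<open>j\<close> fixes
      \<open>i\<close>.\<close>
    have "app j s = t"
    proof (rule maps_ext[OF js t])
      fix i assume i: "i \<^bold>\<in> omega"
      have mem: "opair i (app s i) \<^bold>\<in> s" using maps_app[OF s i] .
      have memQ: "opair i (app s i) \<^bold>\<in> Q" using trans_setD[OF Q sQ mem] .
      have "app j (opair i (app s i)) \<^bold>\<in> app j s"
        using embedding_preserves_mem[OF memQ sQ] mem by simp
      then have "opair i (app j (app s i)) \<^bold>\<in> app j s"
        using embedding_opair[OF memQ] embedding_natural[OF omega] i by simp
      then show "app (app j s) i = app t i" using maps_mem_iff[OF js i] st[OF i] by simp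
    qed
    with pS show ?thesis by simp
  qed
  have "models N p s \<longleftrightarrow> models N p t" if p: "code p" and s: "maps s omega N" and t: "maps t omega N"
    and st: "\<And>i. i \<^bold>\<in> omega \<Longrightarrow> app t i = app j (app s i)" for p s t
  proof -
    have "opair p s \<^bold>\<in> S \<longleftrightarrow> opair p t \<^bold>\<in> S"
      using step[OF p s t st] step[OF code_intros(3)[OF p] s t st]
        satisfaction_relD(3)[OF S(3) s p] satisfaction_relD(3)[OF S(3) t p] by blast
    then show ?thesis using models_iff[OF S(3) p] s t by simp
  qed
  moreover have "app j (app s i) = app (restriction j N) (app s i)" if "maps s omega N" "i \<^bold>\<in> omega" for s i
    using restr(2) maps_app_mem[OF that] by simp
  ultimately show ?thesis
    unfolding elementary_def using restr(1) by simp
qed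

end

subsection \<open>Extending worlds\<close>

text \<open>
  The extension has a unique element \<open>u\<close> that belongs to no other element. Every embedding fixes \<open>u\<close>,
  and \<open>u\<close> codes \<open>N\<close>, \<open>P\<close> and their satisfaction relations, so every embedding restricts to \<open>N\<close> and \<open>P\<close>.
  The extension is kept sparse: the new elements are of a few kinds only, so that it is possible to
  control which buttons are pushed.
\<close>

lemma world_extension:
  assumes N: "trans_set N" and P: "trans_set P" and e: "natural e"
    and A: "\<And>a. a \<^bold>\<in> A \<Longrightarrow> a \<^bold>\<subseteq> omega"
  obtains Q u v where "trans_set Q" "N \<^bold>\<subseteq> Q" "P \<^bold>\<subseteq> Q" "A \<^bold>\<subseteq> Q"
    "N \<R> Q" "P \<R> Q"
    "\<And>x. x \<^bold>\<in> Q \<Longrightarrow> x \<^bold>\<in> N \<or> x \<^bold>\<in> P \<or> x \<^bold>\<in> A \<or> natural x \<or> x = N \<or> x = P \<or> empty \<^bold>\<in> x \<or>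
      (\<exists>a b. x = upair a b) \<or> (\<forall>z. z \<^bold>\<in> x \<longrightarrow> (\<exists>a b. z = opair a b))"
    "u \<^bold>\<in> Q" "u = opair e v" "\<And>x. x \<^bold>\<in> Q \<Longrightarrow> (\<forall>y. y \<^bold>\<in> Q \<longrightarrow> \<not> x \<^bold>\<in> y) \<longleftrightarrow> x = u"
proof -
  obtain SN where SN: "satisfaction_rel N SN"
    "\<And>z. z \<^bold>\<in> SN \<Longrightarrow> \<exists>p s. z = opair p s \<and> code p \<and> maps s omega N"
    by (rule satisfaction_exists[of N]) blast
  obtain SP where SP: "satisfaction_rel P SP"
    "\<And>z. z \<^bold>\<in> SP \<Longrightarrow> \<exists>p s. z = opair p s \<and> code p \<and> maps s omega P"
    by (rule satisfaction_exists[of P]) blast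
  obtain FN where FN: "\<And>f. f \<^bold>\<in> FN \<longleftrightarrow> maps f omega N" using maps_set_exists by blast
  obtain FP where FP: "\<And>f. f \<^bold>\<in> FP \<longleftrightarrow> maps f omega P" using maps_set_exists by blast
  \<comment> \<open>The assignment spaces are included because the elements of \<open>SN\<close> and
    \<open>SP\<close> are pairs of codes and assignments, and the closure has to be
    transitive.\<close>
  define L where "L = un (un (un N P) (un omega A)) (un (un FN FP) (un (upair N P) (upair SN SP)))"
  have L: "x \<^bold>\<in> L \<longleftrightarrow> x \<^bold>\<in> N \<or> x \<^bold>\<in> P \<or> natural x \<or> x \<^bold>\<in> A \<or> maps x omega N \<or> maps x omega P \<or>
    x = N \<or> x = P \<or> x = SN \<or> x = SP" for x
    by (auto simp: L_def FN FP)
  obtain Y where LY: "L \<^bold>\<subseteq> Y" and Yup: "\<And>a b. a \<^bold>\<in> Y \<Longrightarrow> b \<^bold>\<in> Y \<Longrightarrow> upair a b \<^bold>\<in> Y"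
    and Yinv: "\<And>x. x \<^bold>\<in> Y \<Longrightarrow> x \<^bold>\<in> L \<or> (\<exists>a b. a \<^bold>\<in> Y \<and> b \<^bold>\<in> Y \<and> x = upair a b)"
    by (rule upair_closure[of L]) blast
  have LY': "x \<^bold>\<in> Y" if "x \<^bold>\<in> L" for x using LY that by (rule subset_ofD)
  have Yop: "opair a b \<^bold>\<in> Y" if "a \<^bold>\<in> Y" "b \<^bold>\<in> Y" for a b
    using upair_closed_opair[of Y, OF Yup that] .
  have omegaY: "omega \<^bold>\<subseteq> Y" using LY' L by (simp add: subset_of_def)
  have Ycc: "code_closed Y" using upair_closed_code_closed[OF omegaY Yup] .
  have codeY: "p \<^bold>\<in> Y" if "code p" for p using that Ycc by (simp add: code_def)
  have mapsY: "z \<^bold>\<in> Y" if f: "maps f omega M" and z: "z \<^bold>\<in> f" and M: "M = N \<or> M = P" for f M z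
    using f z
  proof (rule maps_memE)
    fix x y assume "z = opair x y" "x \<^bold>\<in> omega" "y \<^bold>\<in> M"
    then show ?thesis using M LY' L Yop by auto
  qed
  have Ytr: "trans_set Y"
  proof (rule trans_setI)
    fix x z assume x: "x \<^bold>\<in> Y" and z: "z \<^bold>\<in> x"
    from Yinv[OF x] show "z \<^bold>\<in> Y"
    proof (elim disjE exE conjE)
      assume "x \<^bold>\<in> L"
      then consider "x \<^bold>\<in> N \<or> x = N" | "x \<^bold>\<in> P \<or> x = P" | "natural x" | "x \<^bold>\<in> A" | "maps x omega N"
        | "maps x omega P" | "x = SN" | "x = SP" unfolding L by blast
      then show ?thesis
      proof cases
        case 1
        then show ?thesis using trans_setD[OF N] z LY' L by blast
      next
        case 2
        then show ?thesis using trans_setD[OF P] z LY' L by blast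
      next
        case 3
        then show ?thesis using natural_trans z LY' L by blast
      next
        case 4
        then show ?thesis using subset_ofD[OF A z] LY' L by simp
      next
        case 5
        then show ?thesis using mapsY z by blast
      next
        case 6
        then show ?thesis using mapsY z by blast
      next
        case 7
        then obtain p s where "z = opair p s" "code p" "maps s omega N" using SN(2) z by blast
        then show ?thesis using codeY Yop LY' L by simp
      next
        case 8
        then obtain p s where "z = opair p s" "code p" "maps s omega P" using SP(2) z by blast
        then show ?thesis using codeY Yop LY' L by simp
      qed
    next
      fix a b assume "a \<^bold>\<in> Y" "b \<^bold>\<in> Y" "x = upair a b"
      then show ?thesis using z by auto
    qed
  qed
  \<comment> \<open>\<open>r\<close> collects what embeddings must fix. Pairing it with
    \<open>Y\<close> lifts \<open>v\<close>, and with it \<open>w\<close> and \<open>u\<close>, out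
    of \<open>Y\<close>; the first component \<open>e\<close> of \<open>u\<close> is the dial
    value.\<close>
  define r where "r = opair (opair N SN) (opair P SP)"
  define v where "v = opair Y r"
  define w where "w = upair e v"
  define u where "u = opair e v"
  \<comment> \<open>Besides \<open>Y\<close>, only the sets needed for transitivity below
    \<open>u\<close> are added; \<open>upair e e\<close> already lies in \<open>Y\<close>.\<close>
  define Q where
    "Q = un Y (un (un (upair Y (upair Y Y)) (upair (upair Y r) v)) (upair w u))"
  have r: "r \<^bold>\<in> Y" unfolding r_def using Yop LY' L by simp
  have eY: "e \<^bold>\<in> Y" using e LY' L by simp
  have Qmem: "x \<^bold>\<in> Q \<longleftrightarrow> x \<^bold>\<in> Y \<or> x = Y \<or> x = upair Y Y \<or> x = upair Y r \<or> x = v \<or> x = w \<or> x = u" for x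
    unfolding Q_def by auto
  have vmem: "x \<^bold>\<in> v \<longleftrightarrow> x = upair Y Y \<or> x = upair Y r" for x unfolding v_def opair_def by simp
  have wmem: "x \<^bold>\<in> w \<longleftrightarrow> x = e \<or> x = v" for x unfolding w_def by simp
  have umem: "x \<^bold>\<in> u \<longleftrightarrow> x = upair e e \<or> x = w" for x unfolding u_def w_def opair_def by simp
  have Qtr: "trans_set Q"
  proof (rule trans_setI)
    fix y z assume "y \<^bold>\<in> Q" "z \<^bold>\<in> y"
    then show "z \<^bold>\<in> Q"
      unfolding Qmem[of y] using trans_setD[OF Ytr, of y z] eY r Yup[OF eY eY]
      by (auto simp: Qmem vmem wmem umem)
  qed
  have YY: "\<not> Y \<^bold>\<in> Y" by (rule mem_irrefl)
  have vY: "\<not> v \<^bold>\<in> Y"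
    using trans_setD[OF Ytr, of v "upair Y Y"] trans_setD[OF Ytr, of "upair Y Y" Y] YY vmem by auto
  have wY: "\<not> w \<^bold>\<in> Y" using trans_setD[OF Ytr, of w v] vY wmem by auto
  have wneY: "w \<noteq> Y" using vY wmem by auto
  have uY: "\<not> u \<^bold>\<in> Y" using trans_setD[OF Ytr, of u w] wY umem by auto
  have umax: "\<not> u \<^bold>\<in> y" if "y \<^bold>\<in> Q" for y
  proof
    assume uy: "u \<^bold>\<in> y"
    have uneY: "u \<noteq> Y" using wY umem by auto
    have uner: "u \<noteq> r" using uY r by blast
    have unev: "u \<noteq> v" using eY YY by (auto simp: u_def v_def)
    have unee: "u \<noteq> e" using uY eY by blast
    have unp: "u \<noteq> upair Y a" if "a \<^bold>\<in> Y \<or> a = Y" for a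
    proof
      assume "u = upair Y a"
      then have "w \<^bold>\<in> upair Y a" using umem by auto
      then show False using wneY wY that by auto
    qed
    from that show False
      unfolding Qmem
    proof (elim disjE)
      assume "y \<^bold>\<in> Y"
      then show False using trans_setD[OF Ytr _ uy] uY by blast
    next
      assume "y = u"
      then show False using uy mem_irrefl by blast
    qed (use uy uneY uner unev unee uY unp r in \<open>auto simp: vmem wmem\<close>)
  qed
  \<comment> \<open>Every other element climbs a ladder: elements of \<open>Y\<close> lie in
    \<open>Y\<close>, \<open>Y\<close> in \<open>upair Y Y\<close>, this and
    \<open>upair Y r\<close> in \<open>v\<close>, \<open>v\<close> in \<open>w\<close>, and
    \<open>w\<close> in \<open>u\<close>.\<close>
  have top: "(\<forall>y. y \<^bold>\<in> Q \<longrightarrow> \<not> x \<^bold>\<in> y) \<longleftrightarrow> x = u" if "x \<^bold>\<in> Q" for x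
  proof
    assume *: "\<forall>y. y \<^bold>\<in> Q \<longrightarrow> \<not> x \<^bold>\<in> y"
    then have "\<not> x \<^bold>\<in> Y" "\<not> x \<^bold>\<in> upair Y Y" "\<not> x \<^bold>\<in> v" "\<not> x \<^bold>\<in> w" "\<not> x \<^bold>\<in> u"
      by (simp_all add: Qmem)
    with that show "x = u" by (auto simp: Qmem vmem wmem umem)
  qed (use umax in blast)
  have YQ: "Y \<^bold>\<subseteq> Q" by (simp add: subset_of_def Qmem)
  have omegaQ: "omega \<^bold>\<subseteq> Q" using omegaY YQ by (simp add: subset_of_def)
  have uQ: "u \<^bold>\<in> Q" by (simp add: Qmem)
  \<comment> \<open>\<open>u\<close> is fixed as the only maximal element. As embeddings commute
    with ordered pairs, injectivity of pairs passes this down to the components.\<close>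
  have fixed: "app j N = N \<and> app j SN = SN \<and> app j P = P \<and> app j SP = SP" if j: "elementary j Q Q" for j
  proof -
    have "app j u = u"
      using top[OF embedding_mem[OF Qtr j uQ]] embedding_maximal[OF Qtr j uQ umax] by blast
    moreover have "opair e v \<^bold>\<in> Q" "opair Y r \<^bold>\<in> Q" using uQ Qmem[of v] by (simp_all add: u_def v_def)
    ultimately have "app j r = r"
      using embedding_opair[OF Qtr j] by (simp add: u_def v_def)
    moreover have "r \<^bold>\<in> Q" "opair N SN \<^bold>\<in> Q" "opair P SP \<^bold>\<in> Q"
      using r Qmem Yop LY' L by simp_all
    ultimately show ?thesis
      using embedding_opair[OF Qtr j] by (simp add: r_def)
  qed
  have inQ: "N \<^bold>\<in> Q" "P \<^bold>\<in> Q" "SN \<^bold>\<in> Q" "SP \<^bold>\<in> Q" using Qmem LY' L by simp_all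
  have sub: "N \<^bold>\<subseteq> Q" "P \<^bold>\<subseteq> Q" "A \<^bold>\<subseteq> Q" using Qmem LY' L by (simp_all add: subset_of_def)
  have "N \<R> Q"
    unfolding accesses_def
    using sub(1) embedding_restriction[OF Qtr _ omegaQ Ycc YQ inQ(1) _ inQ(3) _ SN] fixed by blast
  moreover have "P \<R> Q"
    unfolding accesses_def
    using sub(2) embedding_restriction[OF Qtr _ omegaQ Ycc YQ inQ(2) _ inQ(4) _ SP] fixed by blast
  \<comment> \<open>\<open>Y\<close> is covered by the case of sets containing \<open>empty\<close>;
    assignments and satisfaction relations are sets of ordered pairs; \<open>v\<close>,
    \<open>w\<close> and \<open>u\<close> are unordered pairs.\<close>
  moreover have "x \<^bold>\<in> N \<or> x \<^bold>\<in> P \<or> x \<^bold>\<in> A \<or> natural x \<or> x = N \<or> x = P \<or> empty \<^bold>\<in> x \<or>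
      (\<exists>a b. x = upair a b) \<or> (\<forall>z. z \<^bold>\<in> x \<longrightarrow> (\<exists>a b. z = opair a b))" if "x \<^bold>\<in> Q" for x
  proof -
    have maps: "\<forall>z. z \<^bold>\<in> x \<longrightarrow> (\<exists>a b. z = opair a b)" if "maps x omega M" for M
      using that unfolding maps_def by blast
    have sat: "\<forall>z. z \<^bold>\<in> SN \<longrightarrow> (\<exists>a b. z = opair a b)" "\<forall>z. z \<^bold>\<in> SP \<longrightarrow> (\<exists>a b. z = opair a b)"
      using SN(2) SP(2) by blast+
    have up: "\<exists>a b. v = upair a b" "\<exists>a b. w = upair a b" "\<exists>a b. u = upair a b"
      unfolding v_def w_def u_def opair_def by blast+
    have "empty \<^bold>\<in> Y" using LY' L by simp
    then show ?thesis
      using \<open>x \<^bold>\<in> Q\<close> Yinv[of x] L[of x] maps sat up unfolding Qmem[of x] by metis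
  qed
  ultimately show thesis
    using that[OF Qtr sub _ _ _ uQ u_def top] by blast
qed

subsection \<open>The accessibility relation\<close>

lemma accesses_subset: "M \<R> N \<Longrightarrow> x \<^bold>\<in> M \<Longrightarrow> x \<^bold>\<in> N"
  by (simp add: accesses_def subset_of_def)

lemma accesses_refl: "M \<R> M"
proof -
  have "restriction j M = j" if "elementary j M M" for j
  proof (rule set_eqI)
    fix z
    show "z \<^bold>\<in> restriction j M \<longleftrightarrow> z \<^bold>\<in> j"
      unfolding restriction_mem using maps_memE[OF elementary_maps[OF that], of z] by blast
  qed
  then show ?thesis by (simp add: accesses_def subset_of_def)
qed

lemma accesses_trans:
  assumes MN: "M \<R> N" and NP: "N \<R> P"
  shows "M \<R> P"
proof -
  have "restriction (restriction j N) M = restriction j M" for j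
  proof (rule set_eqI)
    fix z
    show "z \<^bold>\<in> restriction (restriction j N) M \<longleftrightarrow> z \<^bold>\<in> restriction j M"
      unfolding restriction_mem using accesses_subset[OF MN] by blast
  qed
  with assms show ?thesis unfolding accesses_def subset_of_def by metis
qed

lemma accesses_directed:
  assumes "world \<delta> N" "world \<delta> P"
  obtains Q where "world \<delta> Q" "N \<R> Q" "P \<R> Q"
proof -
  have tr: "trans_set N" "trans_set P" and "\<delta> \<^bold>\<in> N" using assms by (simp_all add: world_def)
  obtain Q where "trans_set Q" "N \<R> Q" "P \<R> Q"
    by (rule world_extension[OF tr natural_empty, of empty]) auto
  with \<open>\<delta> \<^bold>\<in> N\<close> show thesis
    using that[of Q] accesses_subset[of N Q \<delta>] by (simp add: world_def)
qed

lemma psat_prop_eval: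
  "prop_eval (\<lambda>\<chi>. psat \<delta> (instantiate \<psi> \<chi>) M s) \<phi> \<longleftrightarrow> psat \<delta> (instantiate \<psi> \<phi>) M s"
  by (induction \<phi>) simp_all

theorem S4_2_sound:
  assumes "\<phi> \<in> S4_2" "world \<delta> M"
  shows "psat \<delta> (instantiate \<psi> \<phi>) M s"
  using assms
proof (induction arbitrary: M)
  case (taut \<phi>)
  then have "prop_eval (\<lambda>\<chi>. psat \<delta> (instantiate \<psi> \<chi>) M s) \<phi>" by (simp add: tautology_def)
  then show ?case by (simp only: psat_prop_eval)
next
  case (S \<phi>)
  then show ?case using accesses_refl by simp
next
  case (Four \<phi>)
  then show ?case using accesses_trans by simp blast
next
  case (Dot2 \<phi>)
  have "\<exists>Q. world \<delta> Q \<and> N \<R> Q \<and> psat \<delta> (instantiate \<psi> \<phi>) Q s"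
    if P: "world \<delta> P" and box: "\<forall>Q. world \<delta> Q \<and> P \<R> Q \<longrightarrow> psat \<delta> (instantiate \<psi> \<phi>) Q s"
      and N: "world \<delta> N" for N P
  proof -
    obtain Q where "world \<delta> Q" "N \<R> Q" "P \<R> Q" using N P by (rule accesses_directed)
    with box show ?thesis by blast
  qed
  then show ?case by auto
qed auto

subsection \<open>Buttons and dials\<close>

lemma numeral_of_mem [simp]: "numeral_of m \<^bold>\<in> numeral_of n \<longleftrightarrow> m < n"
  by (induction n) (auto simp: less_Suc_eq)

text \<open>Without 0 but with 1, it is not transitive, hence neither an ordinal nor natural, and it
  differs from all sets containing \<open>empty\<close>. The offset 4 guarantees the elements 1, 2,
  3, so it is no unordered pair; as 1 is no ordered pair, it is no set of ordered pairs either. The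
  offset also keeps the variable \<open>i + 4\<close> in the formulas clear of the bound variables 1
  and 2.\<close>

definition button :: "nat \<Rightarrow> 'v" where
  "button i = sep (numeral_of (i + 4)) (\<lambda>x. x \<noteq> empty)"

lemma mem_button: "x \<^bold>\<in> button i \<longleftrightarrow> x \<^bold>\<in> numeral_of (i + 4) \<and> x \<noteq> empty"
  unfolding button_def by (intro mem_sep definable_intros)

lemma numeral_of_mem_button [simp]: "numeral_of n \<^bold>\<in> button i \<longleftrightarrow> 0 < n \<and> n < i + 4"
  using numeral_of_inject[of n 0] unfolding mem_button by (auto simp del: numeral_of_inject)

lemma button_inject: "button i = button k \<Longrightarrow> i = k"
  using numeral_of_mem_button[of "i + 3" i] numeral_of_mem_button[of "i + 3" k]
    numeral_of_mem_button[of "k + 3" i] numeral_of_mem_button[of "k + 3" k] by simp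

lemma button_subset_omega: "button i \<^bold>\<subseteq> omega"
  unfolding subset_of_def mem_button mem_omega using natural_trans natural_numeral_of by blast

lemma empty_not_mem_button: "\<not> empty \<^bold>\<in> button i"
  by (simp add: mem_button)

lemma button_not_trans_set: "\<not> trans_set (button i)"
  using trans_setD[of "button i" "numeral_of 1" "numeral_of 0"]
    numeral_of_mem_button[of 1 i] numeral_of_mem_button[of 0 i] by auto

lemma button_not_upair: "button i \<noteq> upair a b"
proof
  assume eq: "button i = upair a b"
  have "numeral_of 1 \<^bold>\<in> button i" "numeral_of 2 \<^bold>\<in> button i" "numeral_of 3 \<^bold>\<in> button i"
    unfolding numeral_of_mem_button by simp_all
  then have "numeral_of 1 = a \<or> numeral_of 1 = b" "numeral_of 2 = a \<or> numeral_of 2 = b"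
    "numeral_of 3 = a \<or> numeral_of 3 = b"
    unfolding eq mem_upair by blast+
  moreover have "numeral_of 1 \<noteq> numeral_of 2" "numeral_of 1 \<noteq> numeral_of 3"
    "numeral_of 2 \<noteq> numeral_of 3"
    by (simp_all only: numeral_of_inject)
  ultimately show False by metis
qed

lemma button_mem_not_opair: "\<exists>z. z \<^bold>\<in> button i \<and> (\<forall>a b. z \<noteq> opair a b)"
proof (intro exI conjI allI notI)
  show "numeral_of 1 \<^bold>\<in> button i" unfolding numeral_of_mem_button by simp
  fix a b assume "numeral_of 1 = opair a b"
  then have "upair a a \<^bold>\<in> succ empty" by (simp add: opair_def)
  then have "upair a a = empty" by simp
  then show False using mem_upair[of a a a] by simp
qed

definition buttons :: "nat \<Rightarrow> 'v \<Rightarrow> nat set" where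
  "buttons k M = {i. i < k \<and> button i \<^bold>\<in> M}"

text \<open>The members of an ordered pair have its first component in common, so for
  \<open>u = opair e x\<close> the last clause says that \<open>e\<close> is the numeral. The
  reading is a set since an arbitrary world may satisfy the condition for no \<open>i\<close> or for
  several.\<close>

definition dials :: "nat \<Rightarrow> 'v \<Rightarrow> nat set" where
  "dials k M = {i. i < k \<and> (\<exists>u. u \<^bold>\<in> M \<and> (\<forall>y. y \<^bold>\<in> M \<longrightarrow> \<not> u \<^bold>\<in> y) \<and>
    (\<forall>v. v \<^bold>\<in> M \<longrightarrow> v \<^bold>\<in> u \<longrightarrow> numeral_of (i + 4) \<^bold>\<in> v))}"

lemma buttons_mono: "M \<R> N \<Longrightarrow> buttons k M \<subseteq> buttons k N"
  using accesses_subset by (auto simp: buttons_def)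

lemma button_set_exists: "finite I \<Longrightarrow> \<exists>A. \<forall>x. x \<^bold>\<in> A \<longleftrightarrow> x \<in> button ` I"
proof (induction I rule: finite_induct)
  case empty
  show ?case by (rule exI[of _ local.empty]) simp
next
  case (insert i I)
  then obtain A where "\<forall>x. x \<^bold>\<in> A \<longleftrightarrow> x \<in> button ` I" by blast
  then show ?case by (intro exI[of _ "un A (upair (button i) (button i))"]) auto
qed

text \<open>One extension of \<open>M\<close> does both: \<open>A\<close> supplies the requested
  buttons and the first component of \<open>u\<close> sets the dial. The list of kinds leaves a
  button no place except in \<open>M\<close> or \<open>A\<close>.\<close>

lemma push_buttons:
  assumes M: "world \<delta> M" and omega: "omega \<^bold>\<subseteq> M"
    and B: "buttons k M \<subseteq> B" "B \<subseteq> {..<k}" and i: "i < k"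
  obtains N where "world \<delta> N" "M \<R> N" "buttons k N = B" "dials k N = {i}"
proof -
  have tr: "trans_set M" and \<delta>: "\<delta> \<^bold>\<in> M" using M by (simp_all add: world_def)
  have "finite B" using B(2) finite_subset by blast
  then obtain A where A: "\<And>x. x \<^bold>\<in> A \<longleftrightarrow> x \<in> button ` B" using button_set_exists by blast
  have Aomega: "a \<^bold>\<subseteq> omega" if "a \<^bold>\<in> A" for a using that A button_subset_omega by auto
  let ?e = "numeral_of (i + 4)"
  have nat: "natural ?e" by (rule natural_numeral_of)
  obtain N u v where N: "trans_set N" "A \<^bold>\<subseteq> N" "M \<R> N"
    and kinds: "\<And>x. x \<^bold>\<in> N \<Longrightarrow> x \<^bold>\<in> M \<or> x \<^bold>\<in> M \<or> x \<^bold>\<in> A \<or> natural x \<or> x = M \<or> x = M \<or> empty \<^bold>\<in> x \<or>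
      (\<exists>a b. x = upair a b) \<or> (\<forall>z. z \<^bold>\<in> x \<longrightarrow> (\<exists>a b. z = opair a b))"
    and u: "u \<^bold>\<in> N" "u = opair ?e v"
    and top: "\<And>x. x \<^bold>\<in> N \<Longrightarrow> (\<forall>y. y \<^bold>\<in> N \<longrightarrow> \<not> x \<^bold>\<in> y) \<longleftrightarrow> x = u"
    by (rule world_extension[OF tr tr nat Aomega]) (assumption | blast)+
  have "world \<delta> N" using N(1) accesses_subset[OF N(3) \<delta>] by (simp add: world_def)
  \<comment> \<open>\<open>M\<close> may itself be an element of \<open>N\<close>; containing
    \<open>empty\<close>, it cannot be a button.\<close>
  have "empty \<^bold>\<in> M" using omega by (simp add: subset_of_def)
  have "button l \<^bold>\<in> N \<longleftrightarrow> l \<in> B" if "l < k" for l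
  proof
    assume "button l \<^bold>\<in> N"
    moreover have "\<not> natural (button l)" using button_not_trans_set natural_trans_set by blast
    moreover have "button l \<noteq> M" using \<open>empty \<^bold>\<in> M\<close> empty_not_mem_button by auto
    ultimately have "button l \<^bold>\<in> M \<or> button l \<^bold>\<in> A"
      using kinds empty_not_mem_button button_not_upair button_mem_not_opair by metis
    then show "l \<in> B"
      using that B(1) A button_inject by (auto simp: buttons_def)
  next
    assume "l \<in> B"
    then have "button l \<^bold>\<in> A" using A by blast
    then show "button l \<^bold>\<in> N" using N(2) by (auto intro: subset_ofD)
  qed
  then have "buttons k N = B" using B(2) by (auto simp: buttons_def)
  moreover have dial: "(\<forall>x. x \<^bold>\<in> N \<longrightarrow> x \<^bold>\<in> u \<longrightarrow> numeral_of (l + 4) \<^bold>\<in> x) \<longleftrightarrow> l = i" for l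
  proof -
    have iff: "x \<^bold>\<in> u \<longleftrightarrow> x = upair ?e ?e \<or> x = upair ?e v" for x unfolding u(2) opair_def by simp
    have "upair ?e ?e \<^bold>\<in> N" using trans_setD[OF N(1) u(1)] iff by blast
    moreover have "numeral_of (l + 4) = ?e \<longleftrightarrow> l = i" unfolding numeral_of_inject by simp
    ultimately show ?thesis unfolding iff by auto
  qed
  have "(\<exists>x. x \<^bold>\<in> N \<and> (\<forall>y. y \<^bold>\<in> N \<longrightarrow> \<not> x \<^bold>\<in> y) \<and>
      (\<forall>z. z \<^bold>\<in> N \<longrightarrow> z \<^bold>\<in> x \<longrightarrow> numeral_of (l + 4) \<^bold>\<in> z)) \<longleftrightarrow> l = i" for l
  proof -
    have "(\<exists>x. x \<^bold>\<in> N \<and> (\<forall>y. y \<^bold>\<in> N \<longrightarrow> \<not> x \<^bold>\<in> y) \<and>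
        (\<forall>z. z \<^bold>\<in> N \<longrightarrow> z \<^bold>\<in> x \<longrightarrow> numeral_of (l + 4) \<^bold>\<in> z)) \<longleftrightarrow>
      (\<forall>z. z \<^bold>\<in> N \<longrightarrow> z \<^bold>\<in> u \<longrightarrow> numeral_of (l + 4) \<^bold>\<in> z)"
      using top u(1) by metis
    then show ?thesis using dial by simp
  qed
  then have "dials k N = {i}" using i unfolding dials_def by auto
  ultimately show thesis using that \<open>world \<delta> N\<close> N(3) by blast
qed

text \<open>All elements of this world are transitive sets, and buttons are not. Adjoining
  \<open>omega\<close> makes the numerals available without any argument about the size of
  \<delta>.\<close>

lemma unpushed_world:
  assumes "ordinal \<delta>"
  obtains M where "world \<delta> M" "omega \<^bold>\<subseteq> M" "buttons k M = {}"
proof -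
  let ?M = "un (succ \<delta>) omega"
  have "trans_set ?M"
  proof (rule trans_setI)
    fix y z assume "y \<^bold>\<in> ?M" "z \<^bold>\<in> y"
    moreover have "trans_set \<delta>" using assms by (simp add: ordinal_def)
    ultimately show "z \<^bold>\<in> ?M" using trans_setD[of \<delta> y z] natural_trans[of y z] by auto
  qed
  then have "world \<delta> ?M" by (simp add: world_def)
  moreover have "trans_set x" if "x \<^bold>\<in> ?M" for x
    using that assms natural_trans_set by (auto simp: ordinal_def)
  then have "buttons k ?M = {}" using button_not_trans_set by (auto simp: buttons_def)
  ultimately show thesis using that[of ?M] by (simp add: subset_of_def)
qed

subsection \<open>Completeness\<close>

text \<open>Meant for the assignment \<open>numeral_of\<close>: variable 0 denotes the empty set and
  \<open>i + 4\<close> its numeral, both as parameters, while 1 and 2 are bound.\<close>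

definition button_fm :: "nat \<Rightarrow> pfm" where
  "button_fm i = PEx 1 (PAll 2 (PIff (PMem 2 1) (PAnd (PMem 2 (i + 4)) (PNeg (PEq 2 0)))))"

definition dial_fm :: "nat \<Rightarrow> pfm" where
  "dial_fm i = PEx 1 (PAnd (PAll 2 (PNeg (PMem 1 2))) (PAll 2 (PImp (PMem 2 1) (PMem (i + 4) 2))))"

text \<open>Absoluteness: the quantifiers see only \<open>M\<close>, but transitivity provides the
  members of the witness, and \<open>omega\<close> the members of the button.\<close>

lemma psat_button_fm:
  assumes "trans_set M" "omega \<^bold>\<subseteq> M"
  shows "psat \<delta> (button_fm i) M numeral_of \<longleftrightarrow> button i \<^bold>\<in> M"
proof -
  have "psat \<delta> (button_fm i) M numeral_of \<longleftrightarrow>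
    (\<exists>x. x \<^bold>\<in> M \<and> (\<forall>y. y \<^bold>\<in> M \<longrightarrow> (y \<^bold>\<in> x \<longleftrightarrow> y \<^bold>\<in> button i)))"
    by (simp add: button_fm_def mem_button)
  also have "\<dots> \<longleftrightarrow> (\<exists>x. x \<^bold>\<in> M \<and> x = button i)"
  proof -
    have "y \<^bold>\<in> M" if "y \<^bold>\<in> button i" for y
      using subset_ofD[OF assms(2) subset_ofD[OF button_subset_omega that]] .
    then have "(\<forall>y. y \<^bold>\<in> M \<longrightarrow> (y \<^bold>\<in> x \<longleftrightarrow> y \<^bold>\<in> button i)) \<longleftrightarrow> x = button i" if "x \<^bold>\<in> M" for x
      using trans_setD[OF assms(1) that] eq_set_iff[of x "button i"] by blast
    then show ?thesis by blast
  qed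
  finally show ?thesis by blast
qed

lemma psat_dial_fm:
  "psat \<delta> (dial_fm i) M numeral_of \<longleftrightarrow> (\<exists>u. u \<^bold>\<in> M \<and> (\<forall>y. y \<^bold>\<in> M \<longrightarrow> \<not> u \<^bold>\<in> y) \<and>
    (\<forall>v. v \<^bold>\<in> M \<longrightarrow> v \<^bold>\<in> u \<longrightarrow> numeral_of (i + 4) \<^bold>\<in> v))"
  by (simp add: dial_fm_def)

text \<open>A case split on the last assertion, repeated, yields a disjunctive normal form. It is
  uniform in \<open>M\<close>, so the same assertion can be evaluated at all worlds.\<close>

lemma boolean_combination:
  fixes n :: nat
  shows "\<exists>\<psi>. \<forall>M. psat \<delta> \<psi> M s \<longleftrightarrow> {i. i < n \<and> psat \<delta> (\<beta> i) M s} \<in> \<S>"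
proof (induction n arbitrary: \<S>)
  case 0
  show ?case
  proof (cases "{} \<in> \<S>")
    case True
    then show ?thesis by (intro exI[of _ "PEq 0 0"]) simp
  next
    case False
    then show ?thesis by (intro exI[of _ "PNeg (PEq 0 0)"]) simp
  qed
next
  case (Suc n)
  obtain \<psi>1 where 1: "\<And>M. psat \<delta> \<psi>1 M s \<longleftrightarrow> {i. i < n \<and> psat \<delta> (\<beta> i) M s} \<in> {X. insert n X \<in> \<S>}"
    using Suc[of "{X. insert n X \<in> \<S>}"] by blast
  obtain \<psi>0 where 0: "\<And>M. psat \<delta> \<psi>0 M s \<longleftrightarrow> {i. i < n \<and> psat \<delta> (\<beta> i) M s} \<in> \<S>"
    using Suc[of \<S>] by blast
  have "{i. i < Suc n \<and> psat \<delta> (\<beta> i) M s} =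
    (if psat \<delta> (\<beta> n) M s then insert n {i. i < n \<and> psat \<delta> (\<beta> i) M s}
     else {i. i < n \<and> psat \<delta> (\<beta> i) M s})" for M
    by (auto simp: less_Suc_eq)
  then show ?case
    by (intro exI[of _ "POr (PAnd (\<beta> n) \<psi>1) (PAnd (PNeg (\<beta> n)) \<psi>0)"]) (simp add: 0 1)
qed

theorem S4_2_valid_complete:
  assumes \<delta>: "ordinal \<delta>" and valid: "valid \<delta> \<phi>"
  shows "\<phi> \<in> S4_2"
proof (rule ccontr)
  assume "\<phi> \<notin> S4_2"
  then obtain W :: "mfm set set" and R V r where
    W: "finite W" "r \<in> W" "\<And>x. x \<in> W \<Longrightarrow> R x x" "\<And>x y z. R x y \<Longrightarrow> R y z \<Longrightarrow> R x z"
    "\<And>x. x \<in> W \<Longrightarrow> R r x" "\<And>x y. x \<in> W \<Longrightarrow> y \<in> W \<Longrightarrow> \<exists>z\<in>W. R x z \<and> R y z"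
    and refuted: "\<not> ksat W R V \<phi> r"
    by (rule S4_2_complete) blast
  obtain k :: nat and g where g: "\<And>B D. B \<subseteq> {..<k} \<Longrightarrow> g B D \<in> W"
    and forth: "\<And>B B' D D'. B \<subseteq> B' \<Longrightarrow> B' \<subseteq> {..<k} \<Longrightarrow> R (g B D) (g B' D')"
    and reach: "\<And>B D y. B \<subseteq> {..<k} \<Longrightarrow> y \<in> W \<Longrightarrow> R (g B D) y \<Longrightarrow>
      \<exists>B' i. B \<subseteq> B' \<and> B' \<subseteq> {..<k} \<and> i < k \<and> g B' {i} = y"
    and start: "\<And>D. R (g {} D) r"
    by (rule button_dial_morphism[of W r R]) (rule W; assumption | blast)+
  define h where "h M = g (buttons k M) (dials k M)" for M
  have buttons: "buttons k M \<subseteq> {..<k}" for M by (auto simp: buttons_def)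
  have hW: "h M \<in> W" for M using g buttons by (simp add: h_def)
  have h_forth: "R (h M) (h N)" if "M \<R> N" for M N
    using forth[OF buttons_mono[OF that] buttons] by (simp add: h_def)
  \<comment> \<open>With \<open>h_forth\<close> this makes \<open>h\<close> a bounded morphism on
    the worlds containing \<open>omega\<close>, though \<R> is far from finite.\<close>
  have h_back: "\<exists>N. world \<delta> N \<and> M \<R> N \<and> h N = y"
    if M: "world \<delta> M" "omega \<^bold>\<subseteq> M" and y: "y \<in> W" "R (h M) y" for M y
  proof -
    obtain B i where B: "buttons k M \<subseteq> B" "B \<subseteq> {..<k}" "i < k" "g B {i} = y"
      using reach[OF buttons y(1) y(2)[unfolded h_def]] by blast
    obtain N where "world \<delta> N" "M \<R> N" "buttons k N = B" "dials k N = {i}"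
      by (rule push_buttons[OF M B(1-3)])
    with B(4) show ?thesis by (auto simp: h_def)
  qed
  \<comment> \<open>Indices below \<open>k\<close> stand for buttons and those from \<open>k\<close>
    to \<open>2 * k - 1\<close> for dial positions; \<open>label\<close> unpacks this.\<close>
  define \<beta> where "\<beta> i = (if i < k then button_fm i else dial_fm (i - k))" for i
  define state where "state M = {i. i < 2 * k \<and> psat \<delta> (\<beta> i) M numeral_of}" for M
  define label where "label X = g {i. i < k \<and> i \<in> X} {i. i < k \<and> i + k \<in> X}" for X
  have label: "label (state M) = h M" if M: "world \<delta> M" "omega \<^bold>\<subseteq> M" for M
  proof -
    have "psat \<delta> (\<beta> i) M numeral_of \<longleftrightarrow> button i \<^bold>\<in> M" if "i < k" for i
      using psat_button_fm[of M \<delta> i] M that by (simp add: \<beta>_def world_def)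
    then have "{i. i < k \<and> i \<in> state M} = buttons k M"
      by (auto simp: state_def buttons_def)
    moreover have "{i. i < k \<and> i + k \<in> state M} = dials k M"
      by (auto simp: state_def dials_def \<beta>_def psat_dial_fm)
    ultimately show ?thesis by (simp add: label_def h_def)
  qed
  have "\<exists>\<psi>. \<forall>M. psat \<delta> \<psi> M numeral_of \<longleftrightarrow> state M \<in> {X. V (label X) n}" for n
    unfolding state_def by (rule boolean_combination)
  then obtain \<psi> where \<psi>: "\<And>n M. psat \<delta> (\<psi> n) M numeral_of \<longleftrightarrow> V (label (state M)) n"
    by (simp only: mem_Collect_eq) metis
  \<comment> \<open>The condition on \<open>omega\<close> persists along \<R>, so the induction
    stays among worlds where buttons and dial can be read and \<open>h_back\<close> applies.\<close>
  have truth: "psat \<delta> (instantiate \<psi> \<chi>) M numeral_of \<longleftrightarrow> ksat W R V \<chi> (h M)"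
    if "world \<delta> M" "omega \<^bold>\<subseteq> M" for \<chi> M
    using that
  proof (induction \<chi> arbitrary: M)
    case (Var i)
    then show ?case using \<psi> label by simp
  next
    case (MBox \<chi>)
    have "omega \<^bold>\<subseteq> N" if "M \<R> N" for N
      using MBox.prems(2) accesses_subset[OF that] by (simp add: subset_of_def)
    then have "psat \<delta> (instantiate \<psi> (MBox \<chi>)) M numeral_of \<longleftrightarrow>
      (\<forall>N. world \<delta> N \<and> M \<R> N \<longrightarrow> ksat W R V \<chi> (h N))"
      using MBox.IH by auto
    also have "\<dots> \<longleftrightarrow> ksat W R V (MBox \<chi>) (h M)"
      using h_back[OF MBox.prems] hW h_forth by (simp, metis)
    finally show ?case .
  next
    case (MDia \<chi>)
    have "omega \<^bold>\<subseteq> N" if "M \<R> N" for N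
      using MDia.prems(2) accesses_subset[OF that] by (simp add: subset_of_def)
    then have "psat \<delta> (instantiate \<psi> (MDia \<chi>)) M numeral_of \<longleftrightarrow>
      (\<exists>N. world \<delta> N \<and> M \<R> N \<and> ksat W R V \<chi> (h N))"
      using MDia.IH by auto
    also have "\<dots> \<longleftrightarrow> ksat W R V (MDia \<chi>) (h M)"
      using h_back[OF MDia.prems] hW h_forth by (simp, metis)
    finally show ?case .
  qed simp_all
  obtain M0 where M0: "world \<delta> M0" "omega \<^bold>\<subseteq> M0" "buttons k M0 = {}"
    by (rule unpushed_world[OF \<delta>])
  \<comment> \<open>The dial of \<open>M0\<close> is not controlled, so \<open>h M0\<close> is only
    known to lie below \<open>r\<close>; one more step reaches a world labelled exactly
    \<open>r\<close>.\<close>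
  then have "R (h M0) r" using start by (simp add: h_def)
  then obtain M where M: "world \<delta> M" "M0 \<R> M" "h M = r" using h_back[OF M0(1,2) W(2)] by blast
  have omega: "omega \<^bold>\<subseteq> M" using M0(2) accesses_subset[OF M(2)] by (simp add: subset_of_def)
  then have "numeral_of n \<^bold>\<in> M" for n by (simp add: subset_of_def)
  then have "psat \<delta> (instantiate \<psi> \<phi>) M numeral_of"
    using valid M(1) unfolding valid_def valid_at_def by blast
  with truth[OF M(1) omega] M(3) refuted show False by simp
qed

end

theorem theorem3p13:
  fixes E :: "'v \<Rightarrow> 'v \<Rightarrow> bool" and \<delta> :: 'v
  assumes "zf_model E"
    and "zf_model.berkeley E \<delta>"
  shows "{\<phi>. zf_model.valid E \<delta> \<phi>} = S4_2"
proof -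
  interpret zf_model E by (rule assms(1))
  have "ordinal \<delta>" using assms(2) by (simp add: berkeley_def cardinal_def)
  then show ?thesis
    using S4_2_valid_complete S4_2_sound by (auto simp: valid_def valid_at_def)
qed

end
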